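(* Let $H=1/2$, $n\ge2$, and let $b,\sigma,\bar X$ be as in the context, where the nonconstant $T$-periodic solution $\bar X$ of $\dot{\bar X}_t=b(\bar X_t)$, $\bar X_0=\bar X_T=x_0$, is transversally hyperbolic. Suppose that $\nabla(\nabla\cdot b)(\bar X_t)=0$ for all $t$. Then there exists $\epsilon_*>0$, independent of $N$, such that, for every $N\in\mathbb N^+$ and every $0<\epsilon<\epsilon_*$, $$\delta^2J_{\epsilon,N}(\bar X)[\eta,\eta]>0$$ for every nonzero $\eta\in\mathcal H_{1/2,0}^\sigma([0,NT];\mathbb R^n)$. More precisely, in the Floquet coordinates $$P(s)^{-1}\eta_s=\begin{pmatrix}z^0_s\\ z^\perp_s\end{pmatrix},$$ for every $0<\epsilon<\epsilon_*$ there exists $c_\epsilon>0$, independent of $N$, such that for all $N\in\mathbb N^+$ and all such $\eta$ $$\delta^2J_{\epsilon,N}(\bar X)[\eta,\eta]\ge c_\epsilon\left(\|(z^0)'\|_{L^2(0,NT)}^2+\|z^\perp\|_{H^1(0,NT)}^2\right).$$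
   Context: Setting. $b:\mathbb R^n\to\mathbb R^n$ is autonomous and of class $C_b^3$ (bounded with bounded continuous derivatives up to order three); $\sigma_t=\operatorname{diag}(\sigma^1_t,\dots,\sigma^n_t)$, $t\ge0$, is deterministic, $C^1$ and $T$-periodic with $0<m_i\le\sigma^i_t\le M_i$. Transversally hyperbolic: for the variational equation $\dot v=\nabla b(\bar X_t)v$, the Floquet multiplier $1$ is simple and every other Floquet multiplier $\mu$ satisfies $|\mu|\ne1$. Floquet coordinates. $P$ is a $T$-periodic Floquet matrix (real or complex, invertible for each $t$) whose first column is $\bar X'$, satisfying $P'(t)=\nabla b(\bar X_t)P(t)-P(t)R$ with constant $R=\begin{pmatrix}0&0\\0&R_\perp\end{pmatrix}$, where $R_\perp$ is $(n-1)\times(n-1)$ with no eigenvalue on the imaginary axis. Here $z^0$ is the first (tangential) component and $z^\perp$ the remaining $n-1$ (transverse) components. Spaces and second variation. $\mathcal H_{1/2,0}^\sigma([0,NT];\mathbb R^n)$ is the space of absolutely continuous $\eta:[0,NT]\to\mathbb R^n$ with $\eta'\in L^2$ and $\eta_0=\eta_{NT}=0$. The second variation at (the periodic extension of) $\bar X$ of the Onsager--Machlup functional $$J_{\epsilon,N}(\phi)=\frac1{2\epsilon}\int_0^{NT}|\sigma_t^{-1}(\phi_t'-b(\phi_t))|^2dt+\frac12\int_0^{NT}\nabla\cdot b(\phi_t)\,dt$$ is $$\delta^2J_{\epsilon,N}(\bar X)[\eta,\eta]=\frac1\epsilon\int_0^{NT}|\sigma_s^{-1}(\eta_s'-\nabla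 b(\bar X_s)\eta_s)|^2ds+\frac12\int_0^{NT}\eta_s^T\nabla^2(\nabla\cdot b)(\bar X_s)\eta_s\,ds .$$ *)

theory Defs
  imports "HOL-Analysis.Analysis" "HOL-Computational_Algebra.Polynomial"
begin

section \<open>Differential operators and coefficients\<close>

text \<open>\<open>Cb k f\<close> is membership in $C_b^k$.  In finite dimension it suffices to bound all iterated
  directional derivatives \<open>D\<^sub>v\<^sub>1 \<dots> D\<^sub>v\<^sub>j f\<close>, \<open>j \<le> k\<close>.\<close>
primrec Cb :: "nat \<Rightarrow> ('a::euclidean_space \<Rightarrow> 'b::euclidean_space) \<Rightarrow> bool" where
  "Cb 0 f \<longleftrightarrow> continuous_on UNIV f \<and> bounded (range f)"
| "Cb (Suc k) f \<longleftrightarrow> bounded (range f) \<and> (\<forall>x. f differentiable (at x)) \<and>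
     (\<forall>v. Cb k (\<lambda>x. frechet_derivative f (at x) v))"

definition divergence :: "(real^'n \<Rightarrow> real^'n) \<Rightarrow> real^'n \<Rightarrow> real" where
  "divergence b x = trace (jacobian b (at x))"

definition gradient :: "(real^'n \<Rightarrow> real) \<Rightarrow> real^'n \<Rightarrow> real^'n" where
  "gradient f x = (\<chi> i. frechet_derivative f (at x) (axis i 1))"

definition hessian :: "(real^'n \<Rightarrow> real) \<Rightarrow> real^'n \<Rightarrow> real^'n^'n" where
  "hessian f x = jacobian (gradient f) (at x)"

definition diag :: "real^'n \<Rightarrow> real^'n^'n" where
  "diag v = (\<chi> i j. if i = j then v $ i else 0)"

text \<open>\<open>\<sigma> t\<close> is the vector of diagonal entries of $\sigma_t$; only \<open>t \<ge> 0\<close> matters.\<close>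
definition noise_coefficient ::
    "real \<Rightarrow> real^'n \<Rightarrow> real^'n \<Rightarrow> (real \<Rightarrow> real^'n) \<Rightarrow> bool" where
  "noise_coefficient T m M \<sigma> \<longleftrightarrow>
     (\<exists>\<sigma>'. continuous_on {0..} \<sigma>' \<and>
        (\<forall>t\<ge>0. (\<sigma> has_vector_derivative \<sigma>' t) (at t within {0..}))) \<and>
     (\<forall>t\<ge>0. \<sigma> (t + T) = \<sigma> t) \<and>
     (\<forall>i. 0 < m $ i \<and> (\<forall>t\<ge>0. m $ i \<le> \<sigma> t $ i \<and> \<sigma> t $ i \<le> M $ i))"

text \<open>The periodic orbit is given through its periodic extension to the whole line.\<close>
definition periodic_orbit ::
    "(real^'n \<Rightarrow> real^'n) \<Rightarrow> real \<Rightarrow> real^'n \<Rightarrow> (real \<Rightarrow> real^'n) \<Rightarrow> bool" where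
  "periodic_orbit b T x0 X \<longleftrightarrow> T > 0 \<and>
     (\<forall>t. (X has_vector_derivative b (X t)) (at t)) \<and>
     (\<forall>t. X (t + T) = X t) \<and> X 0 = x0 \<and> X T = x0 \<and>
     (\<exists>s t. X s \<noteq> X t)"

section \<open>Floquet theory\<close>

definition cvec :: "real^'n \<Rightarrow> complex^'n" where
  "cvec v = (\<chi> i. complex_of_real (v $ i))"

definition cmat :: "real^'n^'n \<Rightarrow> complex^'n^'n" where
  "cmat A = (\<chi> i j. complex_of_real (A $ i $ j))"

definition charpoly :: "complex^'n^'n \<Rightarrow> complex poly" where
  "charpoly A = det (\<chi> i j. (if i = j then [:0, 1:] else 0) - [:A $ i $ j:])"

definition is_monodromy :: "(real \<Rightarrow> real^'n^'n) \<Rightarrow> real \<Rightarrow> real^'n^'n \<Rightarrow> bool" where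
  "is_monodromy A T U \<longleftrightarrow> (\<exists>\<Phi>. \<Phi> 0 = mat 1 \<and>
     (\<forall>t. (\<Phi> has_vector_derivative A t ** \<Phi> t) (at t)) \<and> U = \<Phi> T)"

text \<open>Floquet multipliers are the complex eigenvalues of the monodromy matrix (which exists and
  is unique, the variational equation being linear with continuous coefficients);
  simplicity is algebraic.\<close>
definition transversally_hyperbolic ::
    "(real^'n \<Rightarrow> real^'n) \<Rightarrow> real \<Rightarrow> (real \<Rightarrow> real^'n) \<Rightarrow> bool" where
  "transversally_hyperbolic b T X \<longleftrightarrow>
     (\<exists>U. is_monodromy (\<lambda>t. jacobian b (at (X t))) T U \<and>
        order 1 (charpoly (cmat U)) = 1 \<and>
        (\<forall>\<mu> v. v \<noteq> 0 \<and> cmat U *v v = \<mu> *s v \<and> \<mu> \<noteq> 1 \<longrightarrow> cmod \<mu> \<noteq> 1))"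

text \<open>The index \<open>k\<close> plays the role of the first coordinate.  \<open>transverse_eigenvalue k R \<mu>\<close> says that
  \<open>\<mu>\<close> is an eigenvalue of the block $R_\perp$ obtained from \<open>R\<close> by deleting row and column \<open>k\<close>;
  vectors of length $n-1$ are represented as vectors vanishing at \<open>k\<close>.\<close>
definition transverse_eigenvalue :: "'n::finite \<Rightarrow> complex^'n^'n \<Rightarrow> complex \<Rightarrow> bool" where
  "transverse_eigenvalue k R \<mu> \<longleftrightarrow>
     (\<exists>w::complex^'n. w \<noteq> 0 \<and> w $ k = 0 \<and>
        (\<forall>i. i \<noteq> k \<longrightarrow> (\<Sum>j\<in>UNIV - {k}. R $ i $ j * w $ j) = \<mu> * w $ i))"

text \<open>Real Floquet matrices are included via the embedding of real into complex matrices.\<close>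
definition floquet_matrix ::
    "(real^'n \<Rightarrow> real^'n) \<Rightarrow> real \<Rightarrow> (real \<Rightarrow> real^'n) \<Rightarrow> 'n \<Rightarrow>
     (real \<Rightarrow> complex^'n^'n) \<Rightarrow> complex^'n^'n \<Rightarrow> bool" where
  "floquet_matrix b T X k P R \<longleftrightarrow>
     (\<forall>t. P (t + T) = P t \<and> invertible (P t) \<and>
        column k (P t) = cvec (vector_derivative X (at t)) \<and>
        (P has_vector_derivative (cmat (jacobian b (at (X t))) ** P t - P t ** R)) (at t)) \<and>
     (\<forall>i. R $ i $ k = 0 \<and> R $ k $ i = 0) \<and>
     (\<forall>\<mu>. transverse_eigenvalue k R \<mu> \<longrightarrow> Re \<mu> \<noteq> 0)"

definition floquet_coord ::
    "(real \<Rightarrow> complex^'n^'n) \<Rightarrow> (real \<Rightarrow> real^'n) \<Rightarrow> real \<Rightarrow> complex^'n" where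
  "floquet_coord P \<eta> s = matrix_inv (P s) *v cvec (\<eta> s)"

definition tangential ::
    "'n \<Rightarrow> (real \<Rightarrow> complex^'n^'n) \<Rightarrow> (real \<Rightarrow> real^'n) \<Rightarrow> real \<Rightarrow> complex" where
  "tangential k P \<eta> s = floquet_coord P \<eta> s $ k"

definition transverse ::
    "'n::finite \<Rightarrow> (real \<Rightarrow> complex^'n^'n) \<Rightarrow> (real \<Rightarrow> real^'n) \<Rightarrow> real \<Rightarrow> complex^'n" where
  "transverse k P \<eta> s = (\<chi> i. if i = k then 0 else floquet_coord P \<eta> s $ i)"

section \<open>Function spaces and the second variation\<close>

definition absolutely_continuous_fun ::
    "real \<Rightarrow> real \<Rightarrow> (real \<Rightarrow> 'a::real_normed_vector) \<Rightarrow> bool" where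
  "absolutely_continuous_fun a b f \<longleftrightarrow>
     (\<forall>\<epsilon>>0. \<exists>\<delta>>0. \<forall>(n::nat) u v.
        (\<forall>i<n. a \<le> u i \<and> u i \<le> v i \<and> v i \<le> b) \<and>
        (\<forall>i<n. \<forall>j<n. i \<noteq> j \<longrightarrow> {u i<..<v i} \<inter> {u j<..<v j} = {}) \<and>
        (\<Sum>i<n. v i - u i) < \<delta>
        \<longrightarrow> (\<Sum>i<n. norm (f (v i) - f (u i))) < \<epsilon>)"

text \<open>Derivatives on \<open>[0,L]\<close> are pointwise almost everywhere; the one-sided choice at the
  endpoints makes them depend on the restriction to \<open>[0,L]\<close> only.\<close>
abbreviation deriv_on :: "real \<Rightarrow> (real \<Rightarrow> 'a::real_normed_vector) \<Rightarrow> real \<Rightarrow> 'a" where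
  "deriv_on L f s \<equiv> vector_derivative f (at s within {0..L})"

definition in_L2 :: "real \<Rightarrow> (real \<Rightarrow> 'a::euclidean_space) \<Rightarrow> bool" where
  "in_L2 L f \<longleftrightarrow> f \<in> borel_measurable (lebesgue_on {0..L}) \<and>
     integrable (lebesgue_on {0..L}) (\<lambda>s. (norm (f s))\<^sup>2)"

definition norm_L2 :: "real \<Rightarrow> (real \<Rightarrow> 'a::euclidean_space) \<Rightarrow> real" where
  "norm_L2 L f = sqrt (\<integral>s. (norm (f s))\<^sup>2 \<partial>lebesgue_on {0..L})"

definition norm_H1 :: "real \<Rightarrow> (real \<Rightarrow> 'a::euclidean_space) \<Rightarrow> real" where
  "norm_H1 L f = sqrt ((norm_L2 L f)\<^sup>2 + (norm_L2 L (deriv_on L f))\<^sup>2)"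

text \<open>The space $\mathcal H_{1/2,0}^\sigma([0,L])$.  Differentiability almost everywhere is part of
  the meaning of $\eta' \in L^2$ (and is automatic for absolutely continuous functions);
  it is spelled out because \<open>vector_derivative\<close> is total.\<close>
definition H_half_0 :: "real \<Rightarrow> (real \<Rightarrow> real^'n) set" where
  "H_half_0 L = {\<eta>. absolutely_continuous_fun 0 L \<eta> \<and>
     (AE s in lebesgue_on {0..L}. \<eta> differentiable (at s within {0..L})) \<and>
     in_L2 L (deriv_on L \<eta>) \<and> \<eta> 0 = 0 \<and> \<eta> L = 0}"

text \<open>The second variation at \<open>X\<close>, on \<open>[0,L]\<close> with \<open>L = N T\<close>, of the Onsager--Machlup functional
  $\frac1{2\epsilon}\int_0^L|\sigma_t^{-1}(\phi_t'-b(\phi_t))|^2dt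
   + \frac12\int_0^L\nabla\cdot b(\phi_t)\,dt$.
  The contribution of the second derivative of \<open>b\<close> to the first integral is absent because
  $X' = b(X)$.\<close>
definition second_variation ::
    "(real^'n \<Rightarrow> real^'n) \<Rightarrow> (real \<Rightarrow> real^'n) \<Rightarrow> (real \<Rightarrow> real^'n) \<Rightarrow> real \<Rightarrow> real \<Rightarrow>
     (real \<Rightarrow> real^'n) \<Rightarrow> real" where
  "second_variation b \<sigma> X \<epsilon> L \<eta> =
     1 / \<epsilon> * (\<integral>s. (norm (matrix_inv (diag (\<sigma> s)) *v
                 (deriv_on L \<eta> s - jacobian b (at (X s)) *v \<eta> s)))\<^sup>2 \<partial>lebesgue_on {0..L})
     + 1 / 2 * (\<integral>s. \<eta> s \<bullet> (hessian (divergence b) (X s) *v \<eta> s) \<partial>lebesgue_on {0..L})"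

end

theory Submission
  imports Defs
begin

text \<open>
  Write \<open>f = \<eta>' - \<nabla>b(X) \<eta>\<close>, let \<open>U\<close> be the monodromy matrix and let \<open>l\<close> be its left eigenvector for the simple
  multiplier 1, normalized by \<open>l \<bullet> X'(0) = 1\<close>.  Subtracting from \<open>\<eta>\<close> its spectral component along \<open>X'\<close> gives the
  transverse part \<open>\<eta>\<^sup>\<bottom>\<close>, and everything rests on \<open>\<parallel>\<eta>\<^sup>\<bottom>\<parallel> \<le> C \<parallel>f\<parallel>\<close> in \<open>L\<^sup>2(0, N T)\<close> with \<open>C\<close>
  independent of \<open>N\<close>.  By variation of constants on each period this reduces to the recursion
  \<open>p (j + 1) = B (p j) + g j\<close> for the transverse values at the times \<open>j T\<close>, where \<open>B\<close> is \<open>U\<close> with the eigenvalue 1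
  deflated to 0.  Because \<open>\<eta>\<close> vanishes at both ends the sequence is \<open>N\<close>-periodic, and a discrete Fourier
  transform turns the recursion into the resolvents \<open>(\<mu> - B)\<^sup>-\<^sup>1\<close> with \<open>\<bar>\<mu>\<bar> = 1\<close>, which hyperbolicity bounds
  uniformly.  No Floquet matrix has to be constructed.

  Differentiating \<open>\<nabla>(\<nabla> \<cdot> b)(X t) = 0\<close> in \<open>t\<close> puts \<open>X'\<close> in the kernel of the (symmetric) Hessian, so the
  potential term is at most a multiple of \<open>\<parallel>\<eta>\<^sup>\<bottom>\<parallel>\<^sup>2\<close> and is absorbed by \<open>\<parallel>f\<parallel>\<^sup>2 / \<epsilon>\<close> for small \<open>\<epsilon>\<close>.
  Finally, for any Floquet matrix \<open>P\<close>, the tangential row of \<open>P\<^sup>-\<^sup>1\<close> is \<open>l\<close> transported by the adjoint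
  flow; hence \<open>z\<^sup>\<bottom> = P\<^sup>-\<^sup>1 \<eta>\<^sup>\<bottom>\<close>, and \<open>z' = P\<^sup>-\<^sup>1 f + R z\<close> bounds the derivatives by \<open>f\<close> and \<open>\<eta>\<^sup>\<bottom>\<close>.
\<close>

section \<open>Simple eigenvalues\<close>

text \<open>The tangential coordinate itself has no bound uniform in \<open>N\<close>: for the
  profile \<open>sin (pi * s / (N * T))\<close> times the velocity, its L2 norm is of order
  \<open>N\<close> times that of the residual. So the potential term must not see this direction at
  all, and only the derivative of that coordinate can enter the final estimate. In transverse
  directions the fundamental matrix may grow or decay exponentially. All analytic bounds are
  therefore taken on one period, with the flow restarted at its left end, and the passage to
  \<open>N\<close> periods is purely algebraic. There the Fourier transform needs only that the unit
  circle carries no eigenvalue, with no splitting into stable and unstable subspaces. Deflation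
  replaces restriction to a complement of the velocity: matrices keep their full size, the projected
  sequence stays in the kernel of \<open>l\<close>, where \<open>B\<close> and \<open>U\<close>
  agree, and the only unimodular multiplier is moved to 0. The threshold for \<epsilon> lets the
  potential consume at most half of the energy of \<open>f\<close>; the other half is the lower
  bound that remains.\<close>

lemma poly_charpoly: "poly (charpoly A) x = det (mat x - A)"
proof -
  have "poly (charpoly A) x =
      (\<Sum>p\<in>{p. p permutes UNIV}. of_int (sign p) *
        (\<Prod>i\<in>UNIV. poly ((if i = p i then [:0, 1:] else 0) - [:A $ i $ p i:]) x))"
    unfolding charpoly_def det_def by (simp add: poly_sum poly_prod)
  also have "\<dots> = det (mat x - A)"
    unfolding det_def by (intro sum.cong refl arg_cong2[where f = "(*)"] prod.cong) (auto simp: mat_def)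
  finally show ?thesis .
qed

text \<open>\<open>order\<close> carries information only for a nonzero polynomial. If this one
  vanished, every number would be an eigenvalue, even one larger than the operator bound
  \<open>K\<close>.\<close>

lemma charpoly_nonzero: "charpoly (A::complex^'n^'n) \<noteq> 0"
proof
  assume "charpoly A = 0"
  then have det0: "det (mat x - A) = 0" for x
    by (metis poly_0 poly_charpoly)
  have bl: "bounded_linear (\<lambda>v. A *v v)"
    by (intro linear_conv_bounded_linear[THEN iffD1] linearI)
      (auto simp: matrix_vector_mult_def vec_eq_iff scaleR_sum_right sum.distrib ring_distribs)
  obtain K where K: "\<And>v. norm (A *v v) \<le> norm v * K"
    using bounded_linear.bounded[OF bl] by blast
  have "\<not> invertible (mat (of_real (\<bar>K\<bar> + 1)) - A)"
    by (simp add: invertible_det_nz det0)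
  then obtain v where v: "v \<noteq> 0" "(mat (of_real (\<bar>K\<bar> + 1)) - A) *v v = 0"
    unfolding invertible_left_inverse matrix_left_invertible_ker by blast
  have "A *v v = mat (of_real (\<bar>K\<bar> + 1)) *v v"
    using v(2) by (simp add: matrix_vector_mult_diff_rdistrib)
  also have "\<dots> = (\<bar>K\<bar> + 1) *\<^sub>R v"
    by (simp add: vec_eq_iff matrix_vector_mult_def mat_def if_distrib[of "\<lambda>x. x * _"] cong: if_cong)
       (simp add: scaleR_conv_of_real)
  finally have "norm (A *v v) = (\<bar>K\<bar> + 1) * norm v" by simp
  with K[of v] have "(\<bar>K\<bar> + 1 - K) * norm v \<le> 0" by (simp add: algebra_simps)
  moreover have "(\<bar>K\<bar> + 1 - K) * norm v > 0" using v(1) by (intro mult_pos_pos) auto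
  ultimately show False by simp
qed

text \<open>The column counterpart of \<open>det_row_mul\<close>, in the matrix shape that
  \<open>cramer_lemma\<close> produces.\<close>

lemma det_column_scale:
  fixes B :: "'a::comm_ring_1^'n^'n"
  shows "det (\<chi> i j. if j = k then c * v $ i else B $ i $ j) = c * det (\<chi> i j. if j = k then v $ i else B $ i $ j)"
proof -
  have "transpose (\<chi> i j. if j = k then c * v $ i else B $ i $ j) = (\<chi> j. if j = k then c *s v else column j B)"
    "transpose (\<chi> i j. if j = k then v $ i else B $ i $ j) = (\<chi> j. if j = k then v else column j B)"
    by (auto simp: vec_eq_iff transpose_def column_def)
  note tr = this
  have "det (\<chi> i j. if j = k then c * v $ i else B $ i $ j) = det (\<chi> j. if j = k then c *s v else column j B)"
    unfolding tr(1)[symmetric] det_transpose ..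
  also have "\<dots> = c * det (\<chi> j. if j = k then v else column j B)"
    using det_row_mul[where k = k and c = c and a = "\<lambda>_. v" and b = "\<lambda>j. column j B"] by (simp only:)
  also have "det (\<chi> j. if j = k then v else column j B) = det (\<chi> i j. if j = k then v $ i else B $ i $ j)"
    unfolding tr(2)[symmetric] det_transpose ..
  finally show ?thesis .
qed

text \<open>By Cramer's rule \<open>v $ k\<close> times the characteristic polynomial is \<open>x - 1\<close> times the determinant of
  \<open>x - U\<close> with its \<open>k\<close>-th column replaced by \<open>v\<close>; a simple root at \<open>1\<close> makes the latter nonzero.\<close>
lemma simple_eigenvalue_bordered_det:
  fixes U :: "complex^'n^'n"
  assumes ord: "order 1 (charpoly U) = 1" and Uv: "U *v v = v" and vk: "v $ k \<noteq> 0"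
  shows "det (\<chi> i j. if j = k then v $ i else (mat 1 - U) $ i $ j) \<noteq> 0"
proof -
  define D where "D x = det (\<chi> i j. if j = k then v $ i else (mat x - U) $ i $ j)" for x
  obtain r where r: "charpoly U = [:-1, 1:] * r" "\<not> [:-1, 1:] dvd r"
    using order_decomp[OF charpoly_nonzero, of U 1] ord by auto
  have r1: "poly r 1 \<noteq> 0" using r(2) by (simp add: poly_eq_0_iff_dvd)
  have D_eq: "D x = v $ k * poly r x" if "x \<noteq> 1" for x
  proof -
    have xv: "(mat x - U) *v v = (x - 1) *s v"
      by (simp add: matrix_vector_mult_diff_rdistrib Uv)
         (simp add: vec_eq_iff matrix_vector_mult_def mat_def if_distrib[of "\<lambda>x. x * _"] left_diff_distrib cong: if_cong)
    have "(x - 1) * D x = v $ k * det (mat x - U)"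
      using cramer_lemma[where A = "mat x - U" and x = v and k = k]
      unfolding D_def det_column_scale[symmetric] xv vector_smult_component .
    also have "\<dots> = (x - 1) * (v $ k * poly r x)"
      unfolding poly_charpoly[symmetric] r(1) by (simp add: algebra_simps)
    finally show ?thesis using that by simp
  qed
  \<comment> \<open>Cancelling \<open>x - 1\<close> says nothing at \<open>x = 1\<close>, so the
    value there is recovered as a limit.\<close>
  have "continuous_on UNIV (\<lambda>x. if j = k then v $ i else (mat x - U) $ i $ j)" for i j
    by (cases "j = k"; cases "i = j") (auto simp: mat_def intro!: continuous_intros)
  then have "continuous_on UNIV D"
    unfolding D_def det_def vec_lambda_beta by (intro continuous_intros) auto
  then have "(D \<longlongrightarrow> D 1) (at 1)"
    by (simp add: continuous_on_eq_continuous_at isCont_def)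
  moreover have "((\<lambda>x. v $ k * poly r x) \<longlongrightarrow> v $ k * poly r 1) (at 1)"
    by (intro tendsto_intros)
  then have "(D \<longlongrightarrow> v $ k * poly r 1) (at 1)"
    by (rule Lim_transform_eventually) (auto simp: eventually_at_filter D_eq)
  ultimately have "D 1 = v $ k * poly r 1"
    by (rule tendsto_unique[rotated]) simp
  with r1 vk show ?thesis by (simp add: D_def)
qed

text \<open>Bilinear rather than Hermitian, so that a row of a matrix acts as a linear functional
  and left eigenvectors need no conjugation.\<close>

definition dotc :: "complex^'n \<Rightarrow> complex^'n \<Rightarrow> complex" where
  "dotc x y = (\<Sum>i\<in>UNIV. x $ i * y $ i)"

lemma dotc_mult: "dotc q (A *v x) = dotc (q v* A) x"
proof -
  have "dotc q (A *v x) = (\<Sum>i\<in>UNIV. \<Sum>j\<in>UNIV. q $ i * (A $ i $ j * x $ j))"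
    by (simp add: dotc_def matrix_vector_mult_def sum_distrib_left)
  also have "\<dots> = (\<Sum>j\<in>UNIV. \<Sum>i\<in>UNIV. q $ i * (A $ i $ j * x $ j))" by (rule sum.swap)
  also have "\<dots> = dotc (q v* A) x"
    by (simp add: dotc_def vector_matrix_mult_def sum_distrib_left sum_distrib_right algebra_simps)
  finally show ?thesis .
qed

text \<open>Such a vector never meets the replaced column. This is how invertibility of the bordered
  matrix becomes information about \<open>mat 1 - U\<close>.\<close>

lemma bordered_mult_vec:
  fixes U :: "complex^'n^'n"
  assumes "u $ k = 0"
  shows "(\<chi> i j. if j = k then v $ i else (mat 1 - U) $ i $ j) *v u = u - U *v u"
proof -
  have "(\<chi> i j. if j = k then v $ i else (mat 1 - U) $ i $ j) *v u = (mat 1 - U) *v u"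
    unfolding matrix_vector_mult_def vec_eq_iff using assms by (auto intro!: sum.cong)
  then show ?thesis by (simp add: matrix_vector_mult_diff_rdistrib)
qed

context
  fixes U :: "complex^'n^'n" and v :: "complex^'n"
  assumes ord: "order 1 (charpoly U) = 1" and Uv: "U *v v = v" and v0: "v \<noteq> 0"
begin

text \<open>Subtracting the multiple of \<open>v\<close> that cancels the \<open>k\<close>-th entry
  of \<open>u\<close> leaves a fixed vector on which the bordered matrix acts as
  \<open>mat 1 - U\<close>, that is, as 0. Invertibility makes it 0.\<close>

lemma simple_eigenvalue_kernel:
  assumes Uu: "U *v u = u"
  shows "\<exists>c. u = c *s v"
proof -
  obtain k where vk: "v $ k \<noteq> 0" using v0 by (auto simp: vec_eq_iff)
  define N where "N = (\<chi> i j. if j = k then v $ i else (mat 1 - U) $ i $ j)"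
  have "invertible N" using simple_eigenvalue_bordered_det[OF ord Uv vk] by (simp add: invertible_det_nz N_def)
  define c where "c = u $ k / v $ k"
  have "(u - c *s v) $ k = 0" using vk by (simp add: c_def)
  from bordered_mult_vec[OF this, of v U]
  have "N *v (u - c *s v) = 0"
    unfolding N_def[symmetric] by (simp add: matrix_vector_mult_diff_distrib Uu Uv vec.scale)
  then have "u - c *s v = 0"
    using \<open>invertible N\<close> unfolding invertible_left_inverse matrix_left_invertible_ker by blast
  then show ?thesis by auto
qed

text \<open>The two functionals agree on the range of the bordered matrix: on \<open>v\<close> by
  normalization, on every \<open>y - U *v y\<close> by invariance. That range is the whole
  space.\<close>

lemma simple_eigenvalue_left_unique:
  assumes "dotc q v = 1" "dotc q' v = 1"
    and "\<And>x. dotc q (U *v x) = dotc q x" "\<And>x. dotc q' (U *v x) = dotc q' x"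
  shows "q = q'"
proof -
  obtain k where vk: "v $ k \<noteq> 0" using v0 by (auto simp: vec_eq_iff)
  define N where "N = (\<chi> i j. if j = k then v $ i else (mat 1 - U) $ i $ j)"
  have inv: "invertible N" using simple_eigenvalue_bordered_det[OF ord Uv vk] by (simp add: invertible_det_nz N_def)
  have dotc_diff: "dotc (a - b) x = dotc a x - dotc b x" "dotc x (a - b) = dotc x a - dotc x b" for a b x
    by (simp_all add: dotc_def algebra_simps sum_subtractf)
  have dotc_add: "dotc x (a + b) = dotc x a + dotc x b" and dotc_scale: "dotc x (c *s a) = c * dotc x a" for a b x c
    by (simp_all add: dotc_def algebra_simps sum.distrib sum_distrib_left)
  have ax: "N *v axis k 1 = v"
    by (simp add: matrix_vector_mult_def N_def axis_def vec_eq_iff if_distrib cong: if_cong)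
  have "dotc (q - q') (N *v x) = 0" for x
  proof -
    define y where "y = x - x $ k *s axis k 1"
    have x: "x = y + x $ k *s axis k 1" by (simp add: y_def)
    have "y $ k = 0" by (simp add: y_def)
    then have "N *v y = y - U *v y" unfolding N_def by (rule bordered_mult_vec)
    then have "N *v x = (y - U *v y) + x $ k *s v"
      by (subst x) (simp add: matrix_vector_right_distrib vec.scale ax)
    then show ?thesis using assms by (simp add: dotc_add dotc_diff dotc_scale)
  qed
  moreover have "\<exists>x. N *v x = y" for y
    using inv unfolding invertible_right_inverse matrix_right_invertible_surjective by (metis surjD)
  ultimately have "dotc (q - q') y = 0" for y by metis
  from this[of "axis _ 1"] show ?thesis
    by (simp add: dotc_def axis_def vec_eq_iff if_distrib cong: if_cong)
qed

text \<open>The functional is row \<open>k\<close> of the inverse of the bordered matrix. It is 1 on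
  \<open>v\<close>, the image of the \<open>k\<close>-th unit vector, and 0 on
  \<open>y - U *v y\<close> whenever \<open>y $ k = 0\<close>; a multiple of \<open>v\<close>
  reduces any vector to that case.\<close>

lemma simple_eigenvalue_left_exists:
  "\<exists>q. dotc q v = 1 \<and> (\<forall>x. dotc q (U *v x) = dotc q x)"
proof -
  obtain k where vk: "v $ k \<noteq> 0" using v0 by (auto simp: vec_eq_iff)
  define N where "N = (\<chi> i j. if j = k then v $ i else (mat 1 - U) $ i $ j)"
  have "invertible N" using simple_eigenvalue_bordered_det[OF ord Uv vk] by (simp add: invertible_det_nz N_def)
  then obtain N' where N': "N' ** N = mat 1" unfolding invertible_left_inverse by blast
  define q where "q = N' $ k"
  have qN: "dotc q (N *v x) = x $ k" for x
  proof -
    have "dotc q (N *v x) = (N' *v (N *v x)) $ k"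
      by (simp add: dotc_def q_def matrix_vector_mult_def)
    also have "\<dots> = x $ k" by (simp add: matrix_vector_mul_assoc N')
    finally show ?thesis .
  qed
  have dotc_diff: "dotc x (a - b) = dotc x a - dotc x b" for a b x
    by (simp_all add: dotc_def algebra_simps sum_subtractf)
  have ax: "N *v axis k 1 = v"
    by (simp add: matrix_vector_mult_def N_def axis_def vec_eq_iff if_distrib cong: if_cong)
  have "dotc q v = 1" using qN[of "axis k 1"] by (simp add: ax)
  moreover have "dotc q (U *v x) = dotc q x" for x
  proof -
    define y where "y = x - (x $ k / v $ k) *s v"
    have y0: "y $ k = 0" using vk by (simp add: y_def)
    then have "N *v y = y - U *v y" unfolding N_def by (rule bordered_mult_vec)
    then have "dotc q (y - U *v y) = 0" using qN[of y] y0 by simp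
    moreover have "y - U *v y = x - U *v x"
      by (simp add: y_def matrix_vector_mult_diff_distrib vec.scale Uv)
    ultimately show ?thesis by (simp add: dotc_diff)
  qed
  ultimately show ?thesis by blast
qed

end

section \<open>Transfer between real and complex matrices\<close>

lemma cmat_mult_cvec: "cmat A *v cvec x = cvec (A *v x)"
  by (simp add: cmat_def cvec_def matrix_vector_mult_def vec_eq_iff)

lemma dotc_cvec: "dotc (cvec x) (cvec y) = complex_of_real (x \<bullet> y)"
  by (simp add: dotc_def cvec_def inner_vec_def)

lemma dotc_cvec_left_fixed:
  assumes "\<And>x. l \<bullet> (U *v x) = l \<bullet> x"
  shows "dotc (cvec l) (cmat U *v y) = dotc (cvec l) y"
proof -
  have "(l v* U) \<bullet> x = l \<bullet> x" for x
    unfolding dot_lmul_matrix by (rule assms)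
  then have "l v* U = l"
    by (intro vector_eq_rdot[THEN iffD1]) blast
  moreover have "cvec l v* cmat U = cvec (l v* U)"
    by (simp add: vector_matrix_mult_def cvec_def cmat_def vec_eq_iff)
  ultimately show ?thesis by (simp add: dotc_mult)
qed

text \<open>The real parts of a complex left eigenvector form a real one, because \<open>U\<close>
  and \<open>v\<close> are real.\<close>

lemma simple_eigenvalue_left_real:
  assumes ord: "order 1 (charpoly (cmat U)) = 1" and Uv: "U *v v = v" and v0: "v \<noteq> 0"
  obtains l where "l \<bullet> v = 1" "\<And>x. l \<bullet> (U *v x) = l \<bullet> x"
proof -
  have "cmat U *v cvec v = cvec v" "cvec v \<noteq> 0"
    using Uv v0 by (auto simp: cmat_mult_cvec) (auto simp: cvec_def vec_eq_iff)
  from simple_eigenvalue_left_exists[OF ord this]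
  obtain q where q: "dotc q (cvec v) = 1" "\<And>x. dotc q (cmat U *v x) = dotc q x" by blast
  define l where "l = (\<chi> i. Re (q $ i))"
  have Re: "Re (dotc q (cvec x)) = l \<bullet> x" for x
    by (simp add: dotc_def cvec_def l_def inner_vec_def)
  show ?thesis
    by (rule that[of l]; metis q Re cmat_mult_cvec one_complex.sel(1))
qed

text \<open>An eigenvector of the deflated matrix for a nonzero eigenvalue is annihilated by \<open>l\<close>, hence it is
  an eigenvector of \<open>U\<close> itself.\<close>
lemma deflated_no_unimodular_eigenvalue:
  assumes ord: "order 1 (charpoly (cmat U)) = 1" and Uv: "U *v v = v" and v0: "v \<noteq> 0"
    and l: "l \<bullet> v = 1" "\<And>x. l \<bullet> (U *v x) = l \<bullet> x"
    and hyp: "\<And>\<mu> w. w \<noteq> 0 \<Longrightarrow> cmat U *v w = \<mu> *s w \<Longrightarrow> \<mu> \<noteq> 1 \<Longrightarrow> cmod \<mu> \<noteq> 1"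
    and \<mu>: "cmod \<mu> = 1" and w: "cmat (\<chi> i j. U $ i $ j - v $ i * l $ j) *v w = \<mu> *s w"
  shows "w = 0"
proof (rule ccontr)
  assume w0: "w \<noteq> 0"
  have Uv': "cmat U *v cvec v = cvec v" "cvec v \<noteq> 0"
    using Uv v0 by (auto simp: cmat_mult_cvec) (auto simp: cvec_def vec_eq_iff)
  define q where "q = cvec l"
  have q1: "dotc q (cvec v) = 1" by (simp add: q_def dotc_cvec l)
  have qU: "dotc q (cmat U *v x) = dotc q x" for x
    unfolding q_def by (rule dotc_cvec_left_fixed[OF l(2)])
  have eq: "cmat U *v w - dotc q w *s cvec v = \<mu> *s w"
  proof -
    have "(\<mu> *s w) $ i = (\<Sum>j\<in>UNIV. (U $ i $ j - v $ i * l $ j) * w $ j)" for i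
      unfolding w[symmetric] by (simp add: cmat_def matrix_vector_mult_def)
    also have "\<dots> i = (\<Sum>j\<in>UNIV. U $ i $ j * w $ j) - v $ i * (\<Sum>j\<in>UNIV. l $ j * w $ j)" for i
      by (simp add: left_diff_distrib sum_subtractf sum_distrib_left mult.assoc)
    finally show ?thesis
      by (simp add: vec_eq_iff cmat_def cvec_def q_def dotc_def matrix_vector_mult_def mult.commute)
  qed
  \<comment> \<open>Pairing the eigenvalue equation with \<open>q\<close> makes its left side 0:
    invariance and normalization of \<open>q\<close> cancel the deflation term.\<close>
  have "dotc q (\<mu> *s w) = \<mu> * dotc q w" by (simp add: dotc_def sum_distrib_left algebra_simps)
  moreover have "dotc q (cmat U *v w - dotc q w *s cvec v) = dotc q (cmat U *v w) - dotc q w * dotc q (cvec v)"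
    by (simp add: dotc_def sum_subtractf sum_distrib_left algebra_simps)
  ultimately have "\<mu> * dotc q w = 0" using eq by (simp add: qU q1)
  then have qw: "dotc q w = 0" using \<mu> by auto
  then have Uw: "cmat U *v w = \<mu> *s w" using eq by simp
  show False
  proof (cases "\<mu> = 1")
    case True
    then obtain c where c: "w = c *s cvec v"
      using simple_eigenvalue_kernel[OF ord Uv'] Uw by auto
    have "dotc q w = c * dotc q (cvec v)" unfolding c by (simp add: dotc_def sum_distrib_left algebra_simps)
    then have "c = 0" using qw q1 by simp
    then show False using c w0 by simp
  next
    case False
    then show False using hyp[OF w0 Uw] \<mu> by simp
  qed
qed

section \<open>Periodic sequences and the discrete Fourier transform\<close>

text \<open>Orthogonality of the characters of the cyclic group of order \<open>N\<close>: the ratio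
  of two distinct \<open>N\<close>-th roots of unity is an \<open>N\<close>-th root of unity other
  than 1, so its geometric sum vanishes.\<close>

lemma sum_root_unity_powers:
  assumes N: "N \<ge> (1::nat)" and jk: "j < N" "k < N"
  defines "\<omega> \<equiv> cis (2 * pi / real N)"
  shows "(\<Sum>m<N. (\<omega> ^ j * cnj (\<omega> ^ k)) ^ m) = (if j = k then of_nat N else 0)"
proof -
  have w: "\<omega> ^ j = cis (2 * pi * real j / real N)" for j
    by (simp add: \<omega>_def Complex.DeMoivre mult.commute)
  have unit: "\<omega> ^ k * cnj (\<omega> ^ k) = 1"
    by (simp add: w cis_cnj cis_mult del: complex_cnj_power)
  define z where "z = \<omega> ^ j * cnj (\<omega> ^ k)"
  have wN: "\<omega> ^ N = 1"
    using N by (simp add: w)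
  have "z ^ N = (\<omega> ^ N) ^ j * cnj ((\<omega> ^ N) ^ k)"
    unfolding z_def power_mult_distrib complex_cnj_power[symmetric] by (simp only: power_mult[symmetric] mult.commute)
  then have zN: "z ^ N = 1" by (simp add: wN)
  show ?thesis
  proof (cases "j = k")
    case True
    then show ?thesis by (simp add: unit del: complex_cnj_power)
  next
    case False
    have "z \<noteq> 1"
    proof
      assume z: "z = 1"
      have "\<omega> ^ j = \<omega> ^ j * (\<omega> ^ k * cnj (\<omega> ^ k))" by (simp only: unit mult_1_right)
      also have "\<dots> = z * \<omega> ^ k" by (simp only: z_def mult_ac)
      finally have "\<omega> ^ j = \<omega> ^ k" by (simp only: z mult_1_left)
      then have "j = k"
        using bij_betw_imp_inj_on[OF Complex.bij_betw_roots_unity[of N]] N jk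
        unfolding w by (auto simp: inj_on_def)
      with False show False ..
    qed
    then have "(\<Sum>m<N. z ^ m) = 0" by (simp add: geometric_sum zN)
    with False show ?thesis by (simp add: z_def)
  qed
qed

text \<open>The transform is unnormalized, hence the factor \<open>N\<close>. After expanding the
  squares, summing over the frequency \<open>m\<close> first leaves only the diagonal terms.\<close>

lemma dft_parseval:
  fixes p :: "nat \<Rightarrow> complex"
  assumes N: "N \<ge> (1::nat)"
  defines "\<omega> \<equiv> cis (2 * pi / real N)"
  shows "(\<Sum>m<N. (cmod (\<Sum>j<N. \<omega> ^ (m * j) * p j))\<^sup>2) = real N * (\<Sum>j<N. (cmod (p j))\<^sup>2)"
proof -
  have "complex_of_real (\<Sum>m<N. (cmod (\<Sum>j<N. \<omega> ^ (m * j) * p j))\<^sup>2) =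
      (\<Sum>m<N. (\<Sum>j<N. \<omega> ^ (m * j) * p j) * cnj (\<Sum>j<N. \<omega> ^ (m * j) * p j))"
    by (simp only: of_real_sum complex_norm_square)
  also have "\<dots> = (\<Sum>m<N. \<Sum>j<N. \<Sum>k<N. (p j * cnj (p k)) * (\<omega> ^ j * cnj (\<omega> ^ k)) ^ m)"
    unfolding cnj_sum sum_product
    by (intro sum.cong refl)
      (simp add: power_mult_distrib power_mult[symmetric] mult_ac)
  also have "\<dots> = (\<Sum>j<N. \<Sum>k<N. \<Sum>m<N. (p j * cnj (p k)) * (\<omega> ^ j * cnj (\<omega> ^ k)) ^ m)"
    by (rule trans[OF sum.swap], rule sum.cong[OF refl], rule sum.swap)
  also have "\<dots> = (\<Sum>j<N. \<Sum>k<N. (p j * cnj (p k)) * (if j = k then of_nat N else 0))"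
    unfolding sum_distrib_left[symmetric]
    by (intro sum.cong refl) (simp only: \<omega>_def sum_root_unity_powers[OF N] lessThan_iff)
  also have "\<dots> = (\<Sum>j<N. (p j * cnj (p j)) * of_nat N)"
    by (intro sum.cong refl) (simp add: if_distrib cong: if_cong)
  also have "\<dots> = complex_of_real (real N * (\<Sum>j<N. (cmod (p j))\<^sup>2))"
    by (simp add: complex_norm_square[symmetric] sum_distrib_left mult.commute del: of_real_power)
  finally show ?thesis by (simp only: of_real_eq_iff)
qed

lemma norm_vec_power2: "(norm (x :: 'a::real_normed_vector^'n))\<^sup>2 = (\<Sum>i\<in>UNIV. (norm (x $ i))\<^sup>2)"
  by (simp add: norm_vec_def L2_set_def sum_nonneg)

lemma dft_parseval_vec:
  fixes p :: "nat \<Rightarrow> complex^'n"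
  assumes N: "N \<ge> (1::nat)"
  defines "\<omega> \<equiv> cis (2 * pi / real N)"
  shows "(\<Sum>m<N. (norm (\<Sum>j<N. \<omega> ^ (m * j) *s p j))\<^sup>2) = real N * (\<Sum>j<N. (norm (p j))\<^sup>2)"
proof -
  have "(\<Sum>m<N. (norm (\<Sum>j<N. \<omega> ^ (m * j) *s p j))\<^sup>2) =
      (\<Sum>m<N. \<Sum>i\<in>UNIV. (cmod (\<Sum>j<N. \<omega> ^ (m * j) * p j $ i))\<^sup>2)"
    by (simp add: norm_vec_power2)
  also have "\<dots> = (\<Sum>i\<in>UNIV. \<Sum>m<N. (cmod (\<Sum>j<N. \<omega> ^ (m * j) * p j $ i))\<^sup>2)"
    by (rule sum.swap)
  also have "\<dots> = (\<Sum>i\<in>UNIV. real N * (\<Sum>j<N. (cmod (p j $ i))\<^sup>2))"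
    unfolding \<omega>_def by (intro sum.cong refl dft_parseval N)
  also have "\<dots> = real N * (\<Sum>i\<in>UNIV. \<Sum>j<N. (cmod (p j $ i))\<^sup>2)"
    by (simp only: sum_distrib_left)
  also have "(\<Sum>i\<in>UNIV. \<Sum>j<N. (cmod (p j $ i))\<^sup>2) = (\<Sum>j<N. (norm (p j))\<^sup>2)"
    unfolding norm_vec_power2 by (rule sum.swap)
  finally show ?thesis .
qed

text \<open>The defect attains a positive minimum on the compact product of the unit circle and the
  unit sphere, and scales linearly in \<open>w\<close>. A single constant for the whole circle
  covers the roots of unity of every order, which is the source of uniformity in
  \<open>N\<close>.\<close>

lemma unimodular_resolvent_bound:
  fixes B :: "complex^'n^'n"
  assumes B: "\<forall>\<mu> w. cmod \<mu> = 1 \<longrightarrow> B *v w = \<mu> *s w \<longrightarrow> w = 0"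
  shows "\<exists>c>0. \<forall>\<mu> w. cmod \<mu> = 1 \<longrightarrow> c * norm w \<le> norm (\<mu> *s w - B *v w)"
proof -
  define f where "f = (\<lambda>(\<mu>, w). norm (\<mu> *s w - B *v w))"
  let ?S = "sphere (0::complex) 1 \<times> sphere (0::complex^'n) 1"
  have "continuous_on ?S f"
    unfolding f_def case_prod_unfold vector_scalar_mult_def matrix_vector_mult_def
    by (intro continuous_intros)
  moreover have "compact ?S" by (intro compact_Times) auto
  moreover have "(1, axis undefined 1) \<in> ?S" by simp
  then have "?S \<noteq> {}" by blast
  ultimately obtain z where z: "z \<in> ?S" "\<And>y. y \<in> ?S \<Longrightarrow> f z \<le> f y"
    using continuous_attains_inf[of ?S f] by blast
  have "f z > 0"
  proof (rule ccontr)
    assume "\<not> f z > 0"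
    then have "B *v snd z = fst z *s snd z" by (simp add: f_def case_prod_unfold)
    then have "snd z = 0" using z(1) B by auto
    with z(1) show False by auto
  qed
  moreover have "f z * norm w \<le> norm (\<mu> *s w - B *v w)" if \<mu>: "cmod \<mu> = 1" for \<mu> w
  proof (cases "w = 0")
    case False
    define u where "u = (1 / norm w) *\<^sub>R w"
    have w: "w = norm w *\<^sub>R u" using False by (simp add: u_def)
    have "norm u = 1" using False by (simp add: u_def)
    then have "f z \<le> norm (\<mu> *s u - B *v u)"
      using z(2)[of "(\<mu>, u)"] \<mu> by (simp add: f_def)
    then have "f z * norm w \<le> norm w * norm (\<mu> *s u - B *v u)"
      by (simp add: mult.commute mult_left_mono)
    also have "\<dots> = norm (norm w *\<^sub>R (\<mu> *s u - B *v u))" by simp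
    also have "norm w *\<^sub>R (\<mu> *s u - B *v u) = \<mu> *s (norm w *\<^sub>R u) - B *v (norm w *\<^sub>R u)"
      by (simp add: vec_eq_iff matrix_vector_mult_def scaleR_diff_right scaleR_sum_right)
    also have "\<dots> = \<mu> *s w - B *v w" by (simp only: w[symmetric])
    finally show ?thesis .
  qed simp
  ultimately show ?thesis by blast
qed

text \<open>The discrete Fourier transform diagonalizes the shift on \<open>N\<close>-periodic sequences, which turns
  \<open>p j \<mapsto> p (j + 1) - B (p j)\<close> into multiplication by \<open>\<mu> - B\<close> with \<open>\<mu>\<close> an \<open>N\<close>-th root of unity.\<close>
lemma periodic_sequence_estimate_complex:
  fixes B :: "complex^'n^'n"
  assumes B: "\<forall>\<mu> w. cmod \<mu> = 1 \<longrightarrow> B *v w = \<mu> *s w \<longrightarrow> w = 0"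
  shows "\<exists>C>0. \<forall>N p. N \<ge> (1::nat) \<longrightarrow> p N = p 0 \<longrightarrow>
    (\<Sum>j<N. (norm (p j))\<^sup>2) \<le> C * (\<Sum>j<N. (norm (p (Suc j) - B *v p j))\<^sup>2)"
proof -
  obtain c where c: "c > 0" "\<And>\<mu> w. cmod \<mu> = 1 \<Longrightarrow> c * norm w \<le> norm (\<mu> *s w - B *v w)"
    using unimodular_resolvent_bound[OF B] by blast
  have "(\<Sum>j<N. (norm (p j))\<^sup>2) \<le> (1 / c\<^sup>2) * (\<Sum>j<N. (norm (p (Suc j) - B *v p j))\<^sup>2)"
    if N: "N \<ge> 1" and p: "p N = p 0" for N :: nat and p
  proof -
    define \<omega> where "\<omega> = cis (2 * pi / real N)"
    have wN: "\<omega> ^ (m * N) = 1" for m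
    proof -
      have "\<omega> ^ N = 1" using N by (simp add: \<omega>_def Complex.DeMoivre)
      then show ?thesis by (simp add: mult.commute[of m] power_mult)
    qed
    define h where "h m = (\<Sum>j<N. \<omega> ^ (m * j) *s p j)" for m
    have hat: "(\<Sum>j<N. \<omega> ^ (m * j) *s (p (Suc j) - B *v p j)) = cnj (\<omega> ^ m) *s h m - B *v h m" for m
    proof -
      have u: "cnj (\<omega> ^ m) * \<omega> ^ m = 1"
        by (simp add: \<omega>_def Complex.DeMoivre cis_cnj cis_mult)
      have "\<omega> ^ (m * j) *s p (Suc j) = cnj (\<omega> ^ m) *s (\<omega> ^ (m * Suc j) *s p (Suc j))" for j
        using u by (simp add: power_add mult.assoc[symmetric] del: complex_cnj_power)
      then have "(\<Sum>j<N. \<omega> ^ (m * j) *s p (Suc j)) = cnj (\<omega> ^ m) *s (\<Sum>j<N. \<omega> ^ (m * Suc j) *s p (Suc j))"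
        by (simp only: vec.scale_sum_right)
      \<comment> \<open>Periodicity enters here: the shifted sum gains the term at \<open>N\<close>
        and loses the one at 0, and these coincide.\<close>
      also have "(\<Sum>j<N. \<omega> ^ (m * Suc j) *s p (Suc j)) = h m"
      proof -
        have "\<omega> ^ (m * 0) *s p 0 + (\<Sum>j<N. \<omega> ^ (m * Suc j) *s p (Suc j)) = h m + \<omega> ^ (m * N) *s p N"
          using sum.lessThan_Suc_shift[of "\<lambda>j. \<omega> ^ (m * j) *s p j" N]
          unfolding h_def by (simp only: sum.lessThan_Suc)
        then show ?thesis by (simp add: wN p)
      qed
      finally have 1: "(\<Sum>j<N. \<omega> ^ (m * j) *s p (Suc j)) = cnj (\<omega> ^ m) *s h m" .
      have 2: "(\<Sum>j<N. \<omega> ^ (m * j) *s (B *v p j)) = B *v h m"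
        unfolding h_def by (simp add: vec.linear_sum[OF matrix_vector_mul_linear_gen] vec.scale)
      show ?thesis
        unfolding 1[symmetric] 2[symmetric] by (simp add: vec.scale_right_diff_distrib sum_subtractf)
    qed
    have "real N * (c\<^sup>2 * (\<Sum>j<N. (norm (p j))\<^sup>2)) = (\<Sum>m<N. (c * norm (h m))\<^sup>2)"
      using dft_parseval_vec[OF N, of p]
      by (simp add: h_def \<omega>_def power_mult_distrib sum_distrib_left[symmetric])
    also have "\<dots> \<le> (\<Sum>m<N. (norm (cnj (\<omega> ^ m) *s h m - B *v h m))\<^sup>2)"
      using c(1) by (intro sum_mono power_mono c(2)) (auto simp: \<omega>_def norm_power)
    also have "\<dots> = real N * (\<Sum>j<N. (norm (p (Suc j) - B *v p j))\<^sup>2)"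
      unfolding hat[symmetric] unfolding \<omega>_def by (rule dft_parseval_vec[OF N])
    finally have "c\<^sup>2 * (\<Sum>j<N. (norm (p j))\<^sup>2) \<le> (\<Sum>j<N. (norm (p (Suc j) - B *v p j))\<^sup>2)"
      using N by simp
    then show ?thesis using c(1) by (simp add: field_simps)
  qed
  moreover have "1 / c\<^sup>2 > 0" using c(1) by simp
  ultimately show ?thesis by blast
qed

lemma norm_cvec: "norm (cvec x) = norm x"
  by (simp add: cvec_def norm_vec_def)

lemma periodic_sequence_estimate:
  fixes B :: "real^'n^'n"
  assumes B: "\<forall>\<mu> w. cmod \<mu> = 1 \<longrightarrow> cmat B *v w = \<mu> *s w \<longrightarrow> w = 0"
  shows "\<exists>C>0. \<forall>N p. N \<ge> (1::nat) \<longrightarrow> p N = p 0 \<longrightarrow>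
    (\<Sum>j<N. (norm (p j))\<^sup>2) \<le> C * (\<Sum>j<N. (norm (p (Suc j) - B *v p j))\<^sup>2)"
proof -
  have cv: "cvec x - cmat B *v cvec y = cvec (x - B *v y)" for x y
    by (simp add: vec_eq_iff cvec_def cmat_def matrix_vector_mult_def)
  obtain C where C: "C > 0" "\<And>N p. N \<ge> (1::nat) \<Longrightarrow> p N = p 0 \<Longrightarrow>
    (\<Sum>j<N. (norm (p j))\<^sup>2) \<le> C * (\<Sum>j<N. (norm (p (Suc j) - cmat B *v p j))\<^sup>2)"
    using periodic_sequence_estimate_complex[OF B] by blast
  show ?thesis
    using C(1) C(2)[of _ "\<lambda>j. cvec (p j)" for p] by (intro exI[of _ C]) (simp add: norm_cvec cv)
qed

section \<open>Linear differential equations\<close>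

lemma bounded_bilinear_matrix_vector_mult:
  "bounded_bilinear ((*v) :: 'a::{real_normed_field, euclidean_space}^'n^'m \<Rightarrow> 'a^'n \<Rightarrow> 'a^'m)"
  unfolding bilinear_conv_bounded_bilinear[symmetric] bilinear_def
  by (auto intro!: linearI simp: matrix_vector_right_distrib matrix_vector_mult_add_rdistrib)
    (auto simp: vec_eq_iff matrix_vector_mult_def scaleR_sum_right)

lemma bounded_bilinear_matrix_mult:
  "bounded_bilinear ((**) :: 'a::{real_normed_field, euclidean_space}^'n^'m \<Rightarrow> 'a^'p^'n \<Rightarrow> 'a^'p^'m)"
  unfolding bilinear_conv_bounded_bilinear[symmetric] bilinear_def
  by (auto intro!: linearI)
    (auto simp: vec_eq_iff matrix_matrix_mult_def scaleR_sum_right sum.distrib ring_distribs)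

section \<open>Continuity and derivative of the inverse matrix\<close>

lemma matrix_inv_mult:
  fixes A :: "'a::semiring_1^'n^'m"
  assumes "invertible A"
  shows "A ** matrix_inv A = mat 1" "matrix_inv A ** A = mat 1"
  using someI_ex[OF assms[unfolded invertible_def]] unfolding matrix_inv_def by auto

text \<open>By Cramer's rule the entries of the inverse are quotients of determinants, hence of
  polynomials in the entries of \<open>P t\<close>.\<close>

lemma continuous_on_matrix_inv:
  fixes P :: "'b::topological_space \<Rightarrow> 'a::{real_normed_field, euclidean_space}^'n^'n"
  assumes inv: "\<And>t. t \<in> S \<Longrightarrow> invertible (P t)" and P: "continuous_on S P"
  shows "continuous_on S (\<lambda>t. matrix_inv (P t))"
proof -
  have det: "continuous_on S (\<lambda>t. det (M t))" if "\<And>i j. continuous_on S (\<lambda>t. M t $ i $ j)" for M :: "'b \<Rightarrow> 'a^'n^'n"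
    unfolding det_def by (intro continuous_intros that)
  have Pij: "continuous_on S (\<lambda>t. P t $ i $ j)" for i j
    by (intro continuous_intros P)
  have entry: "matrix_inv (P t) $ k $ l =
      det (\<chi> i j. if j = k then axis l 1 $ i else P t $ i $ j) / det (P t)" if "t \<in> S" for t k l
  proof -
    have "P t *v (matrix_inv (P t) *v axis l 1) = axis l 1"
      by (simp add: matrix_vector_mul_assoc matrix_inv_mult inv[OF that])
    then have "matrix_inv (P t) *v axis l 1 = (\<chi> k. det (\<chi> i j. if j = k then axis l 1 $ i else P t $ i $ j) / det (P t))"
      using inv[OF that] by (subst (asm) cramer) (simp_all add: invertible_det_nz)
    moreover have "(matrix_inv (P t) *v axis l 1) $ k = matrix_inv (P t) $ k $ l"
      by (simp add: matrix_vector_mult_def axis_def if_distrib cong: if_cong)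
    ultimately show ?thesis by simp
  qed
  have "continuous_on S (\<lambda>t. matrix_inv (P t) $ k $ l)" for k l
  proof -
    have "continuous_on S (\<lambda>t. det (\<chi> i j. if j = k then axis l 1 $ i else P t $ i $ j) / det (P t))"
    proof (intro continuous_on_divide det Pij)
      show "continuous_on S (\<lambda>t. (\<chi> i j. if j = k then axis l 1 $ i else P t $ i $ j) $ i $ j)" for i j
        by (cases "j = k") (auto intro!: continuous_intros Pij)
      show "\<forall>t\<in>S. det (P t) \<noteq> 0" using inv by (simp add: invertible_det_nz)
    qed
    then show ?thesis by (rule continuous_on_eq) (simp only: entry)
  qed
  then have "continuous_on S (\<lambda>t. \<chi> k. \<chi> l. matrix_inv (P t) $ k $ l)"
    by (intro continuous_on_vec_lambda)
  then show ?thesis by (simp only: vec_nth_inverse)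
qed

lemma has_vector_derivative_iff_quotient:
  fixes h :: "real \<Rightarrow> 'd::real_normed_vector"
  assumes that: "h t = 0"
  shows "(h has_vector_derivative h') (at t) \<longleftrightarrow> ((\<lambda>s. (1 / (s - t)) *\<^sub>R h s) \<longlongrightarrow> h') (at t)"
proof -
  have "(h has_vector_derivative h') (at t) \<longleftrightarrow> ((\<lambda>s. norm (h s - (s - t) *\<^sub>R h') / norm (s - t)) \<longlongrightarrow> 0) (at t)"
    unfolding has_vector_derivative_def has_derivative_iff_norm
    by (simp add: that bounded_linear_scaleR_left)
  also have "\<dots> \<longleftrightarrow> ((\<lambda>s. norm ((1 / (s - t)) *\<^sub>R h s - h')) \<longlongrightarrow> 0) (at t)"
  proof (intro filterlim_cong refl, unfold eventually_at_filter, intro always_eventually allI impI)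
    fix s assume st: "s \<noteq> t"
    have "(1 / (s - t)) *\<^sub>R h s - h' = (1 / (s - t)) *\<^sub>R (h s - (s - t) *\<^sub>R h')"
      using st by (simp add: scaleR_diff_right)
    then show "norm (h s - (s - t) *\<^sub>R h') / norm (s - t) = norm ((1 / (s - t)) *\<^sub>R h s - h')"
      by simp
  qed
  also have "\<dots> \<longleftrightarrow> ((\<lambda>s. (1 / (s - t)) *\<^sub>R h s) \<longlongrightarrow> h') (at t)"
    by (simp add: tendsto_norm_zero_iff Lim_null[symmetric])
  finally show ?thesis .
qed

text \<open>Only continuity of the first factor is needed because the second one vanishes at \<open>t\<close>.\<close>
lemma has_vector_derivative_bilinear_zero:
  fixes f :: "real \<Rightarrow> 'a::real_normed_vector" and g :: "real \<Rightarrow> 'b::real_normed_vector"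
    and prod :: "'a \<Rightarrow> 'b \<Rightarrow> 'c::real_normed_vector"
  assumes bil: "bounded_bilinear prod" and f: "isCont f t"
    and g: "(g has_vector_derivative g') (at t)" and g0: "g t = 0"
  shows "((\<lambda>s. prod (f s) (g s)) has_vector_derivative prod (f t) g') (at t)"
proof -
  interpret bounded_bilinear prod by fact
  have "((\<lambda>s. (1 / (s - t)) *\<^sub>R g s) \<longlongrightarrow> g') (at t)"
    using g has_vector_derivative_iff_quotient[of g t g', OF g0] by simp
  then have "((\<lambda>s. prod (f s) ((1 / (s - t)) *\<^sub>R g s)) \<longlongrightarrow> prod (f t) g') (at t)"
    using f by (intro tendsto) (auto simp: isCont_def)
  then show ?thesis
    by (subst has_vector_derivative_iff_quotient) (simp_all add: g0 zero_right scaleR_right)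
qed

text \<open>Rests on the identity \<open>Q s = Q t - Q s ** ((P s - P t) ** Q t)\<close>. The factor
  \<open>P s - P t\<close> vanishes at \<open>t\<close>, so continuity of \<open>Q\<close> suffices
  and its differentiability need not be known beforehand.\<close>

lemma has_vector_derivative_matrix_inv:
  fixes P :: "real \<Rightarrow> 'a::{real_normed_field, euclidean_space}^'n^'n"
  assumes inv: "\<And>s. invertible (P s)" and cont: "continuous_on UNIV P"
    and P: "(P has_vector_derivative P') (at t)"
  shows "((\<lambda>s. matrix_inv (P s)) has_vector_derivative - (matrix_inv (P t) ** P' ** matrix_inv (P t))) (at t)"
proof -
  define Q where "Q s = matrix_inv (P s)" for s
  have Qc: "isCont Q t"
    using continuous_on_matrix_inv[of UNIV P] inv cont
    by (simp add: continuous_on_eq_continuous_at Q_def[abs_def])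
  interpret mm: bounded_bilinear "(**) :: 'a^'n^'n \<Rightarrow> 'a^'n^'n \<Rightarrow> 'a^'n^'n"
    by (rule bounded_bilinear_matrix_mult)
  have QP: "Q s ** P s = mat 1" "P s ** Q s = mat 1" for s
    by (simp_all add: Q_def matrix_inv_mult inv)
  have "((\<lambda>s. (P s - P t) ** Q t) has_vector_derivative P' ** Q t) (at t)"
    by (rule bounded_linear.has_vector_derivative[OF mm.bounded_linear_left])
      (auto intro!: derivative_eq_intros P)
  then have "((\<lambda>s. Q s ** ((P s - P t) ** Q t)) has_vector_derivative Q t ** (P' ** Q t)) (at t)"
    by (rule has_vector_derivative_bilinear_zero[OF bounded_bilinear_matrix_mult Qc]) (simp add: mm.zero_left)
  then have "((\<lambda>s. Q t - Q s ** ((P s - P t) ** Q t)) has_vector_derivative - (Q t ** (P' ** Q t))) (at t)"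
    by (auto intro!: derivative_eq_intros)
  also have "(\<lambda>s. Q t - Q s ** ((P s - P t) ** Q t)) = Q"
  proof
    fix s
    have "Q s ** ((P s - P t) ** Q t) = (Q s ** P s) ** Q t - Q s ** (P t ** Q t)"
      by (simp add: mm.diff_left mm.diff_right matrix_mul_assoc)
    then show "Q t - Q s ** ((P s - P t) ** Q t) = Q s" by (simp add: QP)
  qed
  finally show ?thesis by (simp add: Q_def[abs_def] matrix_mul_assoc)
qed

text \<open>Gronwall in both time directions: the square norm of \<open>u t\<close> times
  \<open>exp (-2 * a * t)\<close> is nonincreasing and times \<open>exp (2 * a * t)\<close> is
  nondecreasing, and both products vanish at \<open>t0\<close>.\<close>

lemma linear_ode_zero:
  fixes u :: "real \<Rightarrow> 'a::real_inner"
  assumes u: "\<And>t. (u has_vector_derivative F t) (at t)"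
    and F: "\<And>t. norm (F t) \<le> a * norm (u t)" and u0: "u t0 = 0"
  shows "u t = 0"
proof -
  have d: "((\<lambda>t. (u t \<bullet> u t) * exp (c * t)) has_real_derivative
      (2 * (u t \<bullet> F t) + c * (u t \<bullet> u t)) * exp (c * t)) (at t)" for c t
  proof -
    have "((\<lambda>t. u t \<bullet> u t) has_vector_derivative u t \<bullet> F t + F t \<bullet> u t) (at t)"
      by (rule bounded_bilinear.has_vector_derivative[OF bounded_bilinear_inner u u])
    then have "((\<lambda>t. u t \<bullet> u t) has_real_derivative 2 * (u t \<bullet> F t)) (at t)"
      by (simp add: has_real_derivative_iff_has_vector_derivative inner_commute)
    then show ?thesis by (auto intro!: derivative_eq_intros simp: algebra_simps)
  qed
  have b: "\<bar>u t \<bullet> F t\<bar> \<le> a * (u t \<bullet> u t)" for t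
  proof -
    have "\<bar>u t \<bullet> F t\<bar> \<le> norm (u t) * norm (F t)" by (rule Cauchy_Schwarz_ineq2)
    also have "\<dots> \<le> norm (u t) * (a * norm (u t))" by (intro mult_left_mono F) simp
    finally show ?thesis by (simp add: power2_norm_eq_inner[symmetric] power2_eq_square algebra_simps)
  qed
  have "(u t \<bullet> u t) * exp (c * t) \<le> (u t0 \<bullet> u t0) * exp (c * t0)" if "(t0 \<le> t \<and> c = -2 * a) \<or> (t \<le> t0 \<and> c = 2 * a)" for c
    using that
  proof (elim disjE conjE)
    assume *: "t0 \<le> t" "c = -2 * a"
    show ?thesis
    proof (intro DERIV_nonpos_imp_nonincreasing[OF *(1), where f = "\<lambda>t. (u t \<bullet> u t) * exp (c * t)"] exI conjI, rule d)
      fix x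
      have "2 * (u x \<bullet> F x) + c * (u x \<bullet> u x) \<le> 0"
        using b[of x] by (simp add: * abs_le_iff)
      then show "(2 * (u x \<bullet> F x) + c * (u x \<bullet> u x)) * exp (c * x) \<le> 0"
        by (simp add: mult_nonpos_nonneg)
    qed
  next
    assume *: "t \<le> t0" "c = 2 * a"
    have pos: "2 * (u x \<bullet> F x) + c * (u x \<bullet> u x) \<ge> 0" for x
      using b[of x] by (simp add: * abs_le_iff)
    show ?thesis
      by (intro DERIV_nonneg_imp_nondecreasing[OF *(1), where f = "\<lambda>t. (u t \<bullet> u t) * exp (c * t)"] exI conjI, rule d) (simp add: pos)
  qed
  from this[of "-2 * a"] this[of "2 * a"]
  have "(u t \<bullet> u t) * exp ((-2 * a) * t) \<le> 0 \<or> (u t \<bullet> u t) * exp ((2 * a) * t) \<le> 0"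
    using u0 by (cases "t0 \<le> t") simp_all
  then have "u t \<bullet> u t \<le> 0" by (auto simp: mult_le_0_iff)
  then show ?thesis using inner_gt_zero_iff[of "u t"] by linarith
qed

section \<open>Fundamental matrices of linear equations\<close>

context
  fixes A \<Phi> :: "real \<Rightarrow> real^'n^'n" and a :: real
  assumes \<Phi>0: "\<Phi> 0 = mat 1" and \<Phi>': "\<And>t. (\<Phi> has_vector_derivative A t ** \<Phi> t) (at t)"
    and A: "\<And>t. norm (A t) \<le> a"
begin

lemma fundamental_matrix_solution:
  assumes v: "\<And>t. (v has_vector_derivative A t *v v t) (at t)"
  shows "v t = \<Phi> t *v v 0"
proof -
  interpret mv: bounded_bilinear "(*v) :: real^'n^'n \<Rightarrow> real^'n \<Rightarrow> real^'n"
    by (rule bounded_bilinear_matrix_vector_mult)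
  obtain K where K: "K > 0" "\<And>x y. norm ((x::real^'n^'n) *v (y::real^'n)) \<le> norm x * norm y * K"
    using mv.pos_bounded by blast
  define u where "u t = v t - \<Phi> t *v v 0" for t
  have "u t = 0"
  proof (rule linear_ode_zero)
    show "(u has_vector_derivative A t *v u t) (at t)" for t
      unfolding u_def
      by (rule has_vector_derivative_eq_rhs,
          rule has_vector_derivative_diff[OF v bounded_linear.has_vector_derivative[OF mv.bounded_linear_left \<Phi>']])
        (simp add: mv.diff_right matrix_vector_mul_assoc)
    show "norm (A t *v u t) \<le> (a * K) * norm (u t)" for t
      using order_trans[OF K(2) mult_right_mono[OF mult_right_mono[OF A]]] K(1) by (simp add: mult_ac)
    show "u 0 = 0" by (simp add: u_def \<Phi>0)
  qed
  then show ?thesis by (simp add: u_def)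
qed

lemma fundamental_matrix_unique:
  fixes \<Psi> :: "real \<Rightarrow> real^'n^'n"
  assumes \<Psi>': "\<And>t. (\<Psi> has_vector_derivative A t ** \<Psi> t) (at t)"
  shows "\<Psi> t = \<Phi> t ** \<Psi> 0"
proof -
  have "\<Psi> t *v x = (\<Phi> t ** \<Psi> 0) *v x" for x
  proof -
    interpret mv: bounded_bilinear "(*v) :: real^'n^'n \<Rightarrow> real^'n \<Rightarrow> real^'n"
      by (rule bounded_bilinear_matrix_vector_mult)
    have "((\<lambda>t. \<Psi> t *v x) has_vector_derivative A t *v (\<Psi> t *v x)) (at t)" for t
      using bounded_linear.has_vector_derivative[OF mv.bounded_linear_left \<Psi>']
      by (simp add: matrix_vector_mul_assoc)
    from fundamental_matrix_solution[OF this] show ?thesis by (simp add: matrix_vector_mul_assoc)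
  qed
  then show ?thesis by (simp add: matrix_eq)
qed

text \<open>A kernel vector of \<open>\<Phi> t\<close> starts a solution that vanishes at time
  \<open>t\<close>, hence also at time 0, where \<Phi> is the identity.\<close>

lemma fundamental_matrix_invertible: "invertible (\<Phi> t)"
proof -
  interpret mv: bounded_bilinear "(*v) :: real^'n^'n \<Rightarrow> real^'n \<Rightarrow> real^'n"
    by (rule bounded_bilinear_matrix_vector_mult)
  obtain K where K: "K > 0" "\<And>x y. norm ((x::real^'n^'n) *v (y::real^'n)) \<le> norm x * norm y * K"
    using mv.pos_bounded by blast
  have "x = 0" if x: "\<Phi> t *v x = 0" for x
  proof -
    have "\<Phi> 0 *v x = 0"
    proof (rule linear_ode_zero)
      show "((\<lambda>t. \<Phi> t *v x) has_vector_derivative A t *v (\<Phi> t *v x)) (at t)" for t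
        using bounded_linear.has_vector_derivative[OF mv.bounded_linear_left \<Phi>']
        by (simp add: matrix_vector_mul_assoc)
      show "norm (A t *v (\<Phi> t *v x)) \<le> (a * K) * norm (\<Phi> t *v x)" for t
        using order_trans[OF K(2) mult_right_mono[OF mult_right_mono[OF A]]] K(1) by (simp add: mult_ac)
      show "\<Phi> t *v x = 0" by (rule x)
    qed
    then show ?thesis by (simp add: \<Phi>0)
  qed
  then show ?thesis unfolding invertible_left_inverse matrix_left_invertible_ker by blast
qed

lemma fundamental_matrix_continuous: "continuous_on UNIV \<Phi>"
  using \<Phi>' by (auto simp: continuous_on_eq_continuous_at intro!: has_vector_derivative_continuous)

lemma fundamental_matrix_inv_deriv:
  "((\<lambda>t. matrix_inv (\<Phi> t)) has_vector_derivative - (matrix_inv (\<Phi> t) ** A t)) (at t)"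
proof -
  have "matrix_inv (\<Phi> t) ** (A t ** \<Phi> t) ** matrix_inv (\<Phi> t) = matrix_inv (\<Phi> t) ** A t"
    by (simp add: matrix_mul_assoc[symmetric] matrix_inv_mult fundamental_matrix_invertible)
  then show ?thesis
    using has_vector_derivative_matrix_inv[OF fundamental_matrix_invertible fundamental_matrix_continuous \<Phi>'[of t]]
    by simp
qed

text \<open>By periodicity of \<open>A\<close>, the translate of \<Phi> by \<open>T\<close> solves
  the same equation, with initial value \<open>\<Phi> T\<close>.\<close>

lemma fundamental_matrix_periodic:
  assumes "\<And>t. A (t + T) = A t"
  shows "\<Phi> (t + T) = \<Phi> t ** \<Phi> T"
proof -
  have "((\<lambda>t. \<Phi> (t + T)) has_vector_derivative A t ** \<Phi> (t + T)) (at t)" for t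
  proof -
    have "((\<lambda>t. t + T) has_vector_derivative 1) (at t)"
      by (auto intro!: derivative_eq_intros)
    from vector_diff_chain_at[OF this \<Phi>'[of "t + T"]] show ?thesis by (simp add: o_def assms)
  qed
  from fundamental_matrix_unique[OF this] show ?thesis by simp
qed

end

section \<open>Absolutely continuous functions\<close>

lemma absolutely_continuous_funD:
  assumes "absolutely_continuous_fun a b f" "e > 0"
  shows "\<exists>\<delta>>0. \<forall>(n::nat) u v. (\<forall>i<n. a \<le> u i \<and> u i \<le> v i \<and> v i \<le> b) \<longrightarrow>
    (\<forall>i<n. \<forall>j<n. i \<noteq> j \<longrightarrow> {u i<..<v i} \<inter> {u j<..<v j} = {}) \<longrightarrow>
    (\<Sum>i<n. v i - u i) < \<delta> \<longrightarrow> (\<Sum>i<n. norm (f (v i) - f (u i))) < e"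
proof -
  from assms(1)[unfolded absolutely_continuous_fun_def, THEN spec, THEN mp, OF assms(2)]
  obtain \<delta> where \<delta>: "\<delta> > 0 \<and> (\<forall>(n::nat) u v. (\<forall>i<n. a \<le> u i \<and> u i \<le> v i \<and> v i \<le> b) \<and>
    (\<forall>i<n. \<forall>j<n. i \<noteq> j \<longrightarrow> {u i<..<v i} \<inter> {u j<..<v j} = {}) \<and>
    (\<Sum>i<n. v i - u i) < \<delta> \<longrightarrow> (\<Sum>i<n. norm (f (v i) - f (u i))) < e)" ..
  show ?thesis
  proof (intro exI[of _ \<delta>] conjI allI impI)
    show "\<delta> > 0" using \<delta> ..
  next
    fix n :: nat and u v
    assume "\<forall>i<n. a \<le> u i \<and> u i \<le> v i \<and> v i \<le> b"
      "\<forall>i<n. \<forall>j<n. i \<noteq> j \<longrightarrow> {u i<..<v i} \<inter> {u j<..<v j} = {}" "(\<Sum>i<n. v i - u i) < \<delta>"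
    then show "(\<Sum>i<n. norm (f (v i) - f (u i))) < e"
      using \<delta>[THEN conjunct2, THEN spec[of _ n], THEN spec[of _ u], THEN spec[of _ v]] by meson
  qed
qed

lemma absolutely_continuous_fun_subinterval:
  assumes "absolutely_continuous_fun a b f" "a \<le> c" "d \<le> b"
  shows "absolutely_continuous_fun c d f"
  unfolding absolutely_continuous_fun_def
proof (intro allI impI)
  fix e :: real assume "e > 0"
  then obtain \<delta> where \<delta>: "\<delta> > 0" "\<forall>(n::nat) u v.
        (\<forall>i<n. a \<le> u i \<and> u i \<le> v i \<and> v i \<le> b) \<longrightarrow>
        (\<forall>i<n. \<forall>j<n. i \<noteq> j \<longrightarrow> {u i<..<v i} \<inter> {u j<..<v j} = {}) \<longrightarrow>
        (\<Sum>i<n. v i - u i) < \<delta> \<longrightarrow> (\<Sum>i<n. norm (f (v i) - f (u i))) < e"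
    using absolutely_continuous_funD[OF assms(1) \<open>e > 0\<close>] by blast
  show "\<exists>\<delta>>0. \<forall>(n::nat) u v. (\<forall>i<n. c \<le> u i \<and> u i \<le> v i \<and> v i \<le> d) \<and>
        (\<forall>i<n. \<forall>j<n. i \<noteq> j \<longrightarrow> {u i<..<v i} \<inter> {u j<..<v j} = {}) \<and>
        (\<Sum>i<n. v i - u i) < \<delta> \<longrightarrow> (\<Sum>i<n. norm (f (v i) - f (u i))) < e"
  proof (intro exI[of _ \<delta>] conjI allI impI \<delta>(1))
    fix n :: nat and u v
    assume *: "(\<forall>i<n. c \<le> u i \<and> u i \<le> v i \<and> v i \<le> d) \<and>
        (\<forall>i<n. \<forall>j<n. i \<noteq> j \<longrightarrow> {u i<..<v i} \<inter> {u j<..<v j} = {}) \<and> (\<Sum>i<n. v i - u i) < \<delta>"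
    then have "\<forall>i<n. a \<le> u i \<and> u i \<le> v i \<and> v i \<le> b" using assms(2,3) by (meson order_trans)
    with * show "(\<Sum>i<n. norm (f (v i) - f (u i))) < e" by (intro \<delta>(2)[rule_format]) auto
  qed
qed

text \<open>One comparison serves both Lipschitz functions, through the length term
  \<open>v - u\<close>, and products of a Lipschitz with an absolutely continuous factor.\<close>

lemma absolutely_continuous_fun_dominated:
  fixes f :: "real \<Rightarrow> 'a::real_normed_vector" and F :: "real \<Rightarrow> 'b::real_normed_vector"
  assumes f: "absolutely_continuous_fun a b f"
    and F: "\<And>u v. a \<le> u \<Longrightarrow> u \<le> v \<Longrightarrow> v \<le> b \<Longrightarrow> norm (F v - F u) \<le> C * (norm (f v - f u) + (v - u))"
  shows "absolutely_continuous_fun a b F"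
  unfolding absolutely_continuous_fun_def
proof (intro allI impI)
  fix e :: real assume e: "e > 0"
  \<comment> \<open>The factor 2 splits the budget between the increments of \<open>f\<close> and
    the total length; \<open>\<bar>C\<bar> + 1\<close> keeps the divisor positive.\<close>
  define e' where "e' = e / (2 * (\<bar>C\<bar> + 1))"
  have e': "e' > 0" using e by (simp add: e'_def)
  then obtain \<delta> where \<delta>: "\<delta> > 0" "\<forall>(n::nat) u v.
        (\<forall>i<n. a \<le> u i \<and> u i \<le> v i \<and> v i \<le> b) \<longrightarrow>
        (\<forall>i<n. \<forall>j<n. i \<noteq> j \<longrightarrow> {u i<..<v i} \<inter> {u j<..<v j} = {}) \<longrightarrow>
        (\<Sum>i<n. v i - u i) < \<delta> \<longrightarrow> (\<Sum>i<n. norm (f (v i) - f (u i))) < e'"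
    using absolutely_continuous_funD[OF f e'] by blast
  show "\<exists>\<delta>>0. \<forall>(n::nat) u v. (\<forall>i<n. a \<le> u i \<and> u i \<le> v i \<and> v i \<le> b) \<and>
        (\<forall>i<n. \<forall>j<n. i \<noteq> j \<longrightarrow> {u i<..<v i} \<inter> {u j<..<v j} = {}) \<and>
        (\<Sum>i<n. v i - u i) < \<delta> \<longrightarrow> (\<Sum>i<n. norm (F (v i) - F (u i))) < e"
  proof (intro exI[of _ "min \<delta> e'"] conjI allI impI)
    show "min \<delta> e' > 0" using \<delta>(1) e' by simp
    fix n :: nat and u v
    assume *: "(\<forall>i<n. a \<le> u i \<and> u i \<le> v i \<and> v i \<le> b) \<and>
        (\<forall>i<n. \<forall>j<n. i \<noteq> j \<longrightarrow> {u i<..<v i} \<inter> {u j<..<v j} = {}) \<and> (\<Sum>i<n. v i - u i) < min \<delta> e'"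
    have "(\<Sum>i<n. norm (F (v i) - F (u i))) \<le> (\<Sum>i<n. (\<bar>C\<bar> + 1) * (norm (f (v i) - f (u i)) + (v i - u i)))"
    proof (rule sum_mono)
      fix i assume "i \<in> {..<n}"
      then have uv: "a \<le> u i" "u i \<le> v i" "v i \<le> b" using * by auto
      have "norm (F (v i) - F (u i)) \<le> C * (norm (f (v i) - f (u i)) + (v i - u i))"
        by (rule F[OF uv])
      also have "\<dots> \<le> (\<bar>C\<bar> + 1) * (norm (f (v i) - f (u i)) + (v i - u i))"
        using uv by (intro mult_right_mono) auto
      finally show "norm (F (v i) - F (u i)) \<le> (\<bar>C\<bar> + 1) * (norm (f (v i) - f (u i)) + (v i - u i))" .
    qed
    also have "\<dots> = (\<bar>C\<bar> + 1) * ((\<Sum>i<n. norm (f (v i) - f (u i))) + (\<Sum>i<n. v i - u i))"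
      by (simp add: sum_distrib_left[symmetric] sum.distrib)
    also have "\<dots> < (\<bar>C\<bar> + 1) * (e' + e')"
      using * by (intro mult_strict_left_mono add_strict_mono \<delta>(2)[rule_format]) auto
    also have "\<dots> = e"
    proof -
      have "c * (e / (2 * c) + e / (2 * c)) = e" if "c > 0" for c using that by (simp add: field_simps)
      from this[of "\<bar>C\<bar> + 1"] show ?thesis by (simp add: e'_def)
    qed
    finally show "(\<Sum>i<n. norm (F (v i) - F (u i))) < e" .
  qed
qed

lemma absolutely_continuous_fun_imp_continuous_on:
  fixes f :: "real \<Rightarrow> 'a::real_normed_vector"
  assumes f: "absolutely_continuous_fun a b f"
  shows "continuous_on {a..b} f"
  unfolding continuous_on_iff
proof (intro ballI allI impI)
  fix x e :: real assume x: "x \<in> {a..b}" and "e > 0"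
  then obtain \<delta> where \<delta>: "\<delta> > 0" "\<forall>(n::nat) u v.
        (\<forall>i<n. a \<le> u i \<and> u i \<le> v i \<and> v i \<le> b) \<longrightarrow>
        (\<forall>i<n. \<forall>j<n. i \<noteq> j \<longrightarrow> {u i<..<v i} \<inter> {u j<..<v j} = {}) \<longrightarrow>
        (\<Sum>i<n. v i - u i) < \<delta> \<longrightarrow> (\<Sum>i<n. norm (f (v i) - f (u i))) < e"
    using absolutely_continuous_funD[OF f \<open>e > 0\<close>] by blast
  have *: "norm (f v - f u) < e" if "a \<le> u" "u \<le> v" "v \<le> b" "v - u < \<delta>" for u v
    using \<delta>(2)[THEN spec[of _ 1], THEN spec[of _ "\<lambda>_. u"], THEN spec[of _ "\<lambda>_. v"]] that by simp
  show "\<exists>d>0. \<forall>x'\<in>{a..b}. dist x' x < d \<longrightarrow> dist (f x') (f x) < e"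
  proof (intro exI[of _ \<delta>] conjI \<delta>(1) ballI impI)
    fix y assume y: "y \<in> {a..b}" "dist y x < \<delta>"
    show "dist (f y) (f x) < e"
    proof (cases "x \<le> y")
      case True
      then show ?thesis using *[of x y] x y by (simp add: dist_norm)
    next
      case False
      then show ?thesis using *[of y x] x y by (simp add: dist_norm norm_minus_commute)
    qed
  qed
qed

text \<open>Both factors are continuous, hence bounded on the compact interval, so the increment of
  the product is dominated by the increment of \<open>f\<close> plus the length.\<close>

lemma absolutely_continuous_fun_bilinear:
  fixes f :: "real \<Rightarrow> 'a::real_normed_vector" and M :: "real \<Rightarrow> 'm::real_normed_vector"
    and prod :: "'m \<Rightarrow> 'a \<Rightarrow> 'b::real_normed_vector"
  assumes bil: "bounded_bilinear prod" and f: "absolutely_continuous_fun a b f"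
    and M: "\<And>u v. a \<le> u \<Longrightarrow> u \<le> v \<Longrightarrow> v \<le> b \<Longrightarrow> norm (M v - M u) \<le> K * (v - u)"
  shows "absolutely_continuous_fun a b (\<lambda>t. prod (M t) (f t))"
proof -
  interpret bounded_bilinear prod by fact
  have "continuous_on {a..b} M"
  proof (rule absolutely_continuous_fun_imp_continuous_on)
    have "absolutely_continuous_fun a b M" 
      by (rule absolutely_continuous_fun_dominated[where f = f and C = "\<bar>K\<bar>", OF f])
        (rule order_trans[OF M], auto simp: mult_mono' abs_mult intro!: mult_mono)
    then show "absolutely_continuous_fun a b M" .
  qed
  then have "bounded (M ` {a..b})" by (intro compact_imp_bounded compact_continuous_image) auto
  moreover have "bounded (f ` {a..b})"
    using absolutely_continuous_fun_imp_continuous_on[OF f]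
    by (intro compact_imp_bounded compact_continuous_image) auto
  ultimately obtain c d where c: "\<And>t. t \<in> {a..b} \<Longrightarrow> norm (M t) \<le> c" and d: "\<And>t. t \<in> {a..b} \<Longrightarrow> norm (f t) \<le> d"
    unfolding bounded_iff by (metis image_eqI)
  obtain B where B: "B > 0" "\<And>x y. norm (prod x y) \<le> norm x * norm y * B"
    using pos_bounded by blast
  show ?thesis
  proof (rule absolutely_continuous_fun_dominated[where C = "B * (\<bar>c\<bar> + \<bar>K\<bar> * \<bar>d\<bar>)", OF f])
    fix u v assume uv: "a \<le> u" "u \<le> v" "v \<le> b"
    have "prod (M v) (f v) - prod (M u) (f u) = prod (M v) (f v - f u) + prod (M v - M u) (f u)"
      by (simp add: diff_left diff_right)
    then have "norm (prod (M v) (f v) - prod (M u) (f u)) \<le> norm (M v) * norm (f v - f u) * B + norm (M v - M u) * norm (f u) * B"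
      using norm_triangle_le add_mono B(2) by metis
    also have "\<dots> \<le> \<bar>c\<bar> * norm (f v - f u) * B + (\<bar>K\<bar> * (v - u)) * \<bar>d\<bar> * B"
    proof (intro add_mono mult_mono mult_right_mono)
      show "norm (M v) \<le> \<bar>c\<bar>" using c[of v] uv by auto
      show "norm (f u) \<le> \<bar>d\<bar>" using d[of u] uv by auto
      show "norm (M v - M u) \<le> \<bar>K\<bar> * (v - u)"
        using M[OF uv] uv by (smt (verit) mult_right_mono)
    qed (use uv B in auto)
    also have "\<dots> \<le> B * (\<bar>c\<bar> + \<bar>K\<bar> * \<bar>d\<bar>) * (norm (f v - f u) + (v - u))"
    proof -
      have "0 \<le> B * (\<bar>c\<bar> * (v - u)) + B * (\<bar>K\<bar> * \<bar>d\<bar> * norm (f v - f u))" using uv B by simp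
      then show ?thesis by (simp add: algebra_simps)
    qed
    finally show "norm (prod (M v) (f v) - prod (M u) (f u)) \<le> B * (\<bar>c\<bar> + \<bar>K\<bar> * \<bar>d\<bar>) * (norm (f v - f u) + (v - u))" .
  qed
qed

text \<open>Allows arbitrary finite index sets, so that the pieces of a tagged division can index
  the subintervals directly.\<close>

lemma absolutely_continuous_fun_finite:
  assumes f: "absolutely_continuous_fun a b f" and e: "(e::real) > 0"
  shows "\<exists>\<delta>>0. \<forall>(I::'i set) u v. finite I \<longrightarrow> (\<forall>i\<in>I. a \<le> u i \<and> u i \<le> v i \<and> v i \<le> b) \<longrightarrow>
     (\<forall>i\<in>I. \<forall>j\<in>I. i \<noteq> j \<longrightarrow> {u i<..<v i} \<inter> {u j<..<v j} = {}) \<longrightarrow>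
     (\<Sum>i\<in>I. v i - u i) < \<delta> \<longrightarrow> (\<Sum>i\<in>I. norm (f (v i) - f (u i))) < e"
proof -
  obtain \<delta> where \<delta>: "\<delta> > 0" "\<forall>(n::nat) u v.
        (\<forall>i<n. a \<le> u i \<and> u i \<le> v i \<and> v i \<le> b) \<longrightarrow>
        (\<forall>i<n. \<forall>j<n. i \<noteq> j \<longrightarrow> {u i<..<v i} \<inter> {u j<..<v j} = {}) \<longrightarrow>
        (\<Sum>i<n. v i - u i) < \<delta> \<longrightarrow> (\<Sum>i<n. norm (f (v i) - f (u i))) < e"
    using absolutely_continuous_funD[OF f e] by blast
  have "(\<Sum>i\<in>I. norm (f (v i) - f (u i))) < e"
    if I: "finite I" and uv: "\<forall>i\<in>I. a \<le> u i \<and> u i \<le> v i \<and> v i \<le> b"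
      and disj: "\<forall>i\<in>I. \<forall>j\<in>I. i \<noteq> j \<longrightarrow> {u i<..<v i} \<inter> {u j<..<v j} = {}"
      and sum: "(\<Sum>i\<in>I. v i - u i) < \<delta>" for I :: "'i set" and u v
  proof -
    obtain h where "bij_betw h {0..<card I} I" using ex_bij_betw_nat_finite[OF I] by blast
    then have h: "bij_betw h {..<card I} I" by (simp add: atLeast0LessThan)
    have hI: "h i \<in> I" if "i < card I" for i using h that by (auto simp: bij_betw_def)
    have "(\<Sum>i<card I. norm (f (v (h i)) - f (u (h i)))) < e"
    proof (rule \<delta>(2)[THEN spec, THEN spec, THEN spec, THEN mp, THEN mp, THEN mp])
      show "\<forall>i<card I. a \<le> u (h i) \<and> u (h i) \<le> v (h i) \<and> v (h i) \<le> b" using uv hI by blast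
      show "\<forall>i<card I. \<forall>j<card I. i \<noteq> j \<longrightarrow> {u (h i)<..<v (h i)} \<inter> {u (h j)<..<v (h j)} = {}"
      proof (intro allI impI)
        fix i j assume ij: "i < card I" "j < card I" "i \<noteq> j"
        then have "h i \<noteq> h j" using h by (auto simp: bij_betw_def inj_on_def)
        then show "{u (h i)<..<v (h i)} \<inter> {u (h j)<..<v (h j)} = {}" using disj hI ij by blast
      qed
      show "(\<Sum>i<card I. v (h i) - u (h i)) < \<delta>"
        using sum by (subst sum.reindex_bij_betw[OF h, of "\<lambda>i. v i - u i"])
    qed
    then show ?thesis by (subst (asm) sum.reindex_bij_betw[OF h, of "\<lambda>i. norm (f (v i) - f (u i))"])
  qed
  with \<delta>(1) show ?thesis by blast
qed

text \<open>The gauge at a point of the exceptional null set is an open cover of that set of small measure,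
  so absolute continuity controls the subintervals tagged there.\<close>
theorem absolutely_continuous_fun_has_integral:
  fixes f :: "real \<Rightarrow> 'a::banach"
  assumes ab: "a \<le> b" and f: "absolutely_continuous_fun a b f" and E: "negligible E"
    and deriv: "\<And>x. x \<in> {a..b} - E \<Longrightarrow> (f has_vector_derivative g x) (at x within {a..b})"
  shows "(g has_integral f b - f a) {a..b}"
proof -
  \<comment> \<open>With the value 0 on \<open>E\<close>, pieces tagged there contribute nothing but
    increments of \<open>f\<close>.\<close>
  define g' where "g' x = (if x \<in> E then 0 else g x)" for x
  have "(g' has_integral f b - f a) {a..b}"
    unfolding has_integral_real
  proof (intro allI impI)
    fix e :: real assume e: "e > 0"
    \<comment> \<open>Chosen so that \<open>e1 * (b - a + 1) = e / 2\<close>; the added 1 keeps the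
      divisor nonzero when \<open>a = b\<close>.\<close>
    define e1 where "e1 = e / (2 * (b - a + 1))"
    have e1: "e1 > 0" using e ab by (simp add: e1_def)
    obtain \<delta> where \<delta>: "\<delta> > 0" "\<forall>(I::(real \<times> real set) set) u v. finite I \<longrightarrow> (\<forall>i\<in>I. a \<le> u i \<and> u i \<le> v i \<and> v i \<le> b) \<longrightarrow>
     (\<forall>i\<in>I. \<forall>j\<in>I. i \<noteq> j \<longrightarrow> {u i<..<v i} \<inter> {u j<..<v j} = {}) \<longrightarrow>
     (\<Sum>i\<in>I. v i - u i) < \<delta> \<longrightarrow> (\<Sum>i\<in>I. norm (f (v i) - f (u i))) < e / 2"
      using absolutely_continuous_fun_finite[OF f half_gt_zero[OF e]] by blast
    have Em: "E \<in> sets lebesgue" "emeasure lebesgue E = 0"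
      using E by (auto simp: negligible_iff_null_sets null_sets_def)
    obtain Q where Q: "open Q" "E \<subseteq> Q" "Q - E \<in> lmeasurable" "emeasure lebesgue (Q - E) < ennreal \<delta>"
      using sets_lebesgue_outer_open[OF Em(1) \<delta>(1)] by blast
    have Qm: "Q \<in> lmeasurable" "measure lebesgue Q < \<delta>"
    proof -
      have "emeasure lebesgue Q \<le> emeasure lebesgue (Q - E) + emeasure lebesgue E"
        using Q(2,3) Em(1) by (metis Diff_partition Un_commute emeasure_subadditive fmeasurableD)
      then have *: "emeasure lebesgue Q < ennreal \<delta>" using Q(4) Em(2) by simp
      show "Q \<in> lmeasurable"
        using * Q(1) by (intro fmeasurableI) (auto intro: borel_open simp: less_top[symmetric] order.strict_trans)
      then show "measure lebesgue Q < \<delta>"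
        using * \<delta>(1) by (simp add: emeasure_eq_measure2 ennreal_less_iff)
    qed
    have "\<forall>x. \<exists>d>0. x \<in> {a..b} - E \<longrightarrow>
         (\<forall>y\<in>{a..b}. norm (y-x) < d \<longrightarrow> norm (f y - f x - (y-x) *\<^sub>R g x) \<le> e1 * norm (y-x))"
      using deriv[unfolded has_vector_derivative_def has_derivative_within_alt] e1
      by (metis zero_less_one)
    then obtain d where d: "\<And>x. 0 < d x" "\<And>x y. \<lbrakk>x \<in> {a..b}; x \<notin> E; y \<in> {a..b}; norm (y-x) < d x\<rbrakk>
        \<Longrightarrow> norm (f y - f x - (y-x) *\<^sub>R g x) \<le> e1 * norm (y-x)"
      by (metis DiffI)
    define \<gamma> where "\<gamma> x = (if x \<in> E then Q else ball x (d x))" for x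
    have gauge: "gauge \<gamma>" using Q d(1) by (auto simp: gauge_def \<gamma>_def)
    have main: "norm ((\<Sum>(x, k)\<in>p. Henstock_Kurzweil_Integration.content k *\<^sub>R g' x) - (f b - f a)) < e"
      if p: "p tagged_division_of {a..b}" and fine: "\<gamma> fine p" for p
    proof -
      have fin: "finite p" by (rule tagged_division_ofD(1)[OF p])
      have iv: "\<exists>u v. K = {u..v} \<and> u \<le> x \<and> x \<le> v \<and> a \<le> u \<and> v \<le> b" if xK: "(x, K) \<in> p" for x K
      proof -
        obtain u v where "K = cbox u v" using tagged_division_ofD(4)[OF p xK] by blast
        moreover have "x \<in> K" "K \<subseteq> {a..b}" using tagged_division_ofD(2,3)[OF p xK] by blast+
        ultimately show ?thesis by (auto simp: atLeastatMost_subset_iff)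
      qed
      have cont: "Henstock_Kurzweil_Integration.content K = Sup K - Inf K" if "(x, K) \<in> p" for x K
        using iv[OF that] by auto
      have ba: "b - a = (\<Sum>(x,K)\<in>p. Sup K - Inf K)" "f b - f a = (\<Sum>(x,K)\<in>p. f(Sup K) - f(Inf K))"
        using additive_tagged_division_1[where f= "\<lambda>x. x"] additive_tagged_division_1[where f= f] ab p by auto
      define I where "I = {z\<in>p. fst z \<in> E}"
      have I: "finite I" "I \<subseteq> p" using fin by (auto simp: I_def)
      define D where "D z = (case z of (x, K) \<Rightarrow> Henstock_Kurzweil_Integration.content K *\<^sub>R g' x - (f (Sup K) - f (Inf K)))" for z
      have "(\<Sum>(x, k)\<in>p. Henstock_Kurzweil_Integration.content k *\<^sub>R g' x) - (f b - f a) = sum D p"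
        by (simp add: ba D_def sum_subtractf case_prod_unfold)
      also have "\<dots> = sum D (p - I) + sum D I"
        using I fin by (metis sum.subset_diff)
      finally have split: "(\<Sum>(x, k)\<in>p. Henstock_Kurzweil_Integration.content k *\<^sub>R g' x) - (f b - f a) = sum D (p - I) + sum D I" .
      have "norm (sum D (p - I)) \<le> (\<Sum>z\<in>p - I. e1 * (case z of (x, K) \<Rightarrow> Sup K - Inf K))"
      proof (rule sum_norm_le, safe)
        fix x K assume xK: "(x, K) \<in> p" "(x, K) \<notin> I"
        then have xE: "x \<notin> E" by (simp add: I_def)
        obtain u v where K: "K = {u..v}" "u \<le> x" "x \<le> v" "a \<le> u" "v \<le> b" using iv[OF xK(1)] by blast
        have "K \<subseteq> ball x (d x)" using fineD[OF fine xK(1)] xE by (simp add: \<gamma>_def)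
        then have near: "norm (u - x) < d x" "norm (v - x) < d x"
        proof -
          have "u \<in> ball x (d x)" "v \<in> ball x (d x)" using K by (intro subsetD[OF \<open>K \<subseteq> ball x (d x)\<close>]; simp)+
          then show "norm (u - x) < d x" "norm (v - x) < d x" by (auto simp: dist_norm)
        qed
        \<comment> \<open>Since the tag lies between the endpoints, the two linearization errors are
          bounded by \<open>e1\<close> times \<open>x - u\<close> and \<open>v - x\<close>, which
          add up to the length of \<open>K\<close>.\<close>
        have "D (x, K) = (f u - f x - (u - x) *\<^sub>R g x) - (f v - f x - (v - x) *\<^sub>R g x)"
          using K xE cont[OF xK(1)] by (simp add: D_def g'_def algebra_simps)
        also have "norm \<dots> \<le> e1 * norm (u - x) + e1 * norm (v - x)"
          using K xE near by (intro order_trans[OF norm_triangle_ineq4] add_mono d(2)) auto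
        also have "\<dots> = e1 * (Sup K - Inf K)" using K by (simp add: algebra_simps)
        finally show "norm (D (x, K)) \<le> e1 * (Sup K - Inf K)" .
      qed
      also have "\<dots> \<le> (\<Sum>z\<in>p. e1 * (case z of (x, K) \<Rightarrow> Sup K - Inf K))"
        using fin e1 by (intro sum_mono2) (auto dest!: iv)
      also have "\<dots> = e1 * (b - a)" by (simp add: ba(1) sum_distrib_left)
      also have "\<dots> \<le> e1 * (b - a + 1)" using e1 by simp
      also have "\<dots> = e / 2" using ab by (simp add: e1_def field_simps)
      finally have 1: "norm (sum D (p - I)) \<le> e / 2" .
      have meas: "(\<Sum>z\<in>I. Sup (snd z) - Inf (snd z)) < \<delta>"
      proof -
        have "(\<Sum>z\<in>I. Sup (snd z) - Inf (snd z)) = (\<Sum>z\<in>I. measure lebesgue (snd z))"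
        proof (intro sum.cong refl)
          fix z assume "z \<in> I"
          then obtain x K where z: "z = (x, K)" "(x, K) \<in> p" using I(2) by (cases z) auto
          from iv[OF z(2)] show "Sup (snd z) - Inf (snd z) = measure lebesgue (snd z)" by (auto simp: z(1))
        qed
        also have "\<dots> = measure lebesgue (\<Union>(snd ` I))"
        proof (rule measure_negligible_finite_Union_image[symmetric, OF I(1)])
          fix z assume "z \<in> I" 
          then obtain x K where z: "z = (x, K)" "(x, K) \<in> p" using I(2) by (cases z) auto
          from iv[OF z(2)] show "snd z \<in> lmeasurable" by (auto simp: z(1))
        next
          show "pairwise (\<lambda>x y. negligible (snd x \<inter> snd y)) I"
          proof (rule pairwiseI)
            fix z w assume zw: "z \<in> I" "w \<in> I" "z \<noteq> w"
            obtain x K y L where eq: "z = (x, K)" "w = (y, L)" by (cases z, cases w)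
            have pp: "(x, K) \<in> p" "(y, L) \<in> p" using zw I(2) eq by auto
            then have "interior K \<inter> interior L = {}" using tagged_division_ofD(5)[OF p pp] zw eq by blast
            moreover have "convex (K \<inter> L)" using iv[OF pp(1)] iv[OF pp(2)] by (auto intro!: convex_Int)
            ultimately show "negligible (snd z \<inter> snd w)" by (simp add: eq negligible_convex_interior)
          qed
        qed
        also have "\<dots> \<le> measure lebesgue Q"
        proof (rule measure_mono_fmeasurable[OF _ _ Qm(1)])
          show "\<Union>(snd ` I) \<subseteq> Q" 
          proof safe
            fix x K t assume xK: "(x, K) \<in> I" and "t \<in> snd (x, K)"
            moreover have "K \<subseteq> \<gamma> x" using xK I(2) by (intro fineD[OF fine]) auto
            moreover have "x \<in> E" using xK by (simp add: I_def)
            ultimately show "t \<in> Q" by (auto simp: \<gamma>_def)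
          qed
          show "\<Union>(snd ` I) \<in> sets lebesgue"
          proof (intro sets.finite_Union)
            show "finite (snd ` I)" using I(1) by simp
            show "snd ` I \<subseteq> sets lebesgue" using I(2) iv by fastforce
          qed
        qed
        finally show ?thesis using Qm(2) by simp
      qed
      have "norm (sum D I) \<le> (\<Sum>z\<in>I. norm (f (Sup (snd z)) - f (Inf (snd z))))"
        by (rule sum_norm_le) (auto simp: D_def I_def g'_def norm_minus_commute)
      also have "\<dots> < e / 2"
      proof (rule \<delta>(2)[THEN spec[of _ I], THEN spec[of _ "\<lambda>z. Inf (snd z)"], THEN spec[of _ "\<lambda>z. Sup (snd z)"],
          THEN mp, THEN mp, THEN mp, THEN mp, OF I(1) _ _ meas])
        show "\<forall>i\<in>I. a \<le> Inf (snd i) \<and> Inf (snd i) \<le> Sup (snd i) \<and> Sup (snd i) \<le> b"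
        proof
          fix z assume "z \<in> I"
          then obtain x K where z: "z = (x, K)" "(x, K) \<in> p" using I(2) by (cases z) auto
          from iv[OF z(2)] show "a \<le> Inf (snd z) \<and> Inf (snd z) \<le> Sup (snd z) \<and> Sup (snd z) \<le> b"
            by (auto simp: z(1))
        qed
        show "\<forall>i\<in>I. \<forall>j\<in>I. i \<noteq> j \<longrightarrow>
            {Inf (snd i)<..<Sup (snd i)} \<inter> {Inf (snd j)<..<Sup (snd j)} = {}"
        proof (intro ballI impI)
          fix z w assume zw: "z \<in> I" "w \<in> I" "z \<noteq> w"
          obtain x K y L where eq: "z = (x, K)" "w = (y, L)" by (cases z, cases w)
          have pp: "(x, K) \<in> p" "(y, L) \<in> p" using zw I(2) eq by auto
          then have "interior K \<inter> interior L = {}" using tagged_division_ofD(5)[OF p pp] zw eq by blast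
          then show "{Inf (snd z)<..<Sup (snd z)} \<inter> {Inf (snd w)<..<Sup (snd w)} = {}"
            using iv[OF pp(1)] iv[OF pp(2)] by (auto simp: eq)
        qed
      qed
      finally have 2: "norm (sum D I) < e / 2" .
      show ?thesis unfolding split using norm_triangle_ineq[of "sum D (p - I)" "sum D I"] 1 2 by simp
    qed
    show "\<exists>\<gamma>. gauge \<gamma> \<and> (\<forall>p. p tagged_division_of {a..b} \<and> \<gamma> fine p \<longrightarrow>
        norm ((\<Sum>(x, k)\<in>p. Henstock_Kurzweil_Integration.content k *\<^sub>R g' x) - (f b - f a)) < e)"
      by (intro exI[of _ \<gamma>] conjI allI impI gauge main) simp_all
  qed
  then show ?thesis
    by (rule has_integral_spike[OF E, rotated]) (auto simp: g'_def)
qed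

section \<open>Bounded derivatives and Hessians\<close>

lemma Cb_imp_continuous_bounded:
  "Cb k f \<Longrightarrow> continuous_on UNIV f \<and> bounded (range f)"
  by (cases k) (auto intro: differentiable_imp_continuous_on simp: differentiable_on_def differentiable_at_withinI)

lemma Cb_bounded_linear:
  fixes f :: "'a::euclidean_space \<Rightarrow> 'b::euclidean_space" and h :: "'b \<Rightarrow> 'c::euclidean_space"
  assumes h: "bounded_linear h"
  shows "Cb k f \<Longrightarrow> Cb k (\<lambda>x. h (f x))"
proof (induction k arbitrary: f)
  case 0
  then show ?case
    using bounded_linear_image[OF _ h, of "range f"]
    by (auto simp: image_image intro!: bounded_linear.continuous_on[OF h])
next
  case (Suc k)
  have d: "((\<lambda>x. h (f x)) has_derivative (\<lambda>v. h (frechet_derivative f (at x) v))) (at x)" for x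
    using Suc.prems by (intro bounded_linear.has_derivative[OF h]) (simp add: frechet_derivative_works[symmetric])
  then have "frechet_derivative (\<lambda>x. h (f x)) (at x) = (\<lambda>v. h (frechet_derivative f (at x) v))" for x
    by (rule frechet_derivative_at[symmetric])
  then show ?case
    using Suc bounded_linear_image[OF _ h, of "range f"] d
    by (auto simp: image_image differentiable_def)
qed

lemma Cb_sum:
  fixes f :: "'i \<Rightarrow> 'a::euclidean_space \<Rightarrow> 'b::euclidean_space"
  assumes "finite I"
  shows "(\<And>i. i \<in> I \<Longrightarrow> Cb k (f i)) \<Longrightarrow> Cb k (\<lambda>x. \<Sum>i\<in>I. f i x)"
proof (induction k arbitrary: f)
  have bdd: "bounded (range (\<lambda>x. \<Sum>i\<in>I. f i x))" if "\<And>i. i \<in> I \<Longrightarrow> bounded (range (f i))" for f :: "'i \<Rightarrow> 'a \<Rightarrow> 'b"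
  proof -
    have "\<forall>i\<in>I. \<exists>c. \<forall>x. norm (f i x) \<le> c" using that unfolding bounded_iff by blast
    then obtain c where c: "\<And>i x. i \<in> I \<Longrightarrow> norm (f i x) \<le> c i" by metis
    have "norm (\<Sum>i\<in>I. f i x) \<le> (\<Sum>i\<in>I. c i)" for x by (rule sum_norm_le) (rule c)
    then show ?thesis unfolding bounded_iff by blast
  qed
  {
    case 0
    then show ?case using bdd[of f] by (auto intro!: continuous_on_sum)
  next
    case (Suc k)
    have d: "((\<lambda>x. \<Sum>i\<in>I. f i x) has_derivative (\<lambda>v. \<Sum>i\<in>I. frechet_derivative (f i) (at x) v)) (at x)" for x
      using Suc.prems by (intro has_derivative_sum) (simp add: frechet_derivative_works[symmetric])
    then have "frechet_derivative (\<lambda>x. \<Sum>i\<in>I. f i x) (at x) = (\<lambda>v. \<Sum>i\<in>I. frechet_derivative (f i) (at x) v)" for x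
      by (rule frechet_derivative_at[symmetric])
    then show ?case
      using Suc bdd[of f] differentiableI[OF d] by auto
  }
qed

lemma jacobian_entry: "jacobian f (at x) $ i $ j = frechet_derivative f (at x) (axis j 1) $ i"
  by (simp add: jacobian_def matrix_def)

lemma Cb_jacobian_entry: "Cb (Suc k) f \<Longrightarrow> Cb k (\<lambda>x. jacobian f (at x) $ i $ j)"
  unfolding jacobian_entry by (rule Cb_bounded_linear[OF bounded_linear_vec_nth]) simp

lemma norm_matrix_le: "norm (A :: real^'n^'m) \<le> (\<Sum>i\<in>UNIV. \<Sum>j\<in>UNIV. \<bar>A $ i $ j\<bar>)"
proof -
  have "norm A \<le> (\<Sum>i\<in>UNIV. norm (A $ i))"
    unfolding norm_vec_def[of A] by (rule L2_set_le_sum) simp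
  also have "\<dots> \<le> (\<Sum>i\<in>UNIV. \<Sum>j\<in>UNIV. \<bar>A $ i $ j\<bar>)"
    by (intro sum_mono norm_le_l1_cart)
  finally show ?thesis .
qed

lemma Cb_jacobian_bounded_continuous:
  fixes f :: "real^'n \<Rightarrow> real^'m"
  assumes "Cb (Suc k) f"
  shows "continuous_on UNIV (\<lambda>x. jacobian f (at x))" "\<exists>c. \<forall>x. norm (jacobian f (at x)) \<le> c"
proof -
  have e: "continuous_on UNIV (\<lambda>x. jacobian f (at x) $ i $ j)" "bounded (range (\<lambda>x. jacobian f (at x) $ i $ j))" for i j
    using Cb_imp_continuous_bounded[OF Cb_jacobian_entry[OF assms]] by blast+
  have "continuous_on UNIV (\<lambda>x. \<chi> i. \<chi> j. jacobian f (at x) $ i $ j)"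
    by (intro continuous_on_vec_lambda e)
  then show "continuous_on UNIV (\<lambda>x. jacobian f (at x))" by (simp only: vec_nth_inverse)
  have "\<forall>i j. \<exists>c. \<forall>x. \<bar>jacobian f (at x) $ i $ j\<bar> \<le> c" using e(2) unfolding bounded_iff by auto
  then obtain c where c: "\<And>i j x. \<bar>jacobian f (at x) $ i $ j\<bar> \<le> c i j" by metis
  have "norm (jacobian f (at x)) \<le> (\<Sum>i\<in>UNIV. \<Sum>j\<in>UNIV. c i j)" for x
    by (intro order_trans[OF norm_matrix_le] sum_mono c)
  then show "\<exists>c. \<forall>x. norm (jacobian f (at x)) \<le> c" by blast
qed

lemma Cb_divergence:
  fixes b :: "real^'n \<Rightarrow> real^'n"
  assumes "Cb (Suc k) b"
  shows "Cb k (divergence b)"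
proof -
  have "Cb k (\<lambda>x. \<Sum>i\<in>UNIV. jacobian b (at x) $ i $ i)"
    by (intro Cb_sum Cb_jacobian_entry assms) simp
  then show ?thesis by (simp add: divergence_def[abs_def] trace_def)
qed

lemma gradient_Cb_differentiable:
  fixes g :: "real^'n \<Rightarrow> real"
  assumes g: "Cb (Suc (Suc k)) g"
  shows "gradient g differentiable (at x)"
    and "hessian g x $ i $ j = frechet_derivative (\<lambda>y. frechet_derivative g (at y) (axis i 1)) (at x) (axis j 1)"
proof -
  have d: "(\<lambda>y. frechet_derivative g (at y) v) differentiable (at x)" for v using g by simp
  have "((\<lambda>y. \<chi> i. frechet_derivative g (at y) (axis i 1)) has_derivative
      (\<lambda>v. \<chi> i. frechet_derivative (\<lambda>y. frechet_derivative g (at y) (axis i 1)) (at x) v)) (at x)"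
  proof (subst has_derivative_componentwise_within, rule ballI)
    fix e :: "real^'n" assume "e \<in> Basis"
    then obtain i where e: "e = axis i 1" by (auto simp: Basis_vec_def)
    have "((\<lambda>y. frechet_derivative g (at y) (axis i 1)) has_derivative
        frechet_derivative (\<lambda>y. frechet_derivative g (at y) (axis i 1)) (at x)) (at x)"
      using d by (simp add: frechet_derivative_works[symmetric])
    then show "((\<lambda>y. (\<chi> i. frechet_derivative g (at y) (axis i 1)) \<bullet> e) has_derivative
        (\<lambda>v. (\<chi> i. frechet_derivative (\<lambda>y. frechet_derivative g (at y) (axis i 1)) (at x) v) \<bullet> e)) (at x)"
      by (simp add: e inner_axis)
  qed
  then have *: "(gradient g has_derivative
      (\<lambda>v. \<chi> i. frechet_derivative (\<lambda>y. frechet_derivative g (at y) (axis i 1)) (at x) v)) (at x)"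
    by (simp add: gradient_def[abs_def])
  then show "gradient g differentiable (at x)" unfolding differentiable_def by blast
  show "hessian g x $ i $ j = frechet_derivative (\<lambda>y. frechet_derivative g (at y) (axis i 1)) (at x) (axis j 1)"
    unfolding hessian_def jacobian_entry frechet_derivative_at[OF *, symmetric] by simp
qed

lemma Cb_hessian_entry:
  fixes g :: "real^'n \<Rightarrow> real"
  assumes "Cb (Suc (Suc k)) g"
  shows "Cb k (\<lambda>x. hessian g x $ i $ j)"
  using assms unfolding gradient_Cb_differentiable(2)[OF assms] by simp

lemma Cb_hessian_bounded_continuous:
  fixes g :: "real^'n \<Rightarrow> real"
  assumes "Cb (Suc (Suc k)) g"
  shows "continuous_on UNIV (hessian g)" "\<exists>c. \<forall>x. norm (hessian g x) \<le> c"
proof -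
  have e: "continuous_on UNIV (\<lambda>x. hessian g x $ i $ j)" "bounded (range (\<lambda>x. hessian g x $ i $ j))" for i j
    using Cb_imp_continuous_bounded[OF Cb_hessian_entry[OF assms]] by blast+
  have "continuous_on UNIV (\<lambda>x. \<chi> i. \<chi> j. hessian g x $ i $ j)"
    by (intro continuous_on_vec_lambda e)
  then show "continuous_on UNIV (hessian g)" by (simp only: vec_nth_inverse)
  have "\<forall>i j. \<exists>c. \<forall>x. \<bar>hessian g x $ i $ j\<bar> \<le> c" using e(2) unfolding bounded_iff by auto
  then obtain c where c: "\<And>i j x. \<bar>hessian g x $ i $ j\<bar> \<le> c i j" by metis
  have "norm (hessian g x) \<le> (\<Sum>i\<in>UNIV. \<Sum>j\<in>UNIV. c i j)" for x
    by (intro order_trans[OF norm_matrix_le] sum_mono c)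
  then show "\<exists>c. \<forall>x. norm (hessian g x) \<le> c" by blast
qed

text \<open>The mean value theorem is applied first along \<open>v\<close>, to the increment of
  \<open>g\<close> across \<open>h *\<^sub>R w\<close>, and then along \<open>w\<close>, to the
  derivative in direction \<open>v\<close>. The second difference on the left is symmetric in
  \<open>v\<close> and \<open>w\<close>, although this derivation is not.\<close>

lemma second_difference_mean_value:
  fixes g :: "'a::euclidean_space \<Rightarrow> real"
  assumes g: "\<And>x. g differentiable (at x)"
    and g': "\<And>x. (\<lambda>y. frechet_derivative g (at y) v) differentiable (at x)" and h: "h > 0"
  shows "\<exists>s t. 0 < s \<and> s < h \<and> 0 < t \<and> t < h \<and>
    g (x + h *\<^sub>R v + h *\<^sub>R w) - g (x + h *\<^sub>R v) - g (x + h *\<^sub>R w) + g x =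
    h * h * frechet_derivative (\<lambda>y. frechet_derivative g (at y) v) (at (x + s *\<^sub>R v + t *\<^sub>R w)) w"
proof -
  have line: "((\<lambda>s. f (y + s *\<^sub>R u)) has_real_derivative frechet_derivative f (at (y + s *\<^sub>R u)) u) (at s)"
    if f: "\<And>x. f differentiable (at x)" for f :: "'a \<Rightarrow> real" and y u s
  proof -
    have f': "(f has_derivative frechet_derivative f (at (y + s *\<^sub>R u))) (at (y + s *\<^sub>R u))"
      using f by (simp add: frechet_derivative_works[symmetric])
    have "((\<lambda>s. y + s *\<^sub>R u) has_vector_derivative u) (at s)"
      by (auto intro!: derivative_eq_intros)
    from vector_derivative_diff_chain_within[OF this has_derivative_at_withinI[OF f']]
    show ?thesis by (simp add: o_def has_real_derivative_iff_has_vector_derivative)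
  qed
  define \<phi> where "\<phi> s = g ((x + h *\<^sub>R w) + s *\<^sub>R v) - g (x + s *\<^sub>R v)" for s
  define D where "D y = frechet_derivative g (at y) v" for y
  have "(\<phi> has_real_derivative D ((x + h *\<^sub>R w) + s *\<^sub>R v) - D (x + s *\<^sub>R v)) (at s)" for s
    unfolding \<phi>_def D_def by (intro DERIV_diff line g)
  from MVT2[OF h this] obtain s where s: "0 < s" "s < h"
    "\<phi> h - \<phi> 0 = (h - 0) * (D ((x + h *\<^sub>R w) + s *\<^sub>R v) - D (x + s *\<^sub>R v))" by blast
  have "((\<lambda>t. D ((x + s *\<^sub>R v) + t *\<^sub>R w)) has_real_derivative
      frechet_derivative D (at ((x + s *\<^sub>R v) + t *\<^sub>R w)) w) (at t)" for t
    using g' by (intro line) (simp add: D_def[abs_def])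
  from MVT2[OF h this] obtain t where t: "0 < t" "t < h"
    "D ((x + s *\<^sub>R v) + h *\<^sub>R w) - D ((x + s *\<^sub>R v) + 0 *\<^sub>R w) = (h - 0) * frechet_derivative D (at ((x + s *\<^sub>R v) + t *\<^sub>R w)) w"
    by blast
  have "\<phi> h - \<phi> 0 = h * h * frechet_derivative D (at (x + s *\<^sub>R v + t *\<^sub>R w)) w"
    using s(3) t(3) by (simp add: add_ac)
  then show ?thesis using s t unfolding \<phi>_def D_def[abs_def] 
    by (intro exI[of _ s] exI[of _ t]) (simp add: add_ac)
qed

text \<open>Evaluating the symmetric second difference in both orders equates the two mixed
  derivatives at two nearby points; continuity moves both points to \<open>x\<close>.\<close>

lemma second_derivative_symmetric:
  fixes g :: "'a::euclidean_space \<Rightarrow> real"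
  assumes g: "Cb (Suc (Suc k)) g"
  shows "frechet_derivative (\<lambda>y. frechet_derivative g (at y) v) (at x) w =
         frechet_derivative (\<lambda>y. frechet_derivative g (at y) w) (at x) v"
proof -
  define F where "F v w y = frechet_derivative (\<lambda>y. frechet_derivative g (at y) v) (at y) w" for v w y
  have d: "\<And>x. g differentiable (at x)" "\<And>v x. (\<lambda>y. frechet_derivative g (at y) v) differentiable (at x)"
    using g by simp_all
  have "Cb k (F v w)" for v w using g by (simp add: F_def[abs_def])
  then have cont: "continuous_on UNIV (F v w)" for v w using Cb_imp_continuous_bounded by blast
  have "\<bar>F v w x - F w v x\<bar> \<le> 0 + e" if e: "e > 0" for e
  proof -
    have "\<exists>\<delta>>0. \<forall>y. dist y x < \<delta> \<longrightarrow> dist (F v w y) (F v w x) < e / 2" for v w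
      using cont[of v w] e unfolding continuous_on_iff by (metis UNIV_I half_gt_zero)
    then obtain \<delta>1 \<delta>2 where \<delta>1: "\<delta>1 > 0" "\<And>y. dist y x < \<delta>1 \<Longrightarrow> dist (F v w y) (F v w x) < e / 2"
      and \<delta>2: "\<delta>2 > 0" "\<And>y. dist y x < \<delta>2 \<Longrightarrow> dist (F w v y) (F w v x) < e / 2"
      by metis
    define \<delta> where "\<delta> = min \<delta>1 \<delta>2"
    \<comment> \<open>Makes every intermediate point lie within \<delta> of \<open>x\<close>; the
      added 1 covers the case that both directions are zero.\<close>
    define h where "h = \<delta> / (norm v + norm w + 1)"
    have pos: "norm v + norm w + 1 > 0" by (simp add: add_nonneg_pos)
    have h: "h > 0" using \<delta>1(1) \<delta>2(1) pos by (simp add: h_def \<delta>_def)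
    have hd: "h * (norm v + norm w + 1) = \<delta>" using pos by (simp add: h_def)
    have near: "dist (x + s *\<^sub>R p + t *\<^sub>R q) x < \<delta>"
      if "0 < s" "s < h" "0 < t" "t < h" "norm p + norm q = norm v + norm w" for s t p q
    proof -
      have "dist (x + s *\<^sub>R p + t *\<^sub>R q) x = norm (s *\<^sub>R p + t *\<^sub>R q)" by (simp add: dist_norm)
      also have "\<dots> \<le> s * norm p + t * norm q" using that by (intro order_trans[OF norm_triangle_ineq]) simp
      also have "\<dots> \<le> h * norm p + h * norm q" using that by (intro add_mono mult_right_mono) auto
      also have "\<dots> < \<delta>" using that h unfolding hd[symmetric] by (simp add: distrib_left[symmetric])
      finally show ?thesis .
    qed
    obtain s t where st: "0 < s" "s < h" "0 < t" "t < h"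
      and 1: "g (x + h *\<^sub>R v + h *\<^sub>R w) - g (x + h *\<^sub>R v) - g (x + h *\<^sub>R w) + g x = h * h * F v w (x + s *\<^sub>R v + t *\<^sub>R w)"
      using second_difference_mean_value[OF d h, of x v w] unfolding F_def by blast
    obtain s' t' where st': "0 < s'" "s' < h" "0 < t'" "t' < h"
      and 2: "g (x + h *\<^sub>R w + h *\<^sub>R v) - g (x + h *\<^sub>R w) - g (x + h *\<^sub>R v) + g x = h * h * F w v (x + s' *\<^sub>R w + t' *\<^sub>R v)"
      using second_difference_mean_value[OF d h, of x w v] unfolding F_def by blast
    have "h * h * F v w (x + s *\<^sub>R v + t *\<^sub>R w) = h * h * F w v (x + s' *\<^sub>R w + t' *\<^sub>R v)"
      unfolding 1[symmetric] 2[symmetric] by (simp add: add_ac)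
    then have eq: "F v w (x + s *\<^sub>R v + t *\<^sub>R w) = F w v (x + s' *\<^sub>R w + t' *\<^sub>R v)" using h by simp
    have "dist (F v w (x + s *\<^sub>R v + t *\<^sub>R w)) (F v w x) < e / 2"
      using near[OF st, of v w] by (intro \<delta>1) (simp add: \<delta>_def)
    moreover have "dist (F w v (x + s' *\<^sub>R w + t' *\<^sub>R v)) (F w v x) < e / 2"
      using near[OF st', of w v] by (intro \<delta>2) (simp add: \<delta>_def add.commute)
    ultimately show ?thesis unfolding eq dist_real_def by linarith
  qed
  then have "\<bar>F v w x - F w v x\<bar> \<le> 0" by (rule field_le_epsilon)
  then show ?thesis by (simp add: F_def)
qed

lemma hessian_symmetric:
  fixes g :: "real^'n \<Rightarrow> real"
  assumes "Cb (Suc (Suc k)) g"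
  shows "transpose (hessian g x) = hessian g x"
  by (simp add: vec_eq_iff transpose_def gradient_Cb_differentiable(2)[OF assms] second_derivative_symmetric[OF assms])

lemma hessian_mult_velocity:
  fixes g :: "real^'n \<Rightarrow> real" and X :: "real \<Rightarrow> real^'n"
  assumes g: "Cb (Suc (Suc k)) g" and X: "(X has_vector_derivative X') (at t)"
    and grad: "\<And>s. gradient g (X s) = 0"
  shows "hessian g (X t) *v X' = 0"
proof -
  have "(gradient g has_derivative (\<lambda>h. hessian g (X t) *v h)) (at (X t))"
    using gradient_Cb_differentiable(1)[OF g] unfolding hessian_def jacobian_works .
  from vector_derivative_diff_chain_within[OF X has_derivative_at_withinI[OF this]]
  have "((\<lambda>s. 0) has_vector_derivative hessian g (X t) *v X') (at t)"
    by (simp add: o_def grad)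
  then show ?thesis
    using has_vector_derivative_const vector_derivative_unique_at by blast
qed

text \<open>By symmetry \<open>v\<close> lies in the left kernel as well, so all cross terms drop
  out.\<close>

lemma quadratic_form_kernel:
  fixes K :: "real^'n^'n"
  assumes sym: "transpose K = K" and v: "K *v v = 0"
  shows "\<eta> \<bullet> (K *v \<eta>) = (\<eta> - c *\<^sub>R v) \<bullet> (K *v (\<eta> - c *\<^sub>R v))"
proof -
  have "v \<bullet> (K *v x) = 0" for x
    using dot_lmul_matrix[of v K x] sym v by (metis inner_zero_left transpose_matrix_vector)
  then show ?thesis
    by (simp add: matrix_vector_mult_diff_distrib v inner_diff_left matrix_vector_mult_scaleR)
qed

section \<open>L2 estimates for the inhomogeneous linear equation\<close>

lemma integral_power2_le:
  fixes \<phi> :: "real \<Rightarrow> real"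
  assumes cd: "c \<le> d" and \<phi>: "\<phi> integrable_on {c..d}" and \<phi>2: "(\<lambda>s. (\<phi> s)\<^sup>2) integrable_on {c..d}"
  shows "(integral {c..d} \<phi>)\<^sup>2 \<le> (d - c) * integral {c..d} (\<lambda>s. (\<phi> s)\<^sup>2)"
proof (cases "c = d")
  case False
  then have pos: "d - c > 0" using cd by simp
  define I where "I = integral {c..d} \<phi>"
  define J where "J = integral {c..d} (\<lambda>s. (\<phi> s)\<^sup>2)"
  \<comment> \<open>The mean of \<phi>: integrating the nonnegative function
    \<open>(\<phi> s - m)\<^sup>2\<close> yields the Cauchy-Schwarz inequality against the constant
    1.\<close>
  define m where "m = I / (d - c)"
  have "((\<lambda>s. (\<phi> s)\<^sup>2 - 2 * m * \<phi> s + m\<^sup>2) has_integral (J - 2 * m * I + (d - c) *\<^sub>R m\<^sup>2)) {c..d}"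
    unfolding I_def J_def
    by (intro has_integral_add has_integral_diff has_integral_mult_right integrable_integral \<phi> \<phi>2)
      (use has_integral_const_real[of "m\<^sup>2" c d] cd in simp)
  then have nonneg: "0 \<le> J - 2 * m * I + (d - c) *\<^sub>R m\<^sup>2"
  proof (rule has_integral_nonneg)
    fix s
    have "(\<phi> s)\<^sup>2 - 2 * m * \<phi> s + m\<^sup>2 = (\<phi> s - m)\<^sup>2" by (simp add: power2_eq_square algebra_simps)
    then show "0 \<le> (\<phi> s)\<^sup>2 - 2 * m * \<phi> s + m\<^sup>2" by simp
  qed
  have mI: "(d - c) * m = I" using pos by (simp add: m_def)
  then have "J - 2 * m * I + (d - c) *\<^sub>R m\<^sup>2 = J - m * I"
    by (simp add: power2_eq_square mult.assoc[symmetric])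
  with nonneg have "0 \<le> J - m * I" by (simp add: mult.commute)
  then have "0 \<le> (d - c) * (J - m * I)" using pos by (intro mult_nonneg_nonneg) auto
  also have "\<dots> = (d - c) * J - ((d - c) * m) * I" by (simp add: right_diff_distrib)
  finally show ?thesis by (simp add: mI power2_eq_square I_def J_def)
qed simp

text \<open>\<open>M\<close> is an inverse fundamental matrix up to its initial value, so the
  derivative of \<open>M s *v \<eta> s\<close> is \<open>M s\<close> applied to the residual almost
  everywhere. Integration and Cauchy-Schwarz finish. Keeping \<open>M\<close> abstract permits a
  flow restarted at any time.\<close>

lemma variation_of_constants_bound:
  fixes \<eta> :: "real \<Rightarrow> real^'n" and M A :: "real \<Rightarrow> real^'n^'n"
  assumes cd: "c \<le> d" and \<eta>: "absolutely_continuous_fun c d \<eta>"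
    and E: "negligible E" "\<And>s. s \<in> {c..d} - E \<Longrightarrow> (\<eta> has_vector_derivative g s) (at s within {c..d})"
    and M: "\<And>s. (M has_vector_derivative - (M s ** A s)) (at s)" and A: "continuous_on UNIV A"
    and m: "\<And>s. s \<in> {c..d} \<Longrightarrow> norm (M s) \<le> m"
    and K: "\<And>X y. norm ((X :: real^'n^'n) *v (y :: real^'n)) \<le> norm X * norm y * K"
    and f: "(\<lambda>s. norm (g s - A s *v \<eta> s)) integrable_on {c..d}"
      "(\<lambda>s. (norm (g s - A s *v \<eta> s))\<^sup>2) integrable_on {c..d}"
    and t: "t \<in> {c..d}" and K0: "K > 0"
  shows "(norm (M t *v \<eta> t - M c *v \<eta> c))\<^sup>2 \<le> (m * K)\<^sup>2 * (d - c) * integral {c..d} (\<lambda>s. (norm (g s - A s *v \<eta> s))\<^sup>2)"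
proof -
  define f where "f s = g s - A s *v \<eta> s" for s
  interpret mv: bounded_bilinear "(*v) :: real^'n^'n \<Rightarrow> real^'n \<Rightarrow> real^'n"
    by (rule bounded_bilinear_matrix_vector_mult)
  interpret mm: bounded_bilinear "(**) :: real^'n^'n \<Rightarrow> real^'n^'n \<Rightarrow> real^'n^'n"
    by (rule bounded_bilinear_matrix_mult)
  have Mc: "continuous_on UNIV M"
    using M by (auto simp: continuous_on_eq_continuous_at intro!: has_vector_derivative_continuous)
  have "continuous_on {c..d} (\<lambda>s. M s ** A s)"
    by (intro mm.continuous_on continuous_on_subset[OF Mc] continuous_on_subset[OF A]) auto
  then have "bounded ((\<lambda>s. M s ** A s) ` {c..d})"
    by (intro compact_imp_bounded compact_continuous_image) auto
  then obtain B where B: "\<And>s. s \<in> {c..d} \<Longrightarrow> norm (M s ** A s) \<le> B"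
    unfolding bounded_iff by blast
  have lip: "norm (M v - M u) \<le> B * (v - u)" if "c \<le> u" "u \<le> v" "v \<le> d" for u v
  proof (cases "u = v")
    case False
    have "norm (M v - M u) \<le> B * v - B * u"
    proof (rule differentiable_bound_general[where f' = "\<lambda>s. - (M s ** A s)" and \<phi>' = "\<lambda>_. B"])
      show "((\<lambda>x. B * x) has_vector_derivative B) (at x)" for x
        by (auto intro!: derivative_eq_intros simp flip: has_real_derivative_iff_has_vector_derivative)
    qed (use False that B M in \<open>auto intro!: continuous_intros continuous_on_subset[OF Mc]\<close>)
    then show ?thesis by (simp add: algebra_simps)
  qed simp
  have "absolutely_continuous_fun c d (\<lambda>s. M s *v \<eta> s)"
    by (rule absolutely_continuous_fun_bilinear[OF bounded_bilinear_matrix_vector_mult \<eta> lip])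
  then have "absolutely_continuous_fun c t (\<lambda>s. M s *v \<eta> s)"
    by (rule absolutely_continuous_fun_subinterval) (use t in auto)
  then have int: "((\<lambda>s. M s *v f s) has_integral M t *v \<eta> t - M c *v \<eta> c) {c..t}"
  proof (rule absolutely_continuous_fun_has_integral[rotated])
    fix s assume s: "s \<in> {c..t} - E"
    have "(\<eta> has_vector_derivative g s) (at s within {c..t})"
      by (rule has_vector_derivative_within_subset[OF E(2)]) (use s t in auto)
    then have "((\<lambda>s. M s *v \<eta> s) has_vector_derivative M s *v g s + (- (M s ** A s)) *v \<eta> s) (at s within {c..t})"
      by (intro mv.has_vector_derivative has_vector_derivative_at_within[OF M])
    then show "((\<lambda>s. M s *v \<eta> s) has_vector_derivative M s *v f s) (at s within {c..t})"
      by (simp add: f_def mv.diff_right mv.minus_left matrix_vector_mul_assoc)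
  qed (use E(1) t in auto)
  have fi: "(\<lambda>s. norm (f s)) integrable_on {c..d}" using f(1) by (simp add: f_def)
  have m0: "m \<ge> 0" using m[OF t] norm_ge_zero order_trans by blast
  have "norm (M t *v \<eta> t - M c *v \<eta> c) \<le> integral {c..t} (\<lambda>s. (m * K) * norm (f s))"
    unfolding integral_unique[OF int, symmetric]
  proof (rule integral_norm_bound_integral)
    show "(\<lambda>s. M s *v f s) integrable_on {c..t}" using int by blast
    show "(\<lambda>s. (m * K) * norm (f s)) integrable_on {c..t}"
      by (intro integrable_on_mult_right integrable_on_subinterval[OF fi]) (use t in auto)
    fix s assume "s \<in> {c..t}"
    then have "norm (M s) \<le> m" using t by (intro m) auto
    then have "norm (M s) * norm (f s) * K \<le> m * norm (f s) * K"
      using K0 by (intro mult_right_mono) auto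
    then show "norm (M s *v f s) \<le> (m * K) * norm (f s)"
      using K[of "M s" "f s"] by (simp add: mult_ac)
  qed
  also have "\<dots> \<le> integral {c..d} (\<lambda>s. (m * K) * norm (f s))"
    by (intro integral_subset_le integrable_on_mult_right integrable_on_subinterval[OF fi]) (use t m0 K0 in auto)
  also have "\<dots> = m * K * integral {c..d} (\<lambda>s. norm (f s))" by simp
  finally have "(norm (M t *v \<eta> t - M c *v \<eta> c))\<^sup>2 \<le> (m * K * integral {c..d} (\<lambda>s. norm (f s)))\<^sup>2"
    by (intro power_mono) auto
  also have "\<dots> = (m * K)\<^sup>2 * (integral {c..d} (\<lambda>s. norm (f s)))\<^sup>2" by (simp add: power_mult_distrib)
  also have "\<dots> \<le> (m * K)\<^sup>2 * ((d - c) * integral {c..d} (\<lambda>s. (norm (f s))\<^sup>2))"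
    using f(2) by (intro mult_left_mono integral_power2_le cd fi) (auto simp: f_def)
  finally show ?thesis by (simp add: f_def mult.assoc)
qed

lemma H_half_0_linear_residual:
  fixes A :: "real \<Rightarrow> real^'n^'n" and \<eta> :: "real \<Rightarrow> real^'n"
  assumes \<eta>: "\<eta> \<in> H_half_0 L" and A: "continuous_on UNIV A"
  defines "f \<equiv> \<lambda>s. deriv_on L \<eta> s - A s *v \<eta> s"
  shows "f \<in> borel_measurable (lebesgue_on {0..L})"
    and "integrable (lebesgue_on {0..L}) (\<lambda>s. (norm (f s))\<^sup>2)"
    and "integrable (lebesgue_on {0..L}) (\<lambda>s. norm (f s))"
proof -
  interpret mv: bounded_bilinear "(*v) :: real^'n^'n \<Rightarrow> real^'n \<Rightarrow> real^'n"
    by (rule bounded_bilinear_matrix_vector_mult)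
  have \<eta>c: "continuous_on {0..L} \<eta>"
    using \<eta> by (intro absolutely_continuous_fun_imp_continuous_on) (simp add: H_half_0_def)
  have Ac: "continuous_on {0..L} (\<lambda>s. A s *v \<eta> s)"
    by (intro mv.continuous_on continuous_on_subset[OF A] \<eta>c) auto
  have d: "deriv_on L \<eta> \<in> borel_measurable (lebesgue_on {0..L})"
    "integrable (lebesgue_on {0..L}) (\<lambda>s. (norm (deriv_on L \<eta> s))\<^sup>2)"
    using \<eta> by (simp_all add: H_half_0_def in_L2_def)
  show fm: "f \<in> borel_measurable (lebesgue_on {0..L})"
    unfolding f_def by (intro borel_measurable_diff d(1) continuous_imp_measurable_on_sets_lebesgue Ac) simp
  have "integrable (lebesgue_on {0..L}) (\<lambda>s. (norm (A s *v \<eta> s))\<^sup>2)"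
    by (intro continuous_imp_integrable_real continuous_intros Ac)
  with d(2) have I: "integrable (lebesgue_on {0..L}) (\<lambda>s. 2 * (norm (deriv_on L \<eta> s))\<^sup>2 + 2 * (norm (A s *v \<eta> s))\<^sup>2)"
    by (intro Bochner_Integration.integrable_add integrable_mult_right)
  show sq: "integrable (lebesgue_on {0..L}) (\<lambda>s. (norm (f s))\<^sup>2)"
  proof (rule Bochner_Integration.integrable_bound[OF I])
    show "(\<lambda>s. (norm (f s))\<^sup>2) \<in> borel_measurable (lebesgue_on {0..L})" using fm by measurable
    show "AE s in lebesgue_on {0..L}. norm ((norm (f s))\<^sup>2) \<le> norm (2 * (norm (deriv_on L \<eta> s))\<^sup>2 + 2 * (norm (A s *v \<eta> s))\<^sup>2)"
    proof (rule AE_I2)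
      fix s
      have "(norm (f s))\<^sup>2 \<le> (norm (deriv_on L \<eta> s) + norm (A s *v \<eta> s))\<^sup>2"
        unfolding f_def by (intro power_mono norm_triangle_ineq4) simp
      also have "\<dots> \<le> 2 * (norm (deriv_on L \<eta> s))\<^sup>2 + 2 * (norm (A s *v \<eta> s))\<^sup>2"
        using sum_squares_bound[of "norm (deriv_on L \<eta> s)" "norm (A s *v \<eta> s)"] by (simp add: power2_sum)
      finally show "norm ((norm (f s))\<^sup>2) \<le> norm (2 * (norm (deriv_on L \<eta> s))\<^sup>2 + 2 * (norm (A s *v \<eta> s))\<^sup>2)" by simp
    qed
  qed
  \<comment> \<open>On a bounded interval this function is integrable, and it dominates
    \<open>norm (f s)\<close>.\<close>
  have I1: "integrable (lebesgue_on {0..L}) (\<lambda>s. 1 + (norm (f s))\<^sup>2)"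
    by (intro Bochner_Integration.integrable_add sq continuous_imp_integrable_real continuous_intros)
  show "integrable (lebesgue_on {0..L}) (\<lambda>s. norm (f s))"
  proof (rule Bochner_Integration.integrable_bound[OF I1])
    show "(\<lambda>s. norm (f s)) \<in> borel_measurable (lebesgue_on {0..L})" using fm by measurable
    show "AE s in lebesgue_on {0..L}. norm (norm (f s)) \<le> norm (1 + (norm (f s))\<^sup>2)"
    proof (rule AE_I2)
      fix s
      show "norm (norm (f s)) \<le> norm (1 + (norm (f s))\<^sup>2)"
        using sum_squares_bound[of 1 "norm (f s)"] by (simp add: abs_of_nonneg add_nonneg_nonneg) (smt (verit) norm_ge_zero)
    qed
  qed
qed

lemma H_half_0_derivative:
  assumes \<eta>: "\<eta> \<in> H_half_0 L" and L: "L > 0"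
  shows "\<exists>E. negligible E \<and> (\<forall>s\<in>{0..L} - E. (\<eta> has_vector_derivative deriv_on L \<eta> s) (at s within {0..L}))"
proof -
  have "AE s in lebesgue_on {0..L}. \<eta> differentiable (at s within {0..L})"
    using \<eta> by (simp add: H_half_0_def)
  then obtain E where E: "E \<in> null_sets (lebesgue_on {0..L})"
    "{s \<in> space (lebesgue_on {0..L}). \<not> \<eta> differentiable (at s within {0..L})} \<subseteq> E"
    by (auto simp: eventually_ae_filter)
  have "negligible E" using E(1) by (simp add: null_sets_restrict_space negligible_iff_null_sets)
  moreover have "(\<eta> has_vector_derivative deriv_on L \<eta> s) (at s within {0..L})" if "s \<in> {0..L} - E" for s
    using that E(2) by (auto simp: vector_derivative_works[symmetric])
  ultimately show ?thesis by blast
qed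

section \<open>The transverse estimate\<close>

lemma periodic_shift:
  fixes F :: "real \<Rightarrow> 'a" and T :: real
  assumes "\<And>t. F (t + T) = F t"
  shows "F (t + real j * T) = F t" "F (t - real j * T) = F t"
proof -
  have *: "F (t + real j * T) = F t" for t
  proof (induction j)
    case (Suc j)
    have "F (t + real (Suc j) * T) = F ((t + real j * T) + T)" by (simp add: algebra_simps)
    then show ?case using Suc assms by simp
  qed simp
  show "F (t + real j * T) = F t" by (rule *)
  show "F (t - real j * T) = F t" using *[of "t - real j * T"] by simp
qed

lemma periodic_bounded:
  fixes F :: "real \<Rightarrow> 'a::real_normed_vector"
  assumes T: "T > 0" and per: "\<And>t. F (t + T) = F t" and F: "continuous_on UNIV F"
  shows "\<exists>c>0. \<forall>t\<ge>0. norm (F t) \<le> c"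
proof -
  have "bounded (F ` {0..T})"
    by (intro compact_imp_bounded compact_continuous_image continuous_on_subset[OF F]) auto
  then obtain c where c: "c > 0" "\<And>t. t \<in> {0..T} \<Longrightarrow> norm (F t) \<le> c"
    unfolding bounded_pos by blast
  have "norm (F t) \<le> c" if "t \<ge> 0" for t
  proof -
    define j where "j = nat \<lfloor>t / T\<rfloor>"
    have "t / T \<ge> 0" using that T by simp
    then have j: "real j \<le> t / T" "t / T < real j + 1"
      unfolding j_def by linarith+
    then have "t - real j * T \<in> {0..T}" using T by (simp add: field_simps)
    then show ?thesis using c(2)[of "t - real j * T"] periodic_shift(2)[of F T t j, OF per] by simp
  qed
  with c(1) show ?thesis by blast
qed

text \<open>Collects what the transverse estimate uses about the orbit, with \<open>v\<close> as the
  velocity. The last assumption is hyperbolicity in the form that the Fourier argument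
  consumes.\<close>

locale hyperbolic_periodic_system =
  fixes A \<Phi> :: "real \<Rightarrow> real^'n^'n" and T a :: real and v :: "real \<Rightarrow> real^'n" and l :: "real^'n"
  assumes T: "T > 0" and A_cont: "continuous_on UNIV A" and A_bound: "\<And>t. norm (A t) \<le> a"
    and A_periodic: "\<And>t. A (t + T) = A t"
    and \<Phi>_0: "\<Phi> 0 = mat 1" and \<Phi>_deriv: "\<And>t. (\<Phi> has_vector_derivative A t ** \<Phi> t) (at t)"
    and v_deriv: "\<And>t. (v has_vector_derivative A t *v v t) (at t)" and v_periodic: "\<And>t. v (t + T) = v t"
    and l_v: "l \<bullet> v 0 = 1" and l_monodromy: "\<And>x. l \<bullet> (\<Phi> T *v x) = l \<bullet> x"
    and deflated: "\<forall>\<mu> w. cmod \<mu> = 1 \<longrightarrow>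
      cmat (\<chi> i j. \<Phi> T $ i $ j - v 0 $ i * l $ j) *v w = \<mu> *s w \<longrightarrow> w = 0"
begin

abbreviation \<Psi> :: "real \<Rightarrow> real^'n^'n" where "\<Psi> t \<equiv> matrix_inv (\<Phi> t)"

text \<open>\<open>l\<close> is the left eigenvector dual to the velocity, so \<open>tangential_part\<close> is the coefficient of the
  spectral projection onto the velocity, transported along the orbit.\<close>
definition tangential_part :: "(real \<Rightarrow> real^'n) \<Rightarrow> real \<Rightarrow> real" where
  "tangential_part \<eta> t = l \<bullet> (\<Psi> t *v \<eta> t)"

definition transverse_part :: "(real \<Rightarrow> real^'n) \<Rightarrow> real \<Rightarrow> real^'n" where
  "transverse_part \<eta> t = \<eta> t - tangential_part \<eta> t *\<^sub>R v t"

definition residual :: "real \<Rightarrow> (real \<Rightarrow> real^'n) \<Rightarrow> real \<Rightarrow> real^'n" where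
  "residual L \<eta> s = deriv_on L \<eta> s - A s *v \<eta> s"

lemmas \<Phi>_inv = fundamental_matrix_invertible[OF \<Phi>_0 \<Phi>_deriv A_bound]
lemmas \<Phi>_cont = fundamental_matrix_continuous[OF \<Phi>_0 \<Phi>_deriv A_bound]
lemmas \<Phi>_periodic = fundamental_matrix_periodic[OF \<Phi>_0 \<Phi>_deriv A_bound, of T, OF A_periodic]
lemmas \<Psi>_deriv = fundamental_matrix_inv_deriv[OF \<Phi>_0 \<Phi>_deriv A_bound]
lemmas v_eq = fundamental_matrix_solution[OF \<Phi>_0 \<Phi>_deriv A_bound v_deriv]

lemma \<Psi>_\<Phi> [simp]: "\<Psi> t *v (\<Phi> t *v x) = x" "\<Phi> t *v (\<Psi> t *v x) = x"
  by (simp_all add: matrix_vector_mul_assoc matrix_inv_mult \<Phi>_inv)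

lemma \<Psi>_0 [simp]: "\<Psi> 0 *v x = x"
  using \<Psi>_\<Phi>(1)[of 0 x] by (simp add: \<Phi>_0)

lemma monodromy_v: "\<Phi> T *v v 0 = v 0"
  using v_eq[of T] v_periodic[of 0] by simp

text \<open>Going back one more period applies the inverse monodromy matrix before \<open>l\<close>,
  and \<open>l\<close> is invariant under it. Hence the tangential part can be computed from data on
  a single period.\<close>

lemma functional_periodic: "l \<bullet> (\<Psi> (t + T) *v x) = l \<bullet> (\<Psi> t *v x)"
proof -
  define y where "y = \<Psi> (t + T) *v x"
  have "\<Phi> (t + T) *v y = x" by (simp only: y_def \<Psi>_\<Phi>)
  then have "\<Phi> t *v (\<Phi> T *v y) = x" by (simp only: \<Phi>_periodic matrix_vector_mul_assoc)
  from arg_cong[OF this, of "\<lambda>z. \<Psi> t *v z"] have "\<Psi> t *v x = \<Phi> T *v y" by (simp only: \<Psi>_\<Phi>)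
  then show ?thesis by (simp add: y_def[symmetric] l_monodromy)
qed

text \<open>Restricted to one period because \<Phi> and its inverse may be unbounded over all
  times.\<close>

lemma block_bounds:
  "\<exists>C>0. (\<forall>s\<in>{0..T}. norm (\<Phi> s) \<le> C) \<and> (\<forall>s\<in>{0..T}. norm (\<Psi> s) \<le> C)"
proof -
  have "continuous_on {0..T} \<Phi>" "continuous_on {0..T} \<Psi>"
    using continuous_on_matrix_inv[OF \<Phi>_inv \<Phi>_cont] by (auto intro: continuous_on_subset \<Phi>_cont)
  then have "bounded (\<Phi> ` {0..T})" "bounded (\<Psi> ` {0..T})"
    by (auto intro!: compact_imp_bounded compact_continuous_image)
  then obtain c d where cd: "\<And>s. s \<in> {0..T} \<Longrightarrow> norm (\<Phi> s) \<le> c" "\<And>s. s \<in> {0..T} \<Longrightarrow> norm (\<Psi> s) \<le> d"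
    unfolding bounded_iff by blast
  have "\<And>s. s \<in> {0..T} \<Longrightarrow> norm (\<Phi> s) \<le> \<bar>c\<bar> + \<bar>d\<bar> + 1" "\<And>s. s \<in> {0..T} \<Longrightarrow> norm (\<Psi> s) \<le> \<bar>c\<bar> + \<bar>d\<bar> + 1"
    using cd by force+
  then show ?thesis by (intro exI[of _ "\<bar>c\<bar> + \<bar>d\<bar> + 1"]) auto
qed

section \<open>Estimates on a single period\<close>

context
  fixes N :: nat and \<eta> :: "real \<Rightarrow> real^'n"
  assumes N: "N \<ge> 1" and \<eta>: "\<eta> \<in> H_half_0 (real N * T)"
begin

lemma residual_integrable:
  "(\<lambda>s. norm (residual (real N * T) \<eta> s)) integrable_on {0..real N * T}"
  "(\<lambda>s. (norm (residual (real N * T) \<eta> s))\<^sup>2) integrable_on {0..real N * T}"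
  using H_half_0_linear_residual(2,3)[OF \<eta> A_cont]
  by (auto simp: residual_def intro: integrable_on_lebesgue_on)

lemma block_subset:
  assumes "j < N"
  shows "{real j * T..real (Suc j) * T} \<subseteq> {0..real N * T}" "0 \<le> real j * T" "real (Suc j) * T \<le> real N * T"
proof -
  have "real (Suc j) * T \<le> real N * T" using assms T by (intro mult_right_mono) auto
  moreover have "0 \<le> real j * T" using T by simp
  ultimately show "{real j * T..real (Suc j) * T} \<subseteq> {0..real N * T}" "0 \<le> real j * T" "real (Suc j) * T \<le> real N * T"
    by auto
qed

definition block_energy :: "nat \<Rightarrow> real" where
  "block_energy j = integral {real j * T..real (Suc j) * T} (\<lambda>s. (norm (residual (real N * T) \<eta> s))\<^sup>2)"

lemma block_energy_nonneg: "j < N \<Longrightarrow> block_energy j \<ge> 0"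
  unfolding block_energy_def
  by (intro integral_nonneg integrable_on_subinterval[OF residual_integrable(2) block_subset(1)]) auto

lemma sum_block_integrals:
  fixes F :: "real \<Rightarrow> real"
  assumes F: "F integrable_on {0..real N * T}"
  shows "(\<Sum>j<N. integral {real j * T..real (Suc j) * T} F) = integral {0..real N * T} F"
proof -
  have "n \<le> N \<Longrightarrow> (\<Sum>j<n. integral {real j * T..real (Suc j) * T} F) = integral {0..real n * T} F" for n
  proof (induction n)
    case (Suc n)
    have "real (Suc n) * T \<le> real N * T" using Suc.prems T by (intro mult_right_mono) auto
    then have "F integrable_on {0..real (Suc n) * T}"
      by (intro integrable_on_subinterval[OF F]) auto
    from Henstock_Kurzweil_Integration.integral_combine[OF _ _ this, of "real n * T"]
    show ?case using Suc T by (simp add: mult_right_mono)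
  qed simp
  then show ?thesis by simp
qed

text \<open>Since \<open>A\<close> is periodic, the translate of \<Psi> by \<open>real j * T\<close>
  solves the same adjoint equation and is the identity at the left end of the block. The constant is
  therefore the same for all blocks.\<close>

lemma block_estimate:
  assumes C: "C > 0" "\<And>s. s \<in> {0..T} \<Longrightarrow> norm (\<Psi> s) \<le> C"
    and K: "K > 0" "\<And>X y. norm ((X :: real^'n^'n) *v (y :: real^'n)) \<le> norm X * norm y * K"
    and j: "j < N" and t: "t \<in> {real j * T..real (Suc j) * T}"
  shows "(norm (\<Psi> (t - real j * T) *v \<eta> t - \<eta> (real j * T)))\<^sup>2 \<le> (C * K)\<^sup>2 * T * block_energy j"
proof -
  define M where "M s = \<Psi> (s - real j * T)" for s
  define g where "g = deriv_on (real N * T) \<eta>"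
  have L: "real N * T > 0" using N T by simp
  note sub = block_subset(1)[OF j] and b0 = block_subset(2,3)[OF j]
  obtain E where E: "negligible E" "\<And>s. s \<in> {0..real N * T} - E \<Longrightarrow> (\<eta> has_vector_derivative g s) (at s within {0..real N * T})"
    using H_half_0_derivative[OF \<eta> L] unfolding g_def by blast
  have "(norm (M t *v \<eta> t - M (real j * T) *v \<eta> (real j * T)))\<^sup>2 \<le>
      (C * K)\<^sup>2 * (real (Suc j) * T - real j * T) *
      integral {real j * T..real (Suc j) * T} (\<lambda>s. (norm (g s - A s *v \<eta> s))\<^sup>2)"
  proof (rule variation_of_constants_bound[where E = E])
    show "real j * T \<le> real (Suc j) * T" using T by (simp add: mult_right_mono)
    show "absolutely_continuous_fun (real j * T) (real (Suc j) * T) \<eta>"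
      using \<eta> by (intro absolutely_continuous_fun_subinterval[OF _ b0]) (simp add: H_half_0_def)
    show "(\<eta> has_vector_derivative g s) (at s within {real j * T..real (Suc j) * T})"
      if "s \<in> {real j * T..real (Suc j) * T} - E" for s
      by (rule has_vector_derivative_within_subset[OF E(2) sub]) (use that sub in auto)
    show "(M has_vector_derivative - (M s ** A s)) (at s)" for s
    proof -
      have "((\<lambda>s. s - real j * T) has_vector_derivative 1) (at s)"
        by (auto intro!: derivative_eq_intros)
      from vector_diff_chain_at[OF this \<Psi>_deriv[of "s - real j * T"]]
      show ?thesis by (simp add: o_def M_def[abs_def] periodic_shift(2)[of A T, OF A_periodic])
    qed
    show "norm (M s) \<le> C" if "s \<in> {real j * T..real (Suc j) * T}" for s
      unfolding M_def using that by (intro C) (auto simp: algebra_simps)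
    show "(\<lambda>s. norm (g s - A s *v \<eta> s)) integrable_on {real j * T..real (Suc j) * T}"
      "(\<lambda>s. (norm (g s - A s *v \<eta> s))\<^sup>2) integrable_on {real j * T..real (Suc j) * T}"
      using integrable_on_subinterval[OF residual_integrable(1) sub] integrable_on_subinterval[OF residual_integrable(2) sub]
      by (simp_all add: residual_def g_def)
  qed (use E(1) A_cont K t in auto)
  then show ?thesis
    by (simp add: M_def block_energy_def residual_def g_def algebra_simps)
qed

end

text \<open>Expresses the transverse part through the flow restarted at \<open>real j * T\<close>;
  periodicity of the functional and of the velocity makes this legitimate.\<close>

lemma block_transverse_part:
  "transverse_part \<eta> t = \<Phi> (t - real j * T) *v
    (\<Psi> (t - real j * T) *v \<eta> t - (l \<bullet> (\<Psi> (t - real j * T) *v \<eta> t)) *\<^sub>R v 0)"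
proof -
  have 1: "l \<bullet> (\<Psi> (t - real j * T) *v \<eta> t) = l \<bullet> (\<Psi> t *v \<eta> t)"
    by (rule periodic_shift(2)[of "\<lambda>s. l \<bullet> (\<Psi> s *v \<eta> t)" T, OF functional_periodic])
  have 2: "v t = \<Phi> (t - real j * T) *v v 0"
    using periodic_shift(2)[of v T t j, OF v_periodic] v_eq by metis
  show ?thesis
    unfolding transverse_part_def tangential_part_def 1 2
    by (simp add: matrix_vector_mult_diff_distrib matrix_vector_mult_scaleR)
qed

text \<open>The projection along \<open>v 0\<close> commutes with the monodromy matrix, because
  \<open>l\<close> and \<open>v 0\<close> are its left and right fixed vectors; on the kernel of
  \<open>l\<close> the deflated matrix coincides with the monodromy matrix.\<close>

lemma deflated_step:
  fixes x y :: "real^'n"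
  defines "proj \<equiv> \<lambda>x. x - (l \<bullet> x) *\<^sub>R v 0"
  shows "proj y - (\<chi> i j. \<Phi> T $ i $ j - v 0 $ i * l $ j) *v proj x = proj (y - \<Phi> T *v x)"
proof -
  have B: "(\<chi> i j. \<Phi> T $ i $ j - v 0 $ i * l $ j) *v z = \<Phi> T *v z - (l \<bullet> z) *\<^sub>R v 0" for z
  proof -
    have "((\<chi> i j. \<Phi> T $ i $ j - v 0 $ i * l $ j) *v z) $ i = (\<Sum>j\<in>UNIV. \<Phi> T $ i $ j * z $ j) - v 0 $ i * (\<Sum>j\<in>UNIV. l $ j * z $ j)" for i
      by (simp add: matrix_vector_mult_def left_diff_distrib sum_subtractf sum_distrib_left mult.assoc)
    then show ?thesis by (simp add: vec_eq_iff matrix_vector_mult_def inner_vec_def)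
  qed
  have "l \<bullet> proj x = 0" by (simp add: proj_def inner_diff_right l_v)
  then show ?thesis
    unfolding B by (simp add: proj_def matrix_vector_mult_diff_distrib matrix_vector_mult_scaleR monodromy_v
        inner_diff_right l_monodromy l_v scaleR_diff_left)
qed

lemma transverse_part_continuous:
  assumes "continuous_on S \<eta>"
  shows "continuous_on S (transverse_part \<eta>)"
proof -
  interpret mv: bounded_bilinear "(*v) :: real^'n^'n \<Rightarrow> real^'n \<Rightarrow> real^'n"
    by (rule bounded_bilinear_matrix_vector_mult)
  have "continuous_on UNIV \<Psi>" using continuous_on_matrix_inv[OF \<Phi>_inv \<Phi>_cont] .
  moreover have "continuous_on UNIV v"
    using v_deriv by (auto simp: continuous_on_eq_continuous_at intro!: has_vector_derivative_continuous)
  ultimately have "continuous_on S \<Psi>" "continuous_on S v"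
    by (auto intro: continuous_on_subset)
  then show ?thesis
    unfolding transverse_part_def[abs_def] tangential_part_def
    by (intro continuous_intros mv.continuous_on assms)
qed

lemma transverse_estimate:
  "\<exists>C>0. \<forall>N::nat. N \<ge> 1 \<longrightarrow> (\<forall>\<eta>\<in>H_half_0 (real N * T).
     integral {0..real N * T} (\<lambda>s. (norm (transverse_part \<eta> s))\<^sup>2) \<le>
     C * integral {0..real N * T} (\<lambda>s. (norm (residual (real N * T) \<eta> s))\<^sup>2))"
proof -
  interpret mv: bounded_bilinear "(*v) :: real^'n^'n \<Rightarrow> real^'n \<Rightarrow> real^'n"
    by (rule bounded_bilinear_matrix_vector_mult)
  obtain K where K: "K > 0" "\<And>X y. norm ((X :: real^'n^'n) *v (y :: real^'n)) \<le> norm X * norm y * K"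
    using mv.pos_bounded by blast
  obtain C where C: "C > 0" "\<And>s. s \<in> {0..T} \<Longrightarrow> norm (\<Phi> s) \<le> C" "\<And>s. s \<in> {0..T} \<Longrightarrow> norm (\<Psi> s) \<le> C"
    using block_bounds by blast
  define B where "B = (\<chi> i j. \<Phi> T $ i $ j - v 0 $ i * l $ j)"
  obtain D where D: "D > 0" "\<And>N p. N \<ge> (1::nat) \<Longrightarrow> p N = p 0 \<Longrightarrow>
      (\<Sum>j<N. (norm (p j))\<^sup>2) \<le> D * (\<Sum>j<N. (norm (p (Suc j) - B *v p j))\<^sup>2)"
    using periodic_sequence_estimate[OF deflated] unfolding B_def by blast
  define proj where "proj x = x - (l \<bullet> x) *\<^sub>R v 0" for x
  define c0 where "c0 = 1 + norm l * norm (v 0)"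
  have proj: "norm (proj x) \<le> c0 * norm x" for x
  proof -
    have "norm (proj x) \<le> norm x + \<bar>l \<bullet> x\<bar> * norm (v 0)"
      unfolding proj_def by (intro order_trans[OF norm_triangle_ineq4]) simp
    also have "\<dots> \<le> norm x + (norm l * norm x) * norm (v 0)"
      by (intro add_left_mono mult_right_mono Cauchy_Schwarz_ineq2) simp
    finally show ?thesis by (simp add: c0_def algebra_simps)
  qed
  define q where "q = (C * K)\<^sup>2"
  have \<Phi>q: "(norm (\<Phi> s *v x))\<^sup>2 \<le> q * (norm x)\<^sup>2" if "s \<in> {0..T}" for s x
  proof -
    have "norm (\<Phi> s *v x) \<le> norm (\<Phi> s) * norm x * K" by (rule K)
    also have "\<dots> \<le> C * norm x * K" using that K(1) C(2) by (intro mult_right_mono) auto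
    finally have "(norm (\<Phi> s *v x))\<^sup>2 \<le> (C * norm x * K)\<^sup>2" by (intro power_mono) auto
    then show ?thesis by (simp add: q_def power_mult_distrib mult_ac)
  qed
  have proj2: "(norm (proj x))\<^sup>2 \<le> c0\<^sup>2 * (norm x)\<^sup>2" for x
    using power_mono[OF proj norm_ge_zero, of x 2] by (simp add: power_mult_distrib)
  have q0: "q \<ge> 0" by (simp add: q_def)
  \<comment> \<open>\<open>T\<close> comes from integrating over a block and the outer
    \<open>q\<close> from transport inside it. The summand with \<open>D\<close> bounds the node
    values, the other the deviation from them within a block; each 2 stems from the square of a
    sum.\<close>
  define R where "R = T * q * (2 * (D * (c0\<^sup>2 * (q * (q * T)))) + 2 * (c0\<^sup>2 * (q * T)))"
  have R0: "R \<ge> 0" using T q0 D(1) by (simp add: R_def)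
  have main: "integral {0..real N * T} (\<lambda>s. (norm (transverse_part \<eta> s))\<^sup>2) \<le>
      R * integral {0..real N * T} (\<lambda>s. (norm (residual (real N * T) \<eta> s))\<^sup>2)"
    if N: "N \<ge> 1" and \<eta>: "\<eta> \<in> H_half_0 (real N * T)" for N \<eta>
  proof -
    define e where "e = block_energy N \<eta>"
    define w where "w j = \<eta> (real j * T)" for j
    define y where "y j t = \<Psi> (t - real j * T) *v \<eta> t" for j t
    define p where "p j = proj (w j)" for j
    have blk: "(norm (y j t - w j))\<^sup>2 \<le> q * T * e j" if "j < N" "t \<in> {real j * T..real (Suc j) * T}" for j t
      using block_estimate[OF N \<eta> C(1,3) K that] by (simp add: y_def w_def q_def e_def)
    have step: "(norm (p (Suc j) - B *v p j))\<^sup>2 \<le> c0\<^sup>2 * (q * (q * T)) * e j" if j: "j < N" for j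
    proof -
      let ?t = "real (Suc j) * T"
      have tj: "?t - real j * T = T" by (simp add: algebra_simps)
      \<comment> \<open>The defect of the recursion is the deviation accumulated over the block,
        transported to its right end.\<close>
      have eq: "w (Suc j) - \<Phi> T *v w j = \<Phi> T *v (y j ?t - w j)"
        unfolding y_def tj w_def by (simp add: matrix_vector_mult_diff_distrib)
      have "p (Suc j) - B *v p j = proj (w (Suc j) - \<Phi> T *v w j)"
        using deflated_step[of "w (Suc j)" "w j"] by (simp only: p_def proj_def B_def)
      then have "(norm (p (Suc j) - B *v p j))\<^sup>2 \<le> c0\<^sup>2 * (norm (\<Phi> T *v (y j ?t - w j)))\<^sup>2"
        using proj2 by (simp only: eq)
      also have "\<dots> \<le> c0\<^sup>2 * (q * (norm (y j ?t - w j))\<^sup>2)"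
        using T by (intro mult_left_mono \<Phi>q) auto
      also have "\<dots> \<le> c0\<^sup>2 * (q * (q * T * e j))"
        using T by (intro mult_left_mono blk j q0) (auto simp: mult_right_mono)
      finally show ?thesis by (simp add: mult_ac)
    qed
    have "w N = 0" "w 0 = 0" using \<eta> by (simp_all add: w_def H_half_0_def)
    then have "p N = p 0" by (simp add: p_def)
    then have "(\<Sum>j<N. (norm (p j))\<^sup>2) \<le> D * (\<Sum>j<N. (norm (p (Suc j) - B *v p j))\<^sup>2)"
      by (rule D(2)[OF N])
    also have "\<dots> \<le> D * (\<Sum>j<N. c0\<^sup>2 * (q * (q * T)) * e j)"
      using D(1) by (intro mult_left_mono sum_mono step) auto
    finally have sum_p: "(\<Sum>j<N. (norm (p j))\<^sup>2) \<le> D * (c0\<^sup>2 * (q * (q * T))) * (\<Sum>j<N. e j)"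
      by (simp only: sum_distrib_left[symmetric] mult.assoc)
    have pointwise: "(norm (transverse_part \<eta> t))\<^sup>2 \<le> q * (2 * (norm (p j))\<^sup>2 + 2 * (c0\<^sup>2 * (q * T)) * e j)"
      if j: "j < N" and t: "t \<in> {real j * T..real (Suc j) * T}" for j t
    proof -
      have "transverse_part \<eta> t = \<Phi> (t - real j * T) *v proj (y j t)"
        unfolding proj_def y_def by (rule block_transverse_part)
      then have "(norm (transverse_part \<eta> t))\<^sup>2 \<le> q * (norm (proj (y j t)))\<^sup>2"
        using t \<Phi>q[of "t - real j * T" "proj (y j t)"] by (simp add: algebra_simps)
      also have "\<dots> \<le> q * (2 * (norm (p j))\<^sup>2 + 2 * (c0\<^sup>2 * (q * T)) * e j)"
      proof (rule mult_left_mono[OF _ q0])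
        \<comment> \<open>The node value is controlled by the summed recursion, the deviation by the
          energy of this block alone.\<close>
        have "proj (y j t) = p j + proj (y j t - w j)"
          by (simp add: proj_def p_def inner_diff_right algebra_simps)
        then have "(norm (proj (y j t)))\<^sup>2 \<le> (norm (p j) + norm (proj (y j t - w j)))\<^sup>2"
          by (simp only:) (intro power_mono norm_triangle_ineq norm_ge_zero)
        also have "\<dots> \<le> 2 * (norm (p j))\<^sup>2 + 2 * (norm (proj (y j t - w j)))\<^sup>2"
          using sum_squares_bound[of "norm (p j)" "norm (proj (y j t - w j))"] by (simp add: power2_sum)
        also have "\<dots> \<le> 2 * (norm (p j))\<^sup>2 + 2 * (c0\<^sup>2 * (q * T * e j))"
          by (intro add_left_mono mult_left_mono order_trans[OF proj2] blk j t) auto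
        finally show "(norm (proj (y j t)))\<^sup>2 \<le> 2 * (norm (p j))\<^sup>2 + 2 * (c0\<^sup>2 * (q * T)) * e j"
          by (simp only: mult.assoc)
      qed
      finally show ?thesis .
    qed
    have cont: "continuous_on {0..real N * T} (transverse_part \<eta>)"
      using \<eta> by (intro transverse_part_continuous absolutely_continuous_fun_imp_continuous_on) (simp add: H_half_0_def)
    have int: "(\<lambda>s. (norm (transverse_part \<eta> s))\<^sup>2) integrable_on {0..real N * T}"
      by (intro integrable_continuous_real continuous_intros cont)
    have "integral {0..real N * T} (\<lambda>s. (norm (transverse_part \<eta> s))\<^sup>2) =
        (\<Sum>j<N. integral {real j * T..real (Suc j) * T} (\<lambda>s. (norm (transverse_part \<eta> s))\<^sup>2))"
      by (rule sum_block_integrals[OF N \<eta> int, symmetric])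
    also have "\<dots> \<le> (\<Sum>j<N. T * (q * (2 * (norm (p j))\<^sup>2 + 2 * (c0\<^sup>2 * (q * T)) * e j)))"
    proof (rule sum_mono)
      fix j assume "j \<in> {..<N}"
      then have j: "j < N" by simp
      let ?b = "q * (2 * (norm (p j))\<^sup>2 + 2 * (c0\<^sup>2 * (q * T)) * e j)"
      have "integral {real j * T..real (Suc j) * T} (\<lambda>s. (norm (transverse_part \<eta> s))\<^sup>2) \<le>
          integral {real j * T..real (Suc j) * T} (\<lambda>s. ?b)"
        by (intro integral_le pointwise j integrable_on_subinterval[OF int block_subset(1)[OF N \<eta> j]]) auto
      also have "\<dots> = T * ?b"
        using T by (simp add: mult_right_mono) (simp add: algebra_simps)
      finally show "integral {real j * T..real (Suc j) * T} (\<lambda>s. (norm (transverse_part \<eta> s))\<^sup>2) \<le> T * ?b" .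
    qed
    also have "\<dots> = T * q * (2 * (\<Sum>j<N. (norm (p j))\<^sup>2) + 2 * (c0\<^sup>2 * (q * T)) * (\<Sum>j<N. e j))"
      by (simp only: sum_distrib_left[symmetric] sum.distrib mult.assoc)
    also have "\<dots> \<le> T * q * (2 * (D * (c0\<^sup>2 * (q * (q * T))) * (\<Sum>j<N. e j)) + 2 * (c0\<^sup>2 * (q * T)) * (\<Sum>j<N. e j))"
      using T q0 by (intro mult_left_mono add_right_mono sum_p) auto
    also have "\<dots> = R * (\<Sum>j<N. e j)" by (simp add: R_def algebra_simps)
    also have "(\<Sum>j<N. e j) = integral {0..real N * T} (\<lambda>s. (norm (residual (real N * T) \<eta> s))\<^sup>2)"
      unfolding e_def block_energy_def[OF N \<eta>] by (rule sum_block_integrals[OF N \<eta> residual_integrable(2)[OF N \<eta>]])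
    finally show ?thesis .
  qed
  show ?thesis
  proof (intro exI[of _ "R + 1"] conjI allI impI ballI)
    show "R + 1 > 0" using R0 by simp
    fix N :: nat and \<eta> :: "real \<Rightarrow> real^'n" assume N: "N \<ge> 1" and \<eta>: "\<eta> \<in> H_half_0 (real N * T)"
    have "0 \<le> integral {0..real N * T} (\<lambda>s. (norm (residual (real N * T) \<eta> s))\<^sup>2)"
      by (intro integral_nonneg residual_integrable(2)[OF N \<eta>]) simp
    then show "integral {0..real N * T} (\<lambda>s. (norm (transverse_part \<eta> s))\<^sup>2) \<le>
      (R + 1) * integral {0..real N * T} (\<lambda>s. (norm (residual (real N * T) \<eta> s))\<^sup>2)"
      using main[OF N \<eta>] by (simp add: distrib_right)
  qed
qed

text \<open>With zero residual the flow carries \<eta> exactly across every block, so the initial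
  value 0 persists. This turns the lower bound by the residual energy into strict
  positivity.\<close>

lemma residual_zero_imp_zero:
  assumes N: "N \<ge> 1" and \<eta>: "\<eta> \<in> H_half_0 (real N * T)"
    and zero: "integral {0..real N * T} (\<lambda>s. (norm (residual (real N * T) \<eta> s))\<^sup>2) = 0"
    and t: "t \<in> {0..real N * T}"
  shows "\<eta> t = 0"
proof -
  interpret mv: bounded_bilinear "(*v) :: real^'n^'n \<Rightarrow> real^'n \<Rightarrow> real^'n"
    by (rule bounded_bilinear_matrix_vector_mult)
  obtain K where K: "K > 0" "\<And>X y. norm ((X :: real^'n^'n) *v (y :: real^'n)) \<le> norm X * norm y * K"
    using mv.pos_bounded by blast
  obtain C where C: "C > 0" "\<And>s. s \<in> {0..T} \<Longrightarrow> norm (\<Phi> s) \<le> C" "\<And>s. s \<in> {0..T} \<Longrightarrow> norm (\<Psi> s) \<le> C"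
    using block_bounds by blast
  have "(\<Sum>j<N. block_energy N \<eta> j) = 0"
    using sum_block_integrals[OF N \<eta> residual_integrable(2)[OF N \<eta>]] zero
    by (simp add: block_energy_def[OF N \<eta>])
  then have "\<forall>j\<in>{..<N}. block_energy N \<eta> j = 0"
    by (subst (asm) sum_nonneg_eq_0_iff) (auto intro: block_energy_nonneg[OF N \<eta>])
  then have blk: "\<Psi> (t - real j * T) *v \<eta> t = \<eta> (real j * T)"
    if "j < N" "t \<in> {real j * T..real (Suc j) * T}" for j t
    using block_estimate[OF N \<eta> C(1,3) K that] that by simp
  have inv: "\<eta> t = \<Phi> (t - real j * T) *v \<eta> (real j * T)" if "j < N" "t \<in> {real j * T..real (Suc j) * T}" for j t
    unfolding blk[OF that, symmetric] by simp
  have node: "j \<le> N \<Longrightarrow> \<eta> (real j * T) = 0" for j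
  proof (induction j)
    case 0
    then show ?case using \<eta> by (simp add: H_half_0_def)
  next
    case (Suc j)
    then show ?case using inv[of j "real (Suc j) * T"] T by (simp add: mult_right_mono)
  qed
  show ?thesis
  proof (cases "t = real N * T")
    case True
    then show ?thesis using node[of N] by simp
  next
    case False
    \<comment> \<open>The right end was split off because this index would be \<open>N\<close>
      there, past the last block.\<close>
    define j where "j = nat \<lfloor>t / T\<rfloor>"
    have "t / T \<ge> 0" using t T by simp
    then have j: "real j \<le> t / T" "t / T < real j + 1"
      unfolding j_def by linarith+
    have "t / T < real N" using False t T by (simp add: field_simps)
    then have "j < N" using j by linarith
    moreover have "t \<in> {real j * T..real (Suc j) * T}" using j T by (simp add: field_simps)
    ultimately show ?thesis using inv[of j t] node[of j] by simp
  qed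
qed

end

section \<open>The second variation\<close>

lemma orbit_velocity_deriv:
  fixes b :: "real^'n \<Rightarrow> real^'n"
  assumes b: "b differentiable (at (X t))" and X: "(X has_vector_derivative b (X t)) (at t)"
  shows "((\<lambda>t. b (X t)) has_vector_derivative jacobian b (at (X t)) *v b (X t)) (at t)"
proof -
  have "(b has_derivative (\<lambda>h. jacobian b (at (X t)) *v h)) (at (X t))"
    using b unfolding jacobian_works .
  from vector_derivative_diff_chain_within[OF X has_derivative_at_withinI[OF this]]
  show ?thesis by (simp add: o_def)
qed

text \<open>Simplicity of the multiplier 1 is passed on in addition to the locale, because the
  comparison with Floquet matrices needs uniqueness of \<open>l\<close>.\<close>

lemma orbit_system:
  fixes b :: "real^'n \<Rightarrow> real^'n"
  assumes b: "Cb (Suc k) b" and orbit: "periodic_orbit b T x0 X" and hyp: "transversally_hyperbolic b T X"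
  shows "\<exists>\<Phi> a l. hyperbolic_periodic_system (\<lambda>t. jacobian b (at (X t))) \<Phi> T a (\<lambda>t. b (X t)) l \<and>
    order 1 (charpoly (cmat (\<Phi> T))) = 1"
proof -
  define A where "A t = jacobian b (at (X t))" for t
  have T: "T > 0" and X': "\<And>t. (X has_vector_derivative b (X t)) (at t)" and X_per: "\<And>t. X (t + T) = X t"
    and nonconst: "\<exists>s t. X s \<noteq> X t"
    using orbit by (auto simp: periodic_orbit_def)
  have Xc: "continuous_on UNIV X"
    using X' by (auto simp: continuous_on_eq_continuous_at intro!: has_vector_derivative_continuous)
  obtain a where a: "\<And>t. norm (A t) \<le> a" using Cb_jacobian_bounded_continuous(2)[OF b] by (auto simp: A_def)
  have Ac: "continuous_on UNIV A"
    using continuous_on_compose2[OF Cb_jacobian_bounded_continuous(1)[OF b] Xc] by (simp add: A_def[abs_def])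
  have v': "((\<lambda>t. b (X t)) has_vector_derivative A t *v b (X t)) (at t)" for t
    unfolding A_def by (rule orbit_velocity_deriv[where X = X]) (use b X' in simp_all)
  obtain \<Phi> where \<Phi>0: "\<Phi> 0 = mat 1" and \<Phi>': "\<And>t. (\<Phi> has_vector_derivative A t ** \<Phi> t) (at t)"
    and ord: "order 1 (charpoly (cmat (\<Phi> T))) = 1"
    and mult: "\<And>\<mu> w. w \<noteq> 0 \<Longrightarrow> cmat (\<Phi> T) *v w = \<mu> *s w \<Longrightarrow> \<mu> \<noteq> 1 \<Longrightarrow> cmod \<mu> \<noteq> 1"
    using hyp unfolding transversally_hyperbolic_def is_monodromy_def A_def by blast
  note v_eq = fundamental_matrix_solution[OF \<Phi>0 \<Phi>' a v']
  \<comment> \<open>The velocity solves the variational equation, so a zero at time 0 would make it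
    vanish identically and the orbit constant.\<close>
  have v0: "b (X 0) \<noteq> 0"
  proof
    assume "b (X 0) = 0"
    then have "b (X t) = 0" for t using v_eq[of t] by (simp add: matrix_vector_mult_0_right)
    then have X0: "(X has_vector_derivative 0) (at t within UNIV)" for t using X'[of t] by simp
    show False
    proof (rule has_vector_derivative_zero_constant[of UNIV X])
      fix c assume "\<And>t. t \<in> UNIV \<Longrightarrow> X t = c"
      then have "X t = c" for t by blast
      then show False using nonconst by simp
    qed (use X0 in auto)
  qed
  have Uv: "\<Phi> T *v b (X 0) = b (X 0)" using v_eq[of T] X_per[of 0] by simp
  obtain l where l: "l \<bullet> b (X 0) = 1" "\<And>x. l \<bullet> (\<Phi> T *v x) = l \<bullet> x"
    using simple_eigenvalue_left_real[OF ord Uv v0] by metis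
  have "hyperbolic_periodic_system A \<Phi> T a (\<lambda>t. b (X t)) l"
  proof
    show "\<forall>\<mu> w. cmod \<mu> = 1 \<longrightarrow> cmat (\<chi> i j. \<Phi> T $ i $ j - b (X 0) $ i * l $ j) *v w = \<mu> *s w \<longrightarrow> w = 0"
      by (intro allI impI, rule deflated_no_unimodular_eigenvalue[OF ord Uv v0 l]) (use mult in auto)
  qed (use T Ac a \<Phi>0 \<Phi>' v' X_per l in \<open>auto simp: A_def\<close>)
  then show ?thesis using ord unfolding A_def[abs_def] by blast
qed

section \<open>Bounds and measurability of the noise weight\<close>

lemma matrix_inv_diag_mult:
  fixes y :: "real^'n"
  assumes "\<And>i. u $ i \<noteq> 0"
  shows "matrix_inv (diag u) *v y = (\<chi> i. y $ i / u $ i)"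
proof -
  have dm: "diag u *v x = (\<chi> i. u $ i * x $ i)" for u x :: "real^'n"
    by (simp add: diag_def matrix_vector_mult_def vec_eq_iff if_distrib[of "\<lambda>a. a * _"] cong: if_cong)
  have "diag u *v x = 0 \<Longrightarrow> x = 0" for x using assms by (simp add: dm vec_eq_iff)
  then have inv: "invertible (diag u)" unfolding invertible_left_inverse matrix_left_invertible_ker by blast
  define x where "x = matrix_inv (diag u) *v y"
  have "diag u *v x = y" by (simp add: x_def matrix_vector_mul_assoc matrix_inv_mult inv)
  then have "x $ i = y $ i / u $ i" for i using assms[of i] by (auto simp: dm)
  then show ?thesis by (simp add: x_def vec_eq_iff)
qed

text \<open>The lower bound gives coercivity; the upper one makes the weighted residual square
  integrable.\<close>

lemma noise_coefficient_bounds: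
  fixes m M :: "real^'n"
  assumes "noise_coefficient T m M \<sigma>"
  shows "\<exists>\<mu>>0. \<exists>\<nu>. \<forall>s\<ge>0. \<forall>y. \<mu> * (norm y)\<^sup>2 \<le> (norm (matrix_inv (diag (\<sigma> s)) *v y))\<^sup>2 \<and>
    (norm (matrix_inv (diag (\<sigma> s)) *v y))\<^sup>2 \<le> \<nu> * (norm y)\<^sup>2"
proof -
  have m: "0 < m $ i" and \<sigma>: "\<And>s. s \<ge> 0 \<Longrightarrow> m $ i \<le> \<sigma> s $ i \<and> \<sigma> s $ i \<le> M $ i" for i
    using assms unfolding noise_coefficient_def by blast+
  \<comment> \<open>Here and in \<open>d\<close>, sums over the coordinates stand in for maxima; the
    1 in \<open>d\<close> makes its positivity immediate.\<close>
  define c where "c = (\<Sum>i\<in>UNIV. (1 / m $ i)\<^sup>2)"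
  define d where "d = 1 + (\<Sum>i\<in>UNIV. (M $ i)\<^sup>2)"
  have d: "d > 0" unfolding d_def by (intro add_pos_nonneg sum_nonneg) auto
  have "(1 / d) * (norm y)\<^sup>2 \<le> (norm (matrix_inv (diag (\<sigma> s)) *v y))\<^sup>2 \<and>
    (norm (matrix_inv (diag (\<sigma> s)) *v y))\<^sup>2 \<le> c * (norm y)\<^sup>2" if s: "s \<ge> 0" for s y
  proof -
    have pos: "\<sigma> s $ i > 0" for i using m[of i] \<sigma>[OF s, of i] by linarith
    then have "\<And>i. \<sigma> s $ i \<noteq> 0" by (metis less_irrefl)
    note inv = matrix_inv_diag_mult[OF this]
    have eq: "(norm (matrix_inv (diag (\<sigma> s)) *v y))\<^sup>2 = (\<Sum>i\<in>UNIV. (y $ i)\<^sup>2 * (1 / \<sigma> s $ i)\<^sup>2)"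
      by (simp add: inv norm_vec_power2 power_divide)
    have "(1 / d) * (y $ i)\<^sup>2 \<le> (y $ i)\<^sup>2 * (1 / \<sigma> s $ i)\<^sup>2 \<and> (y $ i)\<^sup>2 * (1 / \<sigma> s $ i)\<^sup>2 \<le> c * (y $ i)\<^sup>2" for i
    proof
      have "(\<sigma> s $ i)\<^sup>2 \<le> (M $ i)\<^sup>2" using pos[of i] \<sigma>[OF s, of i] by (intro power_mono) auto
      also have "\<dots> \<le> (\<Sum>i\<in>UNIV. (M $ i)\<^sup>2)" by (rule member_le_sum) auto
      finally have "(\<sigma> s $ i)\<^sup>2 \<le> d" by (simp add: d_def)
      then have "1 / d \<le> 1 / (\<sigma> s $ i)\<^sup>2" using pos[of i] by (intro divide_left_mono) (auto simp: d)
      then have "(1 / d) * (y $ i)\<^sup>2 \<le> 1 / (\<sigma> s $ i)\<^sup>2 * (y $ i)\<^sup>2" by (rule mult_right_mono) simp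
      then show "(1 / d) * (y $ i)\<^sup>2 \<le> (y $ i)\<^sup>2 * (1 / \<sigma> s $ i)\<^sup>2" by (simp add: power_divide mult.commute)
      have "(1 / \<sigma> s $ i)\<^sup>2 \<le> (1 / m $ i)\<^sup>2"
        using pos[of i] m[of i] \<sigma>[OF s, of i] by (intro power_mono divide_left_mono) auto
      also have "\<dots> \<le> c" unfolding c_def by (rule member_le_sum) auto
      finally show "(y $ i)\<^sup>2 * (1 / \<sigma> s $ i)\<^sup>2 \<le> c * (y $ i)\<^sup>2" by (simp add: mult.commute[of c] mult_left_mono)
    qed
    then show ?thesis
      unfolding eq norm_vec_power2[of y] sum_distrib_left by (auto intro: sum_mono)
  qed
  with d show ?thesis by (intro exI[of _ "1 / d"] conjI exI[of _ c]) auto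
qed

text \<open>In coordinates the inverse of the diagonal matrix becomes division by continuous
  nonvanishing functions on the interval.\<close>

lemma noise_coefficient_measurable:
  fixes f :: "real \<Rightarrow> real^'n"
  assumes noise: "noise_coefficient T m M \<sigma>" and f: "f \<in> borel_measurable (lebesgue_on {0..L})"
  shows "(\<lambda>s. (norm (matrix_inv (diag (\<sigma> s)) *v f s))\<^sup>2) \<in> borel_measurable (lebesgue_on {0..L})"
proof -
  have nz: "\<sigma> s $ i \<noteq> 0" if "s \<ge> 0" for s i
    using noise that unfolding noise_coefficient_def by (metis less_le_not_le order_trans)
  obtain \<sigma>' where "\<And>t. t \<ge> 0 \<Longrightarrow> (\<sigma> has_vector_derivative \<sigma>' t) (at t within {0..})"
    using noise unfolding noise_coefficient_def by blast
  then have "continuous_on {0..} \<sigma>"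
    unfolding continuous_on_eq_continuous_within by (auto intro: has_vector_derivative_continuous)
  then have \<sigma>c: "continuous_on {0..L} \<sigma>" by (rule continuous_on_subset) auto
  have meas: "(\<lambda>s. \<Sum>i\<in>UNIV. (f s \<bullet> axis i 1 / \<sigma> s $ i)\<^sup>2) \<in> borel_measurable (lebesgue_on {0..L})"
  proof (intro borel_measurable_sum borel_measurable_power borel_measurable_divide)
    show "(\<lambda>s. f s \<bullet> axis i 1) \<in> borel_measurable (lebesgue_on {0..L})" for i using f by measurable
    show "(\<lambda>s. \<sigma> s $ i) \<in> borel_measurable (lebesgue_on {0..L})" for i
      by (intro continuous_imp_measurable_on_sets_lebesgue continuous_intros \<sigma>c) simp
  qed
  have eq: "(norm (matrix_inv (diag (\<sigma> s)) *v f s))\<^sup>2 = (\<Sum>i\<in>UNIV. (f s \<bullet> axis i 1 / \<sigma> s $ i)\<^sup>2)"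
    if "s \<in> space (lebesgue_on {0..L})" for s
    using that by (simp add: matrix_inv_diag_mult[OF nz] norm_vec_power2 inner_axis power_divide)
  show ?thesis by (rule measurable_cong[THEN iffD1, OF eq[symmetric] meas])
qed

context hyperbolic_periodic_system
begin

lemma residual_energy:
  assumes \<eta>: "\<eta> \<in> H_half_0 L"
  shows "integrable (lebesgue_on {0..L}) (\<lambda>s. (norm (residual L \<eta> s))\<^sup>2)"
    and "(\<integral>s. (norm (residual L \<eta> s))\<^sup>2 \<partial>lebesgue_on {0..L}) = integral {0..L} (\<lambda>s. (norm (residual L \<eta> s))\<^sup>2)"
    and "0 \<le> integral {0..L} (\<lambda>s. (norm (residual L \<eta> s))\<^sup>2)"
proof -
  show i: "integrable (lebesgue_on {0..L}) (\<lambda>s. (norm (residual L \<eta> s))\<^sup>2)"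
    using H_half_0_linear_residual(2)[OF \<eta> A_cont] by (simp add: residual_def)
  show eq: "(\<integral>s. (norm (residual L \<eta> s))\<^sup>2 \<partial>lebesgue_on {0..L}) = integral {0..L} (\<lambda>s. (norm (residual L \<eta> s))\<^sup>2)"
    by (rule lebesgue_integral_eq_integral[OF i]) simp
  show "0 \<le> integral {0..L} (\<lambda>s. (norm (residual L \<eta> s))\<^sup>2)"
    unfolding eq[symmetric] by (rule Bochner_Integration.integral_nonneg) simp
qed

lemma transverse_part_energy:
  assumes \<eta>: "\<eta> \<in> H_half_0 L"
  shows "integrable (lebesgue_on {0..L}) (\<lambda>s. (norm (transverse_part \<eta> s))\<^sup>2)"
    and "(\<integral>s. (norm (transverse_part \<eta> s))\<^sup>2 \<partial>lebesgue_on {0..L}) = integral {0..L} (\<lambda>s. (norm (transverse_part \<eta> s))\<^sup>2)"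
proof -
  have "continuous_on {0..L} (transverse_part \<eta>)"
    using \<eta> by (intro transverse_part_continuous absolutely_continuous_fun_imp_continuous_on) (simp add: H_half_0_def)
  then show i: "integrable (lebesgue_on {0..L}) (\<lambda>s. (norm (transverse_part \<eta> s))\<^sup>2)"
    by (intro continuous_imp_integrable_real continuous_intros)
  show "(\<integral>s. (norm (transverse_part \<eta> s))\<^sup>2 \<partial>lebesgue_on {0..L}) = integral {0..L} (\<lambda>s. (norm (transverse_part \<eta> s))\<^sup>2)"
    by (rule lebesgue_integral_eq_integral[OF i]) simp
qed

end

lemma second_variation_lower_bound:
  fixes b :: "real^'n \<Rightarrow> real^'n" and X \<sigma> :: "real \<Rightarrow> real^'n"
  assumes sys: "hyperbolic_periodic_system (\<lambda>t. jacobian b (at (X t))) \<Phi> T a (\<lambda>t. b (X t)) l"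
    and b: "Cb 3 b" and X': "\<And>t. (X has_vector_derivative b (X t)) (at t)"
    and noise: "noise_coefficient T m M \<sigma>"
    and grad: "\<And>t. gradient (divergence b) (X t) = 0"
  shows "\<exists>\<epsilon>0>0. \<exists>\<mu>>0. \<forall>N::nat. \<forall>\<epsilon>. N \<ge> 1 \<and> 0 < \<epsilon> \<and> \<epsilon> < \<epsilon>0 \<longrightarrow> (\<forall>\<eta>\<in>H_half_0 (real N * T).
    \<mu> / (2 * \<epsilon>) * integral {0..real N * T}
      (\<lambda>s. (norm (hyperbolic_periodic_system.residual (\<lambda>t. jacobian b (at (X t))) (real N * T) \<eta> s))\<^sup>2)
    \<le> second_variation b \<sigma> X \<epsilon> (real N * T) \<eta>)"
proof -
  interpret hyperbolic_periodic_system "\<lambda>t. jacobian b (at (X t))" \<Phi> T a "\<lambda>t. b (X t)" l by (rule sys)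
  interpret mv: bounded_bilinear "(*v) :: real^'n^'n \<Rightarrow> real^'n \<Rightarrow> real^'n"
    by (rule bounded_bilinear_matrix_vector_mult)
  define g where "g = divergence b"
  define H where "H t = hessian g (X t)" for t
  have g: "Cb (Suc (Suc 0)) g" using Cb_divergence[of 2 b] b by (simp add: g_def numeral_2_eq_2 numeral_3_eq_3)
  obtain \<mu> \<nu> where \<mu>: "\<mu> > 0"
    and noise_b: "\<And>s y. s \<ge> 0 \<Longrightarrow> \<mu> * (norm y)\<^sup>2 \<le> (norm (matrix_inv (diag (\<sigma> s)) *v y))\<^sup>2"
      "\<And>s y. s \<ge> 0 \<Longrightarrow> (norm (matrix_inv (diag (\<sigma> s)) *v y))\<^sup>2 \<le> \<nu> * (norm y)\<^sup>2"
    using noise_coefficient_bounds[OF noise] by blast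
  obtain h where h: "\<And>x. norm (hessian g x) \<le> h" using Cb_hessian_bounded_continuous(2)[OF g] by blast
  obtain K where K: "K > 0" "\<And>X y. norm ((X :: real^'n^'n) *v (y :: real^'n)) \<le> norm X * norm y * K"
    using mv.pos_bounded by blast
  obtain C where C: "C > 0" "\<And>N \<eta>. N \<ge> (1::nat) \<Longrightarrow> \<eta>\<in>H_half_0 (real N * T) \<Longrightarrow>
     integral {0..real N * T} (\<lambda>s. (norm (transverse_part \<eta> s))\<^sup>2) \<le>
     C * integral {0..real N * T} (\<lambda>s. (norm (residual (real N * T) \<eta> s))\<^sup>2)"
    using transverse_estimate by blast
  define \<kappa> where "\<kappa> = h * K"
  have "h \<ge> 0" using h norm_ge_zero order_trans by blast
  then have \<kappa>0: "\<kappa> \<ge> 0" using K(1) by (simp add: \<kappa>_def)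
  have Xc: "continuous_on UNIV X"
    using X' by (auto simp: continuous_on_eq_continuous_at intro!: has_vector_derivative_continuous)
  have Hc: "continuous_on UNIV H"
    using continuous_on_compose2[OF Cb_hessian_bounded_continuous(1)[OF g] Xc] by (simp add: H_def[abs_def])
  have quad: "- (\<kappa> * (norm (transverse_part \<eta> s))\<^sup>2) \<le> \<eta> s \<bullet> (H s *v \<eta> s)" for \<eta> s
  proof -
    have sym: "transpose (H s) = H s" unfolding H_def by (rule hessian_symmetric[OF g])
    have ker: "H s *v b (X s) = 0"
      unfolding H_def by (rule hessian_mult_velocity[OF g X']) (use grad in \<open>simp add: g_def\<close>)
    have "\<eta> s \<bullet> (H s *v \<eta> s) = transverse_part \<eta> s \<bullet> (H s *v transverse_part \<eta> s)"
      unfolding transverse_part_def by (rule quadratic_form_kernel[OF sym ker])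
    moreover have "\<bar>transverse_part \<eta> s \<bullet> (H s *v transverse_part \<eta> s)\<bar> \<le> \<kappa> * (norm (transverse_part \<eta> s))\<^sup>2"
    proof -
      have "\<bar>transverse_part \<eta> s \<bullet> (H s *v transverse_part \<eta> s)\<bar> \<le> norm (transverse_part \<eta> s) * norm (H s *v transverse_part \<eta> s)"
        by (rule Cauchy_Schwarz_ineq2)
      also have "\<dots> \<le> norm (transverse_part \<eta> s) * (norm (H s) * norm (transverse_part \<eta> s) * K)"
        by (intro mult_left_mono K) simp
      also have "\<dots> \<le> norm (transverse_part \<eta> s) * (h * norm (transverse_part \<eta> s) * K)"
        using K(1) by (intro mult_left_mono mult_right_mono) (auto simp: H_def h)
      finally show ?thesis by (simp add: \<kappa>_def power2_eq_square mult_ac)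
    qed
    ultimately show ?thesis by linarith
  qed
  \<comment> \<open>Below this threshold \<open>\<epsilon> * (\<kappa> * C) \<le> \<mu>\<close>, so
    the potential term, at worst \<open>\<kappa> * C * F / 2\<close> in size, uses at most half of
    \<open>\<mu> / \<epsilon> * F\<close>. The added 1 covers \<open>\<kappa> = 0\<close>.\<close>
  define \<epsilon>0 where "\<epsilon>0 = \<mu> / (\<kappa> * C + 1)"
  have \<kappa>C: "\<kappa> * C \<ge> 0" using \<kappa>0 C(1) by simp
  have "\<epsilon>0 > 0" using \<mu> \<kappa>C by (simp add: \<epsilon>0_def add_nonneg_pos)
  moreover have "\<mu> / (2 * \<epsilon>) * integral {0..real N * T} (\<lambda>s. (norm (residual (real N * T) \<eta> s))\<^sup>2)
      \<le> second_variation b \<sigma> X \<epsilon> (real N * T) \<eta>"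
    if N: "N \<ge> 1" and \<epsilon>: "0 < \<epsilon>" "\<epsilon> < \<epsilon>0" and \<eta>: "\<eta> \<in> H_half_0 (real N * T)" for N \<epsilon> \<eta>
  proof -
    define L where "L = real N * T"
    define F where "F = integral {0..L} (\<lambda>s. (norm (residual L \<eta> s))\<^sup>2)"
    have \<eta>L: "\<eta> \<in> H_half_0 L" using \<eta> by (simp add: L_def)
    have F0: "F \<ge> 0" unfolding F_def by (rule residual_energy(3)[OF \<eta>L])
    have fm: "residual L \<eta> \<in> borel_measurable (lebesgue_on {0..L})"
      using H_half_0_linear_residual(1)[OF \<eta>L A_cont] by (simp add: residual_def[abs_def])
    have i1: "integrable (lebesgue_on {0..L}) (\<lambda>s. (norm (matrix_inv (diag (\<sigma> s)) *v residual L \<eta> s))\<^sup>2)"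
    proof (rule Bochner_Integration.integrable_bound[OF integrable_mult_right[OF residual_energy(1)[OF \<eta>L], of \<nu>]])
      show "(\<lambda>s. (norm (matrix_inv (diag (\<sigma> s)) *v residual L \<eta> s))\<^sup>2) \<in> borel_measurable (lebesgue_on {0..L})"
        by (rule noise_coefficient_measurable[OF noise fm])
      show "AE s in lebesgue_on {0..L}. norm ((norm (matrix_inv (diag (\<sigma> s)) *v residual L \<eta> s))\<^sup>2)
          \<le> norm (\<nu> * (norm (residual L \<eta> s))\<^sup>2)"
      proof (rule AE_I2)
        fix s assume "s \<in> space (lebesgue_on {0..L})"
        then have "(norm (matrix_inv (diag (\<sigma> s)) *v residual L \<eta> s))\<^sup>2 \<le> \<nu> * (norm (residual L \<eta> s))\<^sup>2"
          by (intro noise_b) simp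
        then show "norm ((norm (matrix_inv (diag (\<sigma> s)) *v residual L \<eta> s))\<^sup>2) \<le> norm (\<nu> * (norm (residual L \<eta> s))\<^sup>2)"
          by simp
      qed
    qed
    have "\<mu> * F = (\<integral>s. \<mu> * (norm (residual L \<eta> s))\<^sup>2 \<partial>lebesgue_on {0..L})"
      by (simp add: F_def residual_energy(2)[OF \<eta>L])
    also have "\<dots> \<le> (\<integral>s. (norm (matrix_inv (diag (\<sigma> s)) *v residual L \<eta> s))\<^sup>2 \<partial>lebesgue_on {0..L})"
      by (intro integral_mono i1 integrable_mult_right residual_energy(1)[OF \<eta>L] noise_b) simp
    finally have 1: "\<mu> * F \<le> (\<integral>s. (norm (matrix_inv (diag (\<sigma> s)) *v residual L \<eta> s))\<^sup>2 \<partial>lebesgue_on {0..L})" .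
    have \<eta>c: "continuous_on {0..L} \<eta>"
      using \<eta>L by (intro absolutely_continuous_fun_imp_continuous_on) (simp add: H_half_0_def)
    have i2: "integrable (lebesgue_on {0..L}) (\<lambda>s. \<eta> s \<bullet> (H s *v \<eta> s))"
      by (intro continuous_imp_integrable_real continuous_intros mv.continuous_on \<eta>c continuous_on_subset[OF Hc]) auto
    have "- (\<kappa> * (C * F)) \<le> - (\<kappa> * integral {0..L} (\<lambda>s. (norm (transverse_part \<eta> s))\<^sup>2))"
      using C(2)[OF N \<eta>] \<kappa>0 by (simp add: F_def L_def mult_left_mono)
    also have "\<dots> = (\<integral>s. - (\<kappa> * (norm (transverse_part \<eta> s))\<^sup>2) \<partial>lebesgue_on {0..L})"
      by (simp add: transverse_part_energy(2)[OF \<eta>L])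
    also have "\<dots> \<le> (\<integral>s. \<eta> s \<bullet> (H s *v \<eta> s) \<partial>lebesgue_on {0..L})"
      by (intro integral_mono i2 Bochner_Integration.integrable_minus integrable_mult_right transverse_part_energy(1)[OF \<eta>L] quad)
    finally have 2: "- (\<kappa> * C * F) \<le> (\<integral>s. \<eta> s \<bullet> (H s *v \<eta> s) \<partial>lebesgue_on {0..L})" by (simp add: mult.assoc)
    have "\<epsilon> * (\<kappa> * C) \<le> \<mu>"
    proof -
      have "\<epsilon> * (\<kappa> * C) \<le> \<epsilon> * (\<kappa> * C + 1)" using \<epsilon> by simp
      also have "\<dots> \<le> \<epsilon>0 * (\<kappa> * C + 1)" using \<epsilon> \<kappa>C by (intro mult_right_mono) auto
      also have "\<dots> = \<mu>" using \<kappa>C by (simp add: \<epsilon>0_def)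
      finally show ?thesis .
    qed
    then have "\<kappa> * C \<le> \<mu> / \<epsilon>" using \<epsilon> by (simp add: field_simps)
    then have 3: "\<kappa> * C * F \<le> \<mu> / \<epsilon> * F" using F0 by (rule mult_right_mono)
    have "second_variation b \<sigma> X \<epsilon> L \<eta> =
        1 / \<epsilon> * (\<integral>s. (norm (matrix_inv (diag (\<sigma> s)) *v residual L \<eta> s))\<^sup>2 \<partial>lebesgue_on {0..L})
        + 1 / 2 * (\<integral>s. \<eta> s \<bullet> (H s *v \<eta> s) \<partial>lebesgue_on {0..L})"
      by (simp add: second_variation_def residual_def H_def g_def)
    moreover have "1 / \<epsilon> * (\<mu> * F) \<le> 1 / \<epsilon> * (\<integral>s. (norm (matrix_inv (diag (\<sigma> s)) *v residual L \<eta> s))\<^sup>2 \<partial>lebesgue_on {0..L})"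
      using 1 \<epsilon> by (intro mult_left_mono) auto
    moreover have "1 / \<epsilon> * (\<mu> * F) = \<mu> / \<epsilon> * F" "\<mu> / (2 * \<epsilon>) * F = (\<mu> / \<epsilon> * F) / 2" by simp_all
    ultimately have "\<mu> / (2 * \<epsilon>) * F \<le> second_variation b \<sigma> X \<epsilon> L \<eta>" using 2 3 by linarith
    then show ?thesis by (simp add: F_def L_def)
  qed
  ultimately show ?thesis using \<mu> by blast
qed

section \<open>Floquet coordinates\<close>

lemma bounded_linear_cmat: "bounded_linear (cmat :: real^'n^'n \<Rightarrow> complex^'n^'n)"
  unfolding linear_conv_bounded_linear[symmetric]
  by (rule linearI; simp add: cmat_def vec_eq_iff) (simp add: scaleR_conv_of_real)

lemma bounded_linear_cvec: "bounded_linear (cvec :: real^'n \<Rightarrow> complex^'n)"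
  unfolding linear_conv_bounded_linear[symmetric]
  by (rule linearI; simp add: cvec_def vec_eq_iff) (simp add: scaleR_conv_of_real)

lemma cmat_matrix_mult: "cmat (A ** B) = cmat A ** cmat B"
  by (simp add: cmat_def matrix_matrix_mult_def vec_eq_iff)

text \<open>The projection behind \<open>transverse\<close>, isolated as a linear map so that
  derivatives pass through it.\<close>

definition delete_coord :: "'n \<Rightarrow> complex^'n \<Rightarrow> complex^'n" where
  "delete_coord k y = (\<chi> i. if i = k then 0 else y $ i)"

lemma bounded_linear_delete_coord: "bounded_linear (delete_coord k)"
  unfolding linear_conv_bounded_linear[symmetric]
  by (rule linearI) (simp_all add: delete_coord_def vec_eq_iff)

lemma norm_delete_coord_le: "norm (delete_coord k y) \<le> norm y"
  unfolding norm_vec_def by (rule L2_set_mono) (simp_all add: delete_coord_def)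

text \<open>Only the majorant \<open>F\<close> must be integrable: should the square of
  \<open>norm (g s)\<close> fail to be, its Bochner integral is 0 by convention and nonnegativity of
  \<open>F\<close> preserves the inequality.\<close>

lemma norm_L2_power2_le:
  assumes F: "integrable (lebesgue_on {0..L}) F" and nonneg: "\<And>s. 0 \<le> F s"
    and E: "negligible E" "\<And>s. s \<in> {0..L} - E \<Longrightarrow> (norm (g s))\<^sup>2 \<le> F s"
  shows "(norm_L2 L g)\<^sup>2 \<le> (\<integral>s. F s \<partial>lebesgue_on {0..L})"
proof -
  have "(norm_L2 L g)\<^sup>2 = (\<integral>s. (norm (g s))\<^sup>2 \<partial>lebesgue_on {0..L})"
    unfolding norm_L2_def by (simp add: Bochner_Integration.integral_nonneg)
  also have "\<dots> \<le> (\<integral>s. F s \<partial>lebesgue_on {0..L})"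
  proof (rule integral_mono_AE'[OF F])
    have "E \<inter> {0..L} \<in> null_sets (lebesgue_on {0..L})"
      using negligible_subset[OF E(1), of "E \<inter> {0..L}"]
      by (simp add: null_sets_restrict_space negligible_iff_null_sets)
    then show "AE s in lebesgue_on {0..L}. (norm (g s))\<^sup>2 \<le> F s"
      by (rule AE_I') (use E(2) in auto)
  qed (simp add: nonneg)
  finally show ?thesis .
qed

context hyperbolic_periodic_system
begin

context
  fixes P :: "real \<Rightarrow> complex^'n^'n" and R :: "complex^'n^'n" and k :: 'n
  assumes simple: "order 1 (charpoly (cmat (\<Phi> T))) = 1"
    and P_periodic: "\<And>t. P (t + T) = P t" and P_inv: "\<And>t. invertible (P t)"
    and P_column: "\<And>t. column k (P t) = cvec (v t)"
    and P_deriv: "\<And>t. (P has_vector_derivative (cmat (A t) ** P t - P t ** R)) (at t)"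
    and R_zero: "\<And>i. R $ i $ k = 0" "\<And>i. R $ k $ i = 0"
begin

abbreviation Q :: "real \<Rightarrow> complex^'n^'n" where "Q t \<equiv> matrix_inv (P t)"

lemma P_continuous: "continuous_on UNIV P"
  using P_deriv by (auto simp: continuous_on_eq_continuous_at intro!: has_vector_derivative_continuous)

lemma Q_deriv: "(Q has_vector_derivative (R ** Q t - Q t ** cmat (A t))) (at t)"
proof -
  interpret mm: bounded_bilinear "(**) :: complex^'n^'n \<Rightarrow> complex^'n^'n \<Rightarrow> complex^'n^'n"
    by (rule bounded_bilinear_matrix_mult)
  have "Q t ** (cmat (A t) ** P t - P t ** R) ** Q t = Q t ** cmat (A t) ** (P t ** Q t) - (Q t ** P t) ** R ** Q t"
    by (simp only: mm.diff_left mm.diff_right matrix_mul_assoc)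
  then have "- (Q t ** (cmat (A t) ** P t - P t ** R) ** Q t) = R ** Q t - Q t ** cmat (A t)"
    by (simp add: matrix_inv_mult P_inv)
  then show ?thesis using has_vector_derivative_matrix_inv[OF P_inv P_continuous P_deriv[of t]] by simp
qed

lemma R_row: "(R *v y) $ k = 0"
  by (simp add: matrix_vector_mult_def R_zero)

lemma R_delete_coord: "R *v delete_coord k y = R *v y"
  unfolding matrix_vector_mult_def vec_eq_iff by (auto simp: delete_coord_def R_zero intro!: sum.cong)

text \<open>Row \<open>k\<close> of \<open>R\<close> vanishes, so the tangential coordinate of any
  solution of the variational equation is constant.\<close>

lemma Q_row_flow: "(Q t *v (cmat (\<Phi> t) *v y)) $ k = (Q 0 *v y) $ k"
proof -
  interpret mv: bounded_bilinear "(*v) :: complex^'n^'n \<Rightarrow> complex^'n \<Rightarrow> complex^'n"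
    by (rule bounded_bilinear_matrix_vector_mult)
  define h where "h t = (Q t *v (cmat (\<Phi> t) *v y)) $ k" for t
  have h': "(h has_vector_derivative 0) (at t)" for t
  proof -
    define w where "w = cmat (\<Phi> t) *v y"
    have "((\<lambda>t. cmat (\<Phi> t) *v y) has_vector_derivative cmat (A t) *v w) (at t)"
      using bounded_linear.has_vector_derivative[OF mv.bounded_linear_left
          bounded_linear.has_vector_derivative[OF bounded_linear_cmat \<Phi>_deriv[of t]], of y]
      by (simp add: cmat_matrix_mult w_def matrix_vector_mul_assoc)
    from mv.has_vector_derivative[OF Q_deriv this]
    have "((\<lambda>t. Q t *v (cmat (\<Phi> t) *v y)) has_vector_derivative R *v (Q t *v w)) (at t)"
      by (simp add: w_def[symmetric] mv.diff_left matrix_vector_mul_assoc)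
    from bounded_linear.has_vector_derivative[OF bounded_linear_vec_nth this, of k]
    show ?thesis by (simp add: h_def[abs_def] R_row)
  qed
  have "h t = h 0"
  proof (rule has_vector_derivative_zero_constant[of UNIV h])
    fix c assume "\<And>t. t \<in> UNIV \<Longrightarrow> h t = c"
    then show "h t = h 0" by simp
  qed (use h' in auto)
  then show ?thesis by (simp add: h_def \<Phi>_0) (simp add: cmat_def mat_def matrix_vector_mult_def if_distrib[of "\<lambda>x. x * _"] if_distrib[of complex_of_real] cong: if_cong)
qed

text \<open>The tangential row of \<open>P\<^sup>-\<^sup>1\<close> is invariant under the adjoint flow, so it is the left eigenvector
  \<open>l\<close> of the monodromy matrix: all Floquet matrices yield the same tangential coordinate.\<close>
lemma Q_row: "(Q t *v cvec x) $ k = complex_of_real (l \<bullet> (\<Psi> t *v x))"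
proof -
  define q where "q = Q 0 $ k"
  have q: "dotc q y = (Q 0 *v y) $ k" for y
    by (simp add: dotc_def q_def matrix_vector_mult_def)
  have col: "P 0 *v axis k 1 = cvec (v 0)"
    using P_column[of 0] by (simp add: column_def matrix_vector_mult_def axis_def vec_eq_iff if_distrib cong: if_cong)
  have qv: "dotc q (cvec (v 0)) = 1"
    unfolding q col[symmetric] by (simp add: matrix_vector_mul_assoc matrix_inv_mult P_inv axis_def)
  \<comment> \<open>Periodicity of \<open>P\<close> turns constancy along the flow over one period
    into invariance under the monodromy matrix.\<close>
  have qU: "dotc q (cmat (\<Phi> T) *v y) = dotc q y" for y
    unfolding q using Q_row_flow[of T y] P_periodic[of 0] by simp
  have v: "cmat (\<Phi> T) *v cvec (v 0) = cvec (v 0)" "cvec (v 0) \<noteq> 0"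
    using l_v by (auto simp: cmat_mult_cvec monodromy_v) (auto simp: cvec_def vec_eq_iff inner_vec_def)
  have "q = cvec l"
    by (rule simple_eigenvalue_left_unique[OF simple v qv _ qU dotc_cvec_left_fixed[OF l_monodromy]])
      (simp add: dotc_cvec l_v)
  \<comment> \<open>Writing \<open>x\<close> as the image of \<open>\<Psi> t *v x\<close> under the
    flow moves the row back to time 0, where it is \<open>q\<close>.\<close>
  have "(Q t *v cvec x) $ k = (Q t *v (cmat (\<Phi> t) *v cvec (\<Psi> t *v x))) $ k"
    by (simp add: cmat_mult_cvec)
  also have "\<dots> = dotc q (cvec (\<Psi> t *v x))" by (simp add: Q_row_flow q)
  finally show ?thesis by (simp add: \<open>q = cvec l\<close> dotc_cvec)
qed

text \<open>\<open>P s\<close> sends the \<open>k\<close>-th unit vector to the velocity, so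
  removing the tangential part from \<eta> sets exactly the \<open>k\<close>-th coordinate to
  0.\<close>

lemma transverse_eq: "transverse k P \<eta> s = Q s *v cvec (transverse_part \<eta> s)"
proof -
  have "P s *v axis k 1 = cvec (v s)"
    using P_column[of s] by (simp add: column_def matrix_vector_mult_def axis_def vec_eq_iff if_distrib cong: if_cong)
  from arg_cong[OF this, of "\<lambda>y. Q s *v y"]
  have Qv: "Q s *v cvec (v s) = axis k 1" by (simp add: matrix_vector_mul_assoc matrix_inv_mult P_inv)
  have "cvec (transverse_part \<eta> s) = cvec (\<eta> s) - complex_of_real (tangential_part \<eta> s) *s cvec (v s)"
    by (simp add: transverse_part_def cvec_def vec_eq_iff)
  then have "Q s *v cvec (transverse_part \<eta> s) = Q s *v cvec (\<eta> s) - (Q s *v cvec (\<eta> s)) $ k *s axis k 1"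
    by (simp add: matrix_vector_mult_diff_distrib vec.scale Qv Q_row tangential_part_def)
  then show ?thesis
    by (auto simp: transverse_def floquet_coord_def vec_eq_iff axis_def)
qed

lemma Q_bound: "\<exists>c>0. \<forall>s\<ge>0. \<forall>y. norm (Q s *v y) \<le> c * norm y"
proof -
  interpret mv: bounded_bilinear "(*v) :: complex^'n^'n \<Rightarrow> complex^'n \<Rightarrow> complex^'n"
    by (rule bounded_bilinear_matrix_vector_mult)
  obtain K where K: "K > 0" "\<And>X y. norm ((X :: complex^'n^'n) *v (y :: complex^'n)) \<le> norm X * norm y * K"
    using mv.pos_bounded by blast
  have "continuous_on UNIV Q" using continuous_on_matrix_inv[OF P_inv P_continuous] .
  then obtain c where c: "c > 0" "\<And>s. s \<ge> 0 \<Longrightarrow> norm (Q s) \<le> c"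
    using periodic_bounded[OF T, of Q] P_periodic by auto
  have "norm (Q s *v y) \<le> (c * K) * norm y" if "s \<ge> 0" for s y
  proof -
    have "norm (Q s *v y) \<le> norm (Q s) * norm y * K" by (rule K)
    also have "\<dots> \<le> c * norm y * K" using that c(2) K(1) by (intro mult_right_mono) auto
    finally show ?thesis by (simp add: mult_ac)
  qed
  then show ?thesis using c(1) K(1) by (intro exI[of _ "c * K"]) auto
qed

lemma floquet_coord_deriv:
  assumes "(\<eta> has_vector_derivative \<eta>') (at s within S)"
  shows "(floquet_coord P \<eta> has_vector_derivative
    Q s *v cvec (\<eta>' - A s *v \<eta> s) + R *v floquet_coord P \<eta> s) (at s within S)"
proof -
  interpret mv: bounded_bilinear "(*v) :: complex^'n^'n \<Rightarrow> complex^'n \<Rightarrow> complex^'n"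
    by (rule bounded_bilinear_matrix_vector_mult)
  interpret cv: bounded_linear "cvec :: real^'n \<Rightarrow> complex^'n" by (rule bounded_linear_cvec)
  have "((\<lambda>s. Q s *v cvec (\<eta> s)) has_vector_derivative
      Q s *v cvec \<eta>' + (R ** Q s - Q s ** cmat (A s)) *v cvec (\<eta> s)) (at s within S)"
    by (intro mv.has_vector_derivative has_vector_derivative_at_within[OF Q_deriv] cv.has_vector_derivative assms)
  also have "Q s *v cvec \<eta>' + (R ** Q s - Q s ** cmat (A s)) *v cvec (\<eta> s) =
      Q s *v cvec (\<eta>' - A s *v \<eta> s) + R *v (Q s *v cvec (\<eta> s))"
    by (simp add: mv.diff_left mv.diff_right cv.diff cmat_mult_cvec[symmetric] matrix_vector_mul_assoc)
  finally show ?thesis by (simp add: floquet_coord_def[abs_def])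
qed

lemma floquet_norms_le:
  "\<exists>C>0. \<forall>N::nat. N \<ge> 1 \<longrightarrow> (\<forall>\<eta>\<in>H_half_0 (real N * T).
    (norm_L2 (real N * T) (deriv_on (real N * T) (tangential k P \<eta>)))\<^sup>2 + (norm_H1 (real N * T) (transverse k P \<eta>))\<^sup>2
    \<le> C * integral {0..real N * T} (\<lambda>s. (norm (residual (real N * T) \<eta> s))\<^sup>2))"
proof -
  interpret mv: bounded_bilinear "(*v) :: complex^'n^'n \<Rightarrow> complex^'n \<Rightarrow> complex^'n"
    by (rule bounded_bilinear_matrix_vector_mult)
  obtain c where c: "c > 0" "\<And>s y. s \<ge> 0 \<Longrightarrow> norm (Q s *v y) \<le> c * norm y"
    using Q_bound by blast
  obtain r where r: "r > 0" "\<And>y. norm (R *v y) \<le> norm y * r"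
    using bounded_linear.pos_bounded[OF mv.bounded_linear_right[of R]] by blast
  obtain C where C: "C > 0" "\<And>N \<eta>. N \<ge> (1::nat) \<Longrightarrow> \<eta>\<in>H_half_0 (real N * T) \<Longrightarrow>
     integral {0..real N * T} (\<lambda>s. (norm (transverse_part \<eta> s))\<^sup>2) \<le>
     C * integral {0..real N * T} (\<lambda>s. (norm (residual (real N * T) \<eta> s))\<^sup>2)"
    using transverse_estimate by blast
  \<comment> \<open>The three groups bound, in this order, the derivative of the tangential
    coordinate, the transverse coordinates, and their derivative.\<close>
  define C1 where "C1 = c\<^sup>2 + c\<^sup>2 * C + (2 * c\<^sup>2 + 2 * (r * c)\<^sup>2 * C)"
  have "C1 > 0" unfolding C1_def using c(1) C(1) by (intro add_pos_nonneg add_nonneg_nonneg) auto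
  moreover have "(norm_L2 (real N * T) (deriv_on (real N * T) (tangential k P \<eta>)))\<^sup>2 + (norm_H1 (real N * T) (transverse k P \<eta>))\<^sup>2
    \<le> C1 * integral {0..real N * T} (\<lambda>s. (norm (residual (real N * T) \<eta> s))\<^sup>2)"
    if N: "N \<ge> 1" and \<eta>: "\<eta> \<in> H_half_0 (real N * T)" for N \<eta>
  proof -
    define L where "L = real N * T"
    define f where "f s = norm (residual L \<eta> s)" for s
    define z where "z s = norm (transverse_part \<eta> s)" for s
    define F where "F = integral {0..L} (\<lambda>s. (f s)\<^sup>2)"
    have L: "L > 0" using N T by (simp add: L_def)
    have \<eta>L: "\<eta> \<in> H_half_0 L" using \<eta> by (simp add: L_def)
    note fi = residual_energy(1,2)[OF \<eta>L, folded f_def] and zi = transverse_part_energy[OF \<eta>L, folded z_def]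
    have zF: "integral {0..L} (\<lambda>s. (z s)\<^sup>2) \<le> C * F"
      using C(2)[OF N \<eta>] by (simp add: F_def f_def z_def L_def)
    obtain E where E: "negligible E" "\<And>s. s \<in> {0..L} - E \<Longrightarrow> (\<eta> has_vector_derivative deriv_on L \<eta> s) (at s within {0..L})"
      using H_half_0_derivative[OF \<eta>L L] by blast
    have coord: "(floquet_coord P \<eta> has_vector_derivative
        Q s *v cvec (residual L \<eta> s) + R *v floquet_coord P \<eta> s) (at s within {0..L})" if "s \<in> {0..L} - E" for s
      unfolding residual_def by (rule floquet_coord_deriv[OF E(2)[OF that]])
    have Qf: "norm (Q s *v cvec (residual L \<eta> s)) \<le> c * f s" if "s \<in> {0..L} - E" for s
      using c(2)[of s "cvec (residual L \<eta> s)"] that by (simp add: norm_cvec f_def)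
    have z_le: "norm (transverse k P \<eta> s) \<le> c * z s" if "s \<in> {0..L}" for s
      using c(2)[of s "cvec (transverse_part \<eta> s)"] that by (simp add: norm_cvec z_def transverse_eq)
    have "(norm_L2 L (deriv_on L (tangential k P \<eta>)))\<^sup>2 \<le> (\<integral>s. c\<^sup>2 * (f s)\<^sup>2 \<partial>lebesgue_on {0..L})"
    proof (rule norm_L2_power2_le[OF integrable_mult_right[OF fi(1)] _ E(1)])
      fix s assume s: "s \<in> {0..L} - E"
      \<comment> \<open>The zero row of \<open>R\<close> removes the undifferentiated coordinates,
        so the tangential derivative is governed by the residual alone.\<close>
      have "(tangential k P \<eta> has_vector_derivative (Q s *v cvec (residual L \<eta> s)) $ k) (at s within {0..L})"
        using bounded_linear.has_vector_derivative[OF bounded_linear_vec_nth coord[OF s], of k]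
        by (simp add: tangential_def[abs_def] R_row)
      then have "deriv_on L (tangential k P \<eta>) s = (Q s *v cvec (residual L \<eta> s)) $ k"
        using s L by (intro vector_derivative_within_closed_interval) auto
      then have "norm (deriv_on L (tangential k P \<eta>) s) \<le> c * f s"
        using Qf[OF s] Finite_Cartesian_Product.norm_nth_le order_trans by metis
      then show "(norm (deriv_on L (tangential k P \<eta>) s))\<^sup>2 \<le> c\<^sup>2 * (f s)\<^sup>2"
        using power_mono[of _ "c * f s" 2] by (simp add: power_mult_distrib)
    qed simp
    also have "\<dots> = c\<^sup>2 * F" by (simp add: fi(2) F_def)
    finally have 1: "(norm_L2 L (deriv_on L (tangential k P \<eta>)))\<^sup>2 \<le> c\<^sup>2 * F" .
    have "(norm_L2 L (transverse k P \<eta>))\<^sup>2 \<le> (\<integral>s. c\<^sup>2 * (z s)\<^sup>2 \<partial>lebesgue_on {0..L})"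
    proof (rule norm_L2_power2_le[OF integrable_mult_right[OF zi(1)] _ E(1)])
      fix s assume "s \<in> {0..L} - E"
      then show "(norm (transverse k P \<eta> s))\<^sup>2 \<le> c\<^sup>2 * (z s)\<^sup>2"
        using power_mono[OF z_le, of s 2] by (simp add: power_mult_distrib)
    qed simp
    also have "\<dots> = c\<^sup>2 * integral {0..L} (\<lambda>s. (z s)\<^sup>2)" by (simp add: zi(2))
    also have "\<dots> \<le> c\<^sup>2 * (C * F)" by (intro mult_left_mono zF) simp
    finally have 2: "(norm_L2 L (transverse k P \<eta>))\<^sup>2 \<le> c\<^sup>2 * C * F" by (simp add: mult.assoc)
    have "(norm_L2 L (deriv_on L (transverse k P \<eta>)))\<^sup>2 \<le> (\<integral>s. 2 * c\<^sup>2 * (f s)\<^sup>2 + 2 * (r * c)\<^sup>2 * (z s)\<^sup>2 \<partial>lebesgue_on {0..L})"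
    proof (rule norm_L2_power2_le[OF Bochner_Integration.integrable_add[OF integrable_mult_right[OF fi(1)] integrable_mult_right[OF zi(1)]] _ E(1)])
      fix s assume s: "s \<in> {0..L} - E"
      have tr: "transverse k P \<eta> = (\<lambda>s. delete_coord k (floquet_coord P \<eta> s))"
        by (simp add: transverse_def[abs_def] delete_coord_def)
      let ?D = "delete_coord k (Q s *v cvec (residual L \<eta> s) + R *v floquet_coord P \<eta> s)"
      have "(transverse k P \<eta> has_vector_derivative ?D) (at s within {0..L})"
        unfolding tr by (rule bounded_linear.has_vector_derivative[OF bounded_linear_delete_coord coord[OF s]])
      then have "deriv_on L (transverse k P \<eta>) s = ?D"
        using s L by (intro vector_derivative_within_closed_interval) auto
      \<comment> \<open>The zero column of \<open>R\<close> keeps the uncontrolled tangential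
        coordinate out of the transverse derivative.\<close>
      moreover have "R *v floquet_coord P \<eta> s = R *v transverse k P \<eta> s"
        by (simp add: tr R_delete_coord)
      ultimately have "norm (deriv_on L (transverse k P \<eta>) s) \<le> norm (Q s *v cvec (residual L \<eta> s)) + norm (R *v transverse k P \<eta> s)"
        using norm_delete_coord_le norm_triangle_ineq order_trans by metis
      also have "\<dots> \<le> c * f s + (c * z s) * r"
        using s r z_le[of s] by (intro add_mono Qf order_trans[OF r(2)] mult_right_mono) auto
      finally have "(norm (deriv_on L (transverse k P \<eta>) s))\<^sup>2 \<le> (c * f s + (c * z s) * r)\<^sup>2"
        by (intro power_mono) auto
      also have "\<dots> \<le> 2 * (c * f s)\<^sup>2 + 2 * ((c * z s) * r)\<^sup>2"
        using sum_squares_bound[of "c * f s" "(c * z s) * r"] by (simp add: power2_sum)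
      finally show "(norm (deriv_on L (transverse k P \<eta>) s))\<^sup>2 \<le> 2 * c\<^sup>2 * (f s)\<^sup>2 + 2 * (r * c)\<^sup>2 * (z s)\<^sup>2"
        by (simp add: power_mult_distrib mult_ac)
    qed simp
    also have "\<dots> = 2 * c\<^sup>2 * F + 2 * (r * c)\<^sup>2 * integral {0..L} (\<lambda>s. (z s)\<^sup>2)"
      by (subst Bochner_Integration.integral_add[OF integrable_mult_right[OF fi(1)] integrable_mult_right[OF zi(1)]])
        (simp add: fi(2) zi(2) F_def)
    also have "\<dots> \<le> 2 * c\<^sup>2 * F + 2 * (r * c)\<^sup>2 * (C * F)"
      by (intro add_left_mono mult_left_mono zF) simp
    finally have 3: "(norm_L2 L (deriv_on L (transverse k P \<eta>)))\<^sup>2 \<le> (2 * c\<^sup>2 + 2 * (r * c)\<^sup>2 * C) * F"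
      by (simp add: algebra_simps)
    have "(norm_H1 L (transverse k P \<eta>))\<^sup>2 = (norm_L2 L (transverse k P \<eta>))\<^sup>2 + (norm_L2 L (deriv_on L (transverse k P \<eta>)))\<^sup>2"
      unfolding norm_H1_def by (simp add: add_nonneg_nonneg)
    moreover have "C1 * F = c\<^sup>2 * F + c\<^sup>2 * C * F + (2 * c\<^sup>2 + 2 * (r * c)\<^sup>2 * C) * F"
      by (simp add: C1_def distrib_right)
    ultimately have "(norm_L2 L (deriv_on L (tangential k P \<eta>)))\<^sup>2 + (norm_H1 L (transverse k P \<eta>))\<^sup>2 \<le> C1 * F"
      using 1 2 3 by linarith
    then show ?thesis by (simp add: F_def f_def L_def)
  qed
  ultimately show ?thesis by blast
qed

end
end

section \<open>Positivity of the second variation\<close>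

theorem theorem5p4:
  fixes b :: "real^'n \<Rightarrow> real^'n"
    and \<sigma> X :: "real \<Rightarrow> real^'n"
    and m M x0 :: "real^'n"
    and T :: real
    and k :: 'n
  assumes dim: "CARD('n) \<ge> 2"
    and b: "Cb 3 b"
    and sigma: "noise_coefficient T m M \<sigma>"
    and orbit: "periodic_orbit b T x0 X"
    and hyp: "transversally_hyperbolic b T X"
    and grad_div: "\<forall>t. gradient (divergence b) (X t) = 0"
  shows "\<exists>\<epsilon>0>0.
    (\<forall>N::nat. \<forall>\<epsilon>. N \<ge> 1 \<and> 0 < \<epsilon> \<and> \<epsilon> < \<epsilon>0 \<longrightarrow>
       (\<forall>\<eta>\<in>H_half_0 (real N * T). (\<exists>t\<in>{0..real N * T}. \<eta> t \<noteq> 0) \<longrightarrow>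
          second_variation b \<sigma> X \<epsilon> (real N * T) \<eta> > 0)) \<and>
    (\<forall>P R. floquet_matrix b T X k P R \<longrightarrow>
       (\<forall>\<epsilon>. 0 < \<epsilon> \<and> \<epsilon> < \<epsilon>0 \<longrightarrow>
         (\<exists>c>0. \<forall>N::nat. N \<ge> 1 \<longrightarrow>
           (\<forall>\<eta>\<in>H_half_0 (real N * T). (\<exists>t\<in>{0..real N * T}. \<eta> t \<noteq> 0) \<longrightarrow>
              second_variation b \<sigma> X \<epsilon> (real N * T) \<eta> \<ge>
                c * ((norm_L2 (real N * T) (deriv_on (real N * T) (tangential k P \<eta>)))\<^sup>2
                     + (norm_H1 (real N * T) (transverse k P \<eta>))\<^sup>2)))))"
proof -
  have X': "(X has_vector_derivative b (X t)) (at t)" for t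
    using orbit by (simp add: periodic_orbit_def)
  have "Cb (Suc 2) b" using b by (simp add: numeral_2_eq_2 numeral_3_eq_3)
  from orbit_system[OF this orbit hyp] obtain \<Phi> a l where
    sys: "hyperbolic_periodic_system (\<lambda>t. jacobian b (at (X t))) \<Phi> T a (\<lambda>t. b (X t)) l"
    and simple: "order 1 (charpoly (cmat (\<Phi> T))) = 1" by blast
  interpret hyperbolic_periodic_system "\<lambda>t. jacobian b (at (X t))" \<Phi> T a "\<lambda>t. b (X t)" l
    by (rule sys)
  obtain \<epsilon>0 \<mu> where \<epsilon>0: "\<epsilon>0 > 0" and \<mu>: "\<mu> > 0"
    and lower: "\<And>N \<epsilon> \<eta>. N \<ge> (1::nat) \<Longrightarrow> 0 < \<epsilon> \<Longrightarrow> \<epsilon> < \<epsilon>0 \<Longrightarrow> \<eta> \<in> H_half_0 (real N * T) \<Longrightarrow>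
      \<mu> / (2 * \<epsilon>) * integral {0..real N * T} (\<lambda>s. (norm (residual (real N * T) \<eta> s))\<^sup>2)
      \<le> second_variation b \<sigma> X \<epsilon> (real N * T) \<eta>"
    using second_variation_lower_bound[OF sys b X' sigma grad_div[rule_format]] by blast
  show ?thesis
  proof (rule exI[of _ \<epsilon>0], intro conjI allI impI ballI)
    show "\<epsilon>0 > 0" by (rule \<epsilon>0)
  next
    fix N :: nat and \<epsilon> :: real and \<eta> :: "real \<Rightarrow> real^'n"
    assume N\<epsilon>: "1 \<le> N \<and> 0 < \<epsilon> \<and> \<epsilon> < \<epsilon>0" and \<eta>: "\<eta> \<in> H_half_0 (real N * T)"
      and nz: "\<exists>t\<in>{0..real N * T}. \<eta> t \<noteq> 0"
    let ?F = "integral {0..real N * T} (\<lambda>s. (norm (residual (real N * T) \<eta> s))\<^sup>2)"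
    have "?F \<noteq> 0" using residual_zero_imp_zero[OF _ \<eta>] N\<epsilon> nz by blast
    then have "?F > 0" using residual_energy(3)[OF \<eta>] by simp
    then have "0 < \<mu> / (2 * \<epsilon>) * ?F" using \<mu> N\<epsilon> by simp
    also have "\<dots> \<le> second_variation b \<sigma> X \<epsilon> (real N * T) \<eta>" using N\<epsilon> by (intro lower \<eta>) auto
    finally show "0 < second_variation b \<sigma> X \<epsilon> (real N * T) \<eta>" .
  next
    fix P R \<epsilon>
    assume fl: "floquet_matrix b T X k P R" and \<epsilon>: "0 < \<epsilon> \<and> \<epsilon> < \<epsilon>0"
    have vd: "vector_derivative X (at t) = b (X t)" for t
      by (rule vector_derivative_at[OF X'])
    obtain C where C: "C > 0" "\<And>N \<eta>. N \<ge> (1::nat) \<Longrightarrow> \<eta> \<in> H_half_0 (real N * T) \<Longrightarrow>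
      (norm_L2 (real N * T) (deriv_on (real N * T) (tangential k P \<eta>)))\<^sup>2 + (norm_H1 (real N * T) (transverse k P \<eta>))\<^sup>2
      \<le> C * integral {0..real N * T} (\<lambda>s. (norm (residual (real N * T) \<eta> s))\<^sup>2)"
      using floquet_norms_le[OF simple, of P k R] fl unfolding floquet_matrix_def vd by blast
    show "\<exists>c>0. \<forall>N\<ge>1. \<forall>\<eta>\<in>H_half_0 (real N * T). (\<exists>t\<in>{0..real N * T}. \<eta> t \<noteq> 0) \<longrightarrow>
        c * ((norm_L2 (real N * T) (deriv_on (real N * T) (tangential k P \<eta>)))\<^sup>2 +
          (norm_H1 (real N * T) (transverse k P \<eta>))\<^sup>2)
        \<le> second_variation b \<sigma> X \<epsilon> (real N * T) \<eta>"
    \<comment> \<open>The second variation is at least \<open>\<mu> / (2 * \<epsilon>)\<close> times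
      the residual energy, and the Floquet norms are at most \<open>C\<close> times it; both
      constants were fixed before \<open>N\<close>.\<close>
    proof (intro exI[of _ "\<mu> / (2 * \<epsilon>) / C"] conjI allI impI ballI)
      show "\<mu> / (2 * \<epsilon>) / C > 0" using \<mu> \<epsilon> C(1) by simp
      fix N :: nat and \<eta> :: "real \<Rightarrow> real^'n"
      assume N: "1 \<le> N" and \<eta>: "\<eta> \<in> H_half_0 (real N * T)"
      let ?F = "integral {0..real N * T} (\<lambda>s. (norm (residual (real N * T) \<eta> s))\<^sup>2)"
      have "\<mu> / (2 * \<epsilon>) / C * ((norm_L2 (real N * T) (deriv_on (real N * T) (tangential k P \<eta>)))\<^sup>2 +
          (norm_H1 (real N * T) (transverse k P \<eta>))\<^sup>2) \<le> \<mu> / (2 * \<epsilon>) / C * (C * ?F)"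
        using \<mu> \<epsilon> C(1) by (intro mult_left_mono C(2) N \<eta>) auto
      also have "\<dots> = \<mu> / (2 * \<epsilon>) * ?F" using C(1) by simp
      also have "\<dots> \<le> second_variation b \<sigma> X \<epsilon> (real N * T) \<eta>" using \<epsilon> by (intro lower N \<eta>) auto
      finally show "\<mu> / (2 * \<epsilon>) / C * ((norm_L2 (real N * T) (deriv_on (real N * T) (tangential k P \<eta>)))\<^sup>2 +
          (norm_H1 (real N * T) (transverse k P \<eta>))\<^sup>2) \<le> second_variation b \<sigma> X \<epsilon> (real N * T) \<eta>" .
    qed
  qed
qed

end
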